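(* Let $(R,\mathbf m)$ be a countable excellent normal local domain of dimension $d\ge 2$, let $y$ be a nonzero element of $\mathbf m$, and let $R^*$ denote the $(y)$-adic completion of $R$. Then there exists an element $\tau\in yR^*$ that is primarily limit-intersecting in $y$ over $R$.
   Context: Definition. Let $R$ be an excellent normal local domain, $y$ a nonzero element of its maximal ideal, and $R^*$ the $(y)$-adic completion of $R$. Elements $\tau_1,\dots,\tau_s\in yR^*$ that are algebraically independent over $R$ are said to be primarily limit-intersecting in $y$ over $R$ if the inclusion map $R[\tau_1,\dots,\tau_s]\hookrightarrow R^*[1/y]$ is flat. (For a single element $\tau\in yR^*$: $\tau$ is algebraically independent over $R$ and $R[\tau]\hookrightarrow R^*[1/y]$ is flat.) *)

theory Defs
  imports
    "HOL-Algebra.Algebra"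
    "HOL-Algebra.Generated_Rings"
    "HOL-Algebra.Ideal_Product"
    "HOL-Algebra.Ring_Divisibility"
    "HOL-Algebra.Finite_Extensions"
    "HOL-Library.Extended_Nat"
    "HOL-Library.Countable_Set"
begin

text \<open>
  All rings are commutative with one and are given by carriers, as in HOL-Algebra.

  Several notions below quantify over all finitely generated algebras, all finite field extensions
  or all modules over a ring with elements in \<open>'a\<close>. HOL cannot quantify over types inside a
  definition, so these structures are taken with carriers in \<open>'a list\<close>. That type is infinite and
  at least as large as \<open>'a\<close>; as a finitely generated algebra, a finite field extension or a finitely
  generated module over a ring \<open>A\<close> has at most \<open>max |A| \<aleph>\<^sub>0\<close> elements, each has an isomorphic copy
  there. For flatness, testing finitely generated modules suffices.
\<close>


section \<open>Prime ideals, dimension, local rings\<close>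

definition krull_dim :: "('a, 'c) ring_scheme \<Rightarrow> enat" where
  "krull_dim A = Sup {enat n | n. \<exists>P :: nat \<Rightarrow> 'a set.
     (\<forall>i\<le>n. primeideal (P i) A) \<and> (\<forall>i<n. P i \<subset> P (Suc i))}"

definition local_ring :: "('a, 'c) ring_scheme \<Rightarrow> 'a set \<Rightarrow> bool" where
  "local_ring A m \<longleftrightarrow> cring A \<and> maximalideal m A \<and> (\<forall>n. maximalideal n A \<longrightarrow> n = m)"

definition saturated_prime_chain ::
    "('a, 'c) ring_scheme \<Rightarrow> 'a set \<Rightarrow> 'a set \<Rightarrow> nat \<Rightarrow> (nat \<Rightarrow> 'a set) \<Rightarrow> bool" where
  "saturated_prime_chain A P Q n C \<longleftrightarrow>
     C 0 = P \<and> C n = Q \<and> (\<forall>i\<le>n. primeideal (C i) A) \<and> (\<forall>i<n. C i \<subset> C (Suc i)) \<and>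
     (\<forall>i<n. \<not> (\<exists>I. primeideal I A \<and> C i \<subset> I \<and> I \<subset> C (Suc i)))"

definition catenary_ring :: "('a, 'c) ring_scheme \<Rightarrow> bool" where
  "catenary_ring A \<longleftrightarrow>
     (\<forall>P Q. primeideal P A \<and> primeideal Q A \<and> P \<subseteq> Q \<longrightarrow>
        (\<exists>!n. \<exists>C. saturated_prime_chain A P Q n C))"


section \<open>Localization\<close>

definition loc_rel :: "('a, 'c) ring_scheme \<Rightarrow> 'a set \<Rightarrow> (('a \<times> 'a) \<times> ('a \<times> 'a)) set" where
  "loc_rel A S = {((a, s), (b, t)). a \<in> carrier A \<and> s \<in> S \<and> b \<in> carrier A \<and> t \<in> S \<and>
     (\<exists>u\<in>S. u \<otimes>\<^bsub>A\<^esub> (t \<otimes>\<^bsub>A\<^esub> a) = u \<otimes>\<^bsub>A\<^esub> (s \<otimes>\<^bsub>A\<^esub> b))}"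

definition fraction :: "('a, 'c) ring_scheme \<Rightarrow> 'a set \<Rightarrow> 'a \<Rightarrow> 'a \<Rightarrow> ('a \<times> 'a) set" where
  "fraction A S a s = loc_rel A S `` {(a, s)}"

definition localization :: "('a, 'c) ring_scheme \<Rightarrow> 'a set \<Rightarrow> ('a \<times> 'a) set ring" where
  "localization A S =
     \<lparr>carrier = (carrier A \<times> S) // loc_rel A S,
      monoid.mult = (\<lambda>p q. \<Union>(a, s)\<in>p. \<Union>(b, t)\<in>q. fraction A S (a \<otimes>\<^bsub>A\<^esub> b) (s \<otimes>\<^bsub>A\<^esub> t)),
      monoid.one = fraction A S \<one>\<^bsub>A\<^esub> \<one>\<^bsub>A\<^esub>,
      ring.zero = fraction A S \<zero>\<^bsub>A\<^esub> \<one>\<^bsub>A\<^esub>,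
      ring.add = (\<lambda>p q. \<Union>(a, s)\<in>p. \<Union>(b, t)\<in>q.
               fraction A S (t \<otimes>\<^bsub>A\<^esub> a \<oplus>\<^bsub>A\<^esub> s \<otimes>\<^bsub>A\<^esub> b) (s \<otimes>\<^bsub>A\<^esub> t))\<rparr>"

definition loc_map :: "('a, 'c) ring_scheme \<Rightarrow> 'a set \<Rightarrow> 'a \<Rightarrow> ('a \<times> 'a) set" where
  "loc_map A S a = fraction A S a \<one>\<^bsub>A\<^esub>"

definition localization_at_prime :: "('a, 'c) ring_scheme \<Rightarrow> 'a set \<Rightarrow> ('a \<times> 'a) set ring" where
  "localization_at_prime A P = localization A (carrier A - P)"

definition powers_of :: "('a, 'c) ring_scheme \<Rightarrow> 'a \<Rightarrow> 'a set" where
  "powers_of A y = {y [^]\<^bsub>A\<^esub> n | n :: nat. True}"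

definition nonzero_elements :: "('a, 'c) ring_scheme \<Rightarrow> 'a set" where
  "nonzero_elements A = carrier A - {\<zero>\<^bsub>A\<^esub>}"

definition residue_field_at :: "('a, 'c) ring_scheme \<Rightarrow> 'a set \<Rightarrow> ('a set \<times> 'a set) set ring" where
  "residue_field_at A P = localization (A Quot P) (nonzero_elements (A Quot P))"

definition residue_map :: "('a, 'c) ring_scheme \<Rightarrow> 'a set \<Rightarrow> 'a \<Rightarrow> ('a set \<times> 'a set) set" where
  "residue_map A P a = loc_map (A Quot P) (nonzero_elements (A Quot P)) (P +>\<^bsub>A\<^esub> a)"


section \<open>Normal domains\<close>

definition integral_over :: "('a, 'c) ring_scheme \<Rightarrow> 'a set \<Rightarrow> 'a \<Rightarrow> bool" where
  "integral_over B K x \<longleftrightarrow>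
     (\<exists>p \<in> carrier (K[X]\<^bsub>B\<^esub>). p \<noteq> [] \<and> hd p = \<one>\<^bsub>B\<^esub> \<and> ring.eval B p x = \<zero>\<^bsub>B\<^esub>)"

definition normal_domain :: "('a, 'c) ring_scheme \<Rightarrow> bool" where
  "normal_domain A \<longleftrightarrow> domain A \<and>
     (let S = nonzero_elements A; A' = loc_map A S ` carrier A in
      \<forall>x \<in> carrier (localization A S). integral_over (localization A S) A' x \<longrightarrow> x \<in> A')"


section \<open>Adic completion\<close>

primrec ideal_power :: "('a, 'c) ring_scheme \<Rightarrow> 'a set \<Rightarrow> nat \<Rightarrow> 'a set" where
  "ideal_power A I 0 = carrier A"
| "ideal_power A I (Suc n) = ideal_prod A I (ideal_power A I n)"

text \<open>The inverse limit of the rings \<open>A/I\<^sup>n\<close>: as \<open>I\<^sup>n\<^sup>+\<^sup>1 \<subseteq> I\<^sup>n\<close>, the transition map sends a coset of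
  \<open>I\<^sup>n\<^sup>+\<^sup>1\<close> to the coset of \<open>I\<^sup>n\<close> containing it.\<close>

definition adic_completion :: "('a, 'c) ring_scheme \<Rightarrow> 'a set \<Rightarrow> (nat \<Rightarrow> 'a set) ring" where
  "adic_completion A I =
     \<lparr>carrier = {x. \<forall>n. x n \<in> carrier (A Quot ideal_power A I n) \<and> x (Suc n) \<subseteq> x n},
      monoid.mult = (\<lambda>x y n. x n \<otimes>\<^bsub>A Quot ideal_power A I n\<^esub> y n),
      monoid.one = (\<lambda>n. \<one>\<^bsub>A Quot ideal_power A I n\<^esub>),
      ring.zero = (\<lambda>n. \<zero>\<^bsub>A Quot ideal_power A I n\<^esub>),
      ring.add = (\<lambda>x y n. x n \<oplus>\<^bsub>A Quot ideal_power A I n\<^esub> y n)\<rparr>"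

definition completion_map :: "('a, 'c) ring_scheme \<Rightarrow> 'a set \<Rightarrow> 'a \<Rightarrow> (nat \<Rightarrow> 'a set)" where
  "completion_map A I a = (\<lambda>n. ideal_power A I n +>\<^bsub>A\<^esub> a)"


section \<open>Tensor products and flatness\<close>

definition algebra_via ::
    "('a \<Rightarrow> 'b) \<Rightarrow> ('b, 'c) ring_scheme \<Rightarrow> ('a, 'b) module" where
  "algebra_via f B =
     \<lparr>carrier = carrier B, monoid.mult = monoid.mult B, monoid.one = monoid.one B, ring.zero = ring.zero B, ring.add = ring.add B,
      smult = (\<lambda>a b. f a \<otimes>\<^bsub>B\<^esub> b)\<rparr>"

definition module_maps ::
    "('a, 'c) ring_scheme \<Rightarrow> ('a, 'm, 'd) module_scheme \<Rightarrow> ('a, 'n, 'e) module_scheme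
      \<Rightarrow> ('m \<Rightarrow> 'n) set" where
  "module_maps A M N = {f \<in> carrier M \<rightarrow> carrier N.
     (\<forall>x\<in>carrier M. \<forall>y\<in>carrier M. f (x \<oplus>\<^bsub>M\<^esub> y) = f x \<oplus>\<^bsub>N\<^esub> f y) \<and>
     (\<forall>a\<in>carrier A. \<forall>x\<in>carrier M. f (a \<odot>\<^bsub>M\<^esub> x) = a \<odot>\<^bsub>N\<^esub> f x)}"

definition tensor_relators ::
    "('a, 'c) ring_scheme \<Rightarrow> ('a, 'm, 'd) module_scheme \<Rightarrow> ('a, 'n, 'e) module_scheme
      \<Rightarrow> ('m \<times> 'n \<Rightarrow>\<^sub>0 int) set" where
  "tensor_relators A M N =
     {frag_of (x \<oplus>\<^bsub>M\<^esub> x', y) - frag_of (x, y) - frag_of (x', y) | x x' y.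
        x \<in> carrier M \<and> x' \<in> carrier M \<and> y \<in> carrier N} \<union>
     {frag_of (x, y \<oplus>\<^bsub>N\<^esub> y') - frag_of (x, y) - frag_of (x, y') | x y y'.
        x \<in> carrier M \<and> y \<in> carrier N \<and> y' \<in> carrier N} \<union>
     {frag_of (a \<odot>\<^bsub>M\<^esub> x, y) - frag_of (x, a \<odot>\<^bsub>N\<^esub> y) | a x y.
        a \<in> carrier A \<and> x \<in> carrier M \<and> y \<in> carrier N}"

definition tensor_null ::
    "('a, 'c) ring_scheme \<Rightarrow> ('a, 'm, 'd) module_scheme \<Rightarrow> ('a, 'n, 'e) module_scheme
      \<Rightarrow> ('m \<times> 'n \<Rightarrow>\<^sub>0 int) set" where
  "tensor_null A M N =
     generate (free_Abelian_group (carrier M \<times> carrier N)) (tensor_relators A M N)"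

definition tensor_group ::
    "('a, 'c) ring_scheme \<Rightarrow> ('a, 'm, 'd) module_scheme \<Rightarrow> ('a, 'n, 'e) module_scheme
      \<Rightarrow> ('m \<times> 'n \<Rightarrow>\<^sub>0 int) set monoid" where
  "tensor_group A M N =
     free_Abelian_group (carrier M \<times> carrier N) Mod tensor_null A M N"

text \<open>The map \<open>f \<otimes> id : M \<otimes> N \<rightarrow> M' \<otimes> N\<close> induced by a linear map \<open>f : M \<rightarrow> M'\<close>.\<close>

definition tensor_map ::
    "('a, 'c) ring_scheme \<Rightarrow> ('a, 'm', 'd) module_scheme \<Rightarrow> ('a, 'n, 'e) module_scheme
      \<Rightarrow> ('m \<Rightarrow> 'm') \<Rightarrow> ('m \<times> 'n \<Rightarrow>\<^sub>0 int) set \<Rightarrow> ('m' \<times> 'n \<Rightarrow>\<^sub>0 int) set" where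
  "tensor_map A M' N f w =
     (\<Union>u\<in>w. tensor_null A M' N #>\<^bsub>free_Abelian_group (carrier M' \<times> carrier N)\<^esub>
              frag_extend (\<lambda>(x, y). frag_of (f x, y)) u)"

definition flat_module :: "('a, 'c) ring_scheme \<Rightarrow> ('a, 'n, 'e) module_scheme \<Rightarrow> bool" where
  "flat_module A N \<longleftrightarrow> module A N \<and>
     (\<forall>(M :: ('a, 'a list) module) (M' :: ('a, 'a list) module) f.
        module A M \<and> module A M' \<and> f \<in> module_maps A M M' \<and> inj_on f (carrier M) \<longrightarrow>
        inj_on (tensor_map A M' N f) (carrier (tensor_group A M N)))"

definition flat_hom ::
    "('a, 'c) ring_scheme \<Rightarrow> ('b, 'd) ring_scheme \<Rightarrow> ('a \<Rightarrow> 'b) \<Rightarrow> bool" where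
  "flat_hom A B f \<longleftrightarrow> cring A \<and> cring B \<and> f \<in> ring_hom A B \<and> flat_module A (algebra_via f B)"

text \<open>The tensor product \<open>B \<otimes>\<^sub>A C\<close> of \<open>A\<close>-algebras, presented as the integral monoid ring of the
  multiplicative monoid \<open>B \<times> C\<close> modulo the ideal generated by the bilinearity relators.\<close>

definition pair_monoid_ring ::
    "('b, 'd) ring_scheme \<Rightarrow> ('c, 'e) ring_scheme \<Rightarrow> ('b \<times> 'c \<Rightarrow>\<^sub>0 int) ring" where
  "pair_monoid_ring B C =
     \<lparr>carrier = {u. Poly_Mapping.keys u \<subseteq> carrier B \<times> carrier C},
      monoid.mult = (\<lambda>u v. frag_extend (\<lambda>(b, c).
                frag_extend (\<lambda>(b', c'). frag_of (b \<otimes>\<^bsub>B\<^esub> b', c \<otimes>\<^bsub>C\<^esub> c')) v) u),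
      monoid.one = frag_of (\<one>\<^bsub>B\<^esub>, \<one>\<^bsub>C\<^esub>),
      ring.zero = 0,
      ring.add = (+)\<rparr>"

definition tensor_ideal ::
    "('a, 'r) ring_scheme \<Rightarrow> ('a, 'b, 'd) module_scheme \<Rightarrow> ('a, 'c, 'e) module_scheme
      \<Rightarrow> ('b \<times> 'c \<Rightarrow>\<^sub>0 int) set" where
  "tensor_ideal A B C = Idl\<^bsub>pair_monoid_ring B C\<^esub> (tensor_relators A B C)"

definition tensor_ring ::
    "('a, 'r) ring_scheme \<Rightarrow> ('a, 'b, 'd) module_scheme \<Rightarrow> ('a, 'c, 'e) module_scheme
      \<Rightarrow> ('b \<times> 'c \<Rightarrow>\<^sub>0 int) set ring" where
  "tensor_ring A B C = pair_monoid_ring B C Quot tensor_ideal A B C"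

definition tensor_inl ::
    "('a, 'r) ring_scheme \<Rightarrow> ('a, 'b, 'd) module_scheme \<Rightarrow> ('a, 'c, 'e) module_scheme
      \<Rightarrow> 'b \<Rightarrow> ('b \<times> 'c \<Rightarrow>\<^sub>0 int) set" where
  "tensor_inl A B C b = tensor_ideal A B C +>\<^bsub>pair_monoid_ring B C\<^esub> frag_of (b, \<one>\<^bsub>C\<^esub>)"


section \<open>Regular rings and regular homomorphisms\<close>

definition regular_local_ring :: "('a, 'c) ring_scheme \<Rightarrow> bool" where
  "regular_local_ring A \<longleftrightarrow> noetherian_ring A \<and>
     (\<exists>m E. local_ring A m \<and> E \<subseteq> carrier A \<and> finite E \<and> m = Idl\<^bsub>A\<^esub> E \<and>
            enat (card E) = krull_dim A)"

definition regular_ring :: "('a, 'c) ring_scheme \<Rightarrow> bool" where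
  "regular_ring A \<longleftrightarrow> cring A \<and> noetherian_ring A \<and>
     (\<forall>P. primeideal P A \<longrightarrow> regular_local_ring (localization_at_prime A P))"

definition geometrically_regular ::
    "('k, 'c) ring_scheme \<Rightarrow> ('b, 'd) ring_scheme \<Rightarrow> ('k \<Rightarrow> 'b) \<Rightarrow> bool" where
  "geometrically_regular k B g \<longleftrightarrow> field k \<and> cring B \<and> g \<in> ring_hom k B \<and>
     (\<forall>(L :: 'k list ring) h.
        field L \<and> h \<in> ring_hom k L \<and> ring.finite_dimension L (h ` carrier k) (carrier L) \<longrightarrow>
        regular_ring (tensor_ring k (algebra_via g B) (algebra_via h L)))"

definition regular_hom ::
    "('a, 'c) ring_scheme \<Rightarrow> ('b, 'd) ring_scheme \<Rightarrow> ('a \<Rightarrow> 'b) \<Rightarrow> bool" where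
  "regular_hom A B f \<longleftrightarrow> flat_hom A B f \<and>
     (\<forall>P. primeideal P A \<longrightarrow>
        (let K = algebra_via (residue_map A P) (residue_field_at A P); B' = algebra_via f B in
         geometrically_regular (residue_field_at A P) (tensor_ring A K B') (tensor_inl A K B')))"


section \<open>Excellent rings\<close>

definition finitely_generated_algebra ::
    "('a, 'c) ring_scheme \<Rightarrow> ('b, 'd) ring_scheme \<Rightarrow> ('a \<Rightarrow> 'b) \<Rightarrow> bool" where
  "finitely_generated_algebra A B f \<longleftrightarrow> cring B \<and> f \<in> ring_hom A B \<and>
     (\<exists>E. finite E \<and> E \<subseteq> carrier B \<and> carrier B = generate_ring B (f ` carrier A \<union> E))"

definition universally_catenary :: "('a, 'c) ring_scheme \<Rightarrow> bool" where
  "universally_catenary A \<longleftrightarrow>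
     (\<forall>(B :: 'a list ring) f. finitely_generated_algebra A B f \<longrightarrow> catenary_ring B)"

definition G_ring :: "('a, 'c) ring_scheme \<Rightarrow> bool" where
  "G_ring A \<longleftrightarrow>
     (\<forall>P m. primeideal P A \<and> maximalideal m (localization_at_prime A P) \<longrightarrow>
        regular_hom (localization_at_prime A P)
          (adic_completion (localization_at_prime A P) m)
          (completion_map (localization_at_prime A P) m))"

definition spec :: "('a, 'c) ring_scheme \<Rightarrow> 'a set set" where
  "spec A = {P. primeideal P A}"

definition zariski_open :: "('a, 'c) ring_scheme \<Rightarrow> 'a set set \<Rightarrow> bool" where
  "zariski_open A U \<longleftrightarrow> (\<exists>I. ideal I A \<and> U = {P \<in> spec A. \<not> I \<subseteq> P})"

definition regular_locus :: "('a, 'c) ring_scheme \<Rightarrow> 'a set set" where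
  "regular_locus A = {P \<in> spec A. regular_local_ring (localization_at_prime A P)}"

definition J2_ring :: "('a, 'c) ring_scheme \<Rightarrow> bool" where
  "J2_ring A \<longleftrightarrow>
     (\<forall>(B :: 'a list ring) f. finitely_generated_algebra A B f \<longrightarrow>
        zariski_open B (regular_locus B))"

definition excellent_ring :: "('a, 'c) ring_scheme \<Rightarrow> bool" where
  "excellent_ring A \<longleftrightarrow> cring A \<and> noetherian_ring A \<and>
     universally_catenary A \<and> G_ring A \<and> J2_ring A"


section \<open>Primarily limit-intersecting elements\<close>

definition y_completion :: "('a, 'c) ring_scheme \<Rightarrow> 'a \<Rightarrow> (nat \<Rightarrow> 'a set) ring" where
  "y_completion R y = adic_completion R (PIdl\<^bsub>R\<^esub> y)"

definition y_completion_map :: "('a, 'c) ring_scheme \<Rightarrow> 'a \<Rightarrow> 'a \<Rightarrow> (nat \<Rightarrow> 'a set)" where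
  "y_completion_map R y = completion_map R (PIdl\<^bsub>R\<^esub> y)"

text \<open>In the situation of interest \<open>R\<close> is a Noetherian local domain and \<open>y\<close> is not a unit, so
  \<open>R \<rightarrow> R\<^sup>*\<close> is injective and \<open>R\<close> is identified with its image \<open>R'\<close>.\<close>

definition primarily_limit_intersecting ::
    "('a, 'c) ring_scheme \<Rightarrow> 'a \<Rightarrow> (nat \<Rightarrow> 'a set) \<Rightarrow> bool" where
  "primarily_limit_intersecting R y \<tau> \<longleftrightarrow>
     (let Rs = y_completion R y;
          R' = y_completion_map R y ` carrier R;
          ys = y_completion_map R y y;
          R\<tau> = Rs\<lparr>carrier := generate_ring Rs (R' \<union> {\<tau>})\<rparr>;
          S = powers_of Rs ys
      in \<tau> \<in> PIdl\<^bsub>Rs\<^esub> ys \<and>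
         ring.transcendental Rs R' \<tau> \<and>
         flat_hom R\<tau> (localization Rs S) (loc_map Rs S))"

end

theory Submission
  imports Defs
begin

text \<open>
  Write \<open>C\<close> for the completion \<open>R\<^sup>*\<close>. By the equational criterion, \<open>\<tau>\<close> is primarily
  limit-intersecting as soon as, for every finite family \<open>f\<close> in \<open>R[X]\<close>, each relation
  \<open>\<Sum> f\<^sub>i(\<tau>) x\<^sub>i = 0\<close> over \<open>C\<close> is, up to a power of \<open>y\<close>, a \<open>C\<close>-combination of values at \<open>\<tau>\<close> of
  syzygies of \<open>f\<close> over \<open>R[X]\<close>; the case of a single polynomial gives transcendence.

  Let \<open>L\<close> be the \<open>y\<close>-saturation of the ideal \<open>J\<close> generated by \<open>f\<close>, so \<open>y\<^sup>m L \<subseteq> J\<close>. Near any point of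
  \<open>R\<close> there is a \<open>t\<close> in \<open>R\<close> such that \<open>X - t\<close> is a nonzerodivisor modulo \<open>L\<close>, and then \<open>y\<^sup>m\<close> times a
  syzygy of \<open>f(t)\<close> lifts to a syzygy of \<open>f\<close>. If \<open>\<tau>\<close> is close enough to \<open>t\<close>, the Artin-Rees property
  of the ideal generated by \<open>f(t)\<close> lets a relation at \<open>\<tau>\<close> be approximated by a syzygy of \<open>f(t)\<close>; hence
  \<open>y\<^sup>m x = \<sigma>(\<tau>) + y\<^sup>m\<^sup>+\<^sup>1 x'\<close> with a syzygy \<open>\<sigma>\<close> of \<open>f\<close> and a relation \<open>x'\<close> at \<open>\<tau>\<close>. Iterating and
  summing in \<open>C\<close> shows that \<open>x\<close> is a combination of syzygies as required. As \<open>R[X]\<close> is countable, a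
  \<open>y\<close>-adically convergent sequence of points meets these conditions for all \<open>f\<close>.
\<close>

section \<open>Linear forms and finitely generated ideals\<close>

text \<open>The obstacle is that flatness imposes infinitely many conditions on one element. Each is
  put into a form that is open and dense for the \<open>y\<close>-adic topology: every ball contains
  a smaller ball on all of which it holds, so countably many can be met by nested balls, as in
  Baire's theorem. Losing a fixed power \<open>y^m\<close> is harmless because \<open>y\<close> is
  inverted in the target.

  Regularity of \<open>X - t\<close> modulo the saturation \<open>L\<close> is what makes lifting
  work: a syzygy of \<open>f(t)\<close>, read as a vector of constants, pairs with \<open>f\<close>
  to an element of \<open>J\<close> vanishing at \<open>t\<close>, hence of the form
  \<open>(X - t) g\<close>. Regularity forces \<open>g\<close> into \<open>L\<close>, so
  \<open>y^m g\<close> lies in \<open>J\<close> and the defect can be subtracted. The Artin-Rees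
  property is only needed as stationarity of the colon ideals of \<open>(f(t))\<close> by powers of
  \<open>y\<close>. The summation in \<open>C\<close> is done one coordinate at a time, from the
  last one down, so that only ideals of \<open>R[X]\<close>, and not modules of syzygies, have to be
  finitely generated.\<close>

primrec dot :: "('a, 'c) ring_scheme \<Rightarrow> nat \<Rightarrow> (nat \<Rightarrow> 'a) \<Rightarrow> (nat \<Rightarrow> 'a) \<Rightarrow> 'a" where
  "dot R 0 f x = \<zero>\<^bsub>R\<^esub>"
| "dot R (Suc k) f x = dot R k f x \<oplus>\<^bsub>R\<^esub> f k \<otimes>\<^bsub>R\<^esub> x k"

lemma dot_carrier_update [simp]: "dot (R\<lparr>carrier := K\<rparr>) k f x = dot R k f x"
  by (induction k) auto

text \<open>A finite family is encoded as a total function whose first \<open>k\<close> values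
  count. The other values are merely kept in the carrier, so that closure conditions carry no index
  bounds; this rule lets them be altered.\<close>

lemma dot_cong: "(\<And>i. i < k \<Longrightarrow> f i = g i) \<Longrightarrow> (\<And>i. i < k \<Longrightarrow> x i = z i) \<Longrightarrow> dot R k f x = dot R k g z"
  by (induction k) auto

lemma (in ring) dot_closed [simp]:
  "\<forall>i. f i \<in> carrier R \<Longrightarrow> \<forall>i. x i \<in> carrier R \<Longrightarrow> dot R k f x \<in> carrier R"
  by (induction k) auto

lemma (in ring) dot_zero: "\<forall>i. f i \<in> carrier R \<Longrightarrow> dot R k f (\<lambda>i. \<zero>) = \<zero>"
  by (induction k) auto

lemma (in ring) dot_add:
  assumes "\<forall>i. f i \<in> carrier R" "\<forall>i. x i \<in> carrier R" "\<forall>i. z i \<in> carrier R"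
  shows "dot R k f (\<lambda>i. x i \<oplus> z i) = dot R k f x \<oplus> dot R k f z"
proof (induction k)
  case (Suc k)
  have c: "f k \<in> carrier R" "x k \<in> carrier R" "z k \<in> carrier R"
    "dot R k f x \<in> carrier R" "dot R k f z \<in> carrier R" using assms by auto
  show ?case unfolding dot.simps Suc using c by (simp add: r_distr a_ac)
qed simp

lemma (in cring) dot_smult:
  assumes "\<forall>i. f i \<in> carrier R" "\<forall>i. x i \<in> carrier R" "c \<in> carrier R"
  shows "dot R k f (\<lambda>i. c \<otimes> x i) = c \<otimes> dot R k f x"
proof (induction k)
  case (Suc k)
  have c: "f k \<in> carrier R" "x k \<in> carrier R" "dot R k f x \<in> carrier R" using assms by auto
  show ?case unfolding dot.simps Suc using c assms(3) by (simp add: r_distr m_ac)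
qed (use assms in simp)

lemma (in cring) dot_commute:
  assumes "\<forall>i. f i \<in> carrier R" "\<forall>i. x i \<in> carrier R"
  shows "dot R k f x = dot R k x f"
  by (induction k) (use assms in \<open>simp_all add: m_comm\<close>)

lemma (in ring) dot_minus:
  assumes "\<forall>i. f i \<in> carrier R" "\<forall>i. x i \<in> carrier R" "\<forall>i. z i \<in> carrier R"
  shows "dot R k f (\<lambda>i. x i \<ominus> z i) = dot R k f x \<ominus> dot R k f z"
proof -
  have "x i = (x i \<ominus> z i) \<oplus> z i" for i
    using assms by (simp add: a_minus_def a_assoc l_neg)
  then have "dot R k f x = dot R k f (\<lambda>i. (x i \<ominus> z i) \<oplus> z i)" by simp
  also have "\<dots> = dot R k f (\<lambda>i. x i \<ominus> z i) \<oplus> dot R k f z"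
    by (rule dot_add) (use assms in auto)
  finally have e: "dot R k f x = dot R k f (\<lambda>i. x i \<ominus> z i) \<oplus> dot R k f z" .
  have "dot R k f x \<in> carrier R" "dot R k f z \<in> carrier R" "dot R k f (\<lambda>i. x i \<ominus> z i) \<in> carrier R"
    using assms by auto
  then show ?thesis unfolding e by (simp add: a_minus_def a_assoc r_neg)
qed

lemma ring_hom_dot:
  assumes "ring R" "ring S" "h \<in> ring_hom R S" "\<forall>i. f i \<in> carrier R" "\<forall>i. x i \<in> carrier R"
  shows "h (dot R k f x) = dot S k (\<lambda>i. h (f i)) (\<lambda>i. h (x i))"
proof -
  interpret R: ring R by fact
  interpret S: ring S by fact
  interpret ring_hom_ring R S h by (rule ring_hom_ringI2) fact+
  show ?thesis by (induction k) (use assms in simp_all)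
qed

lemma ring_hom_pow:
  assumes "ring R" "ring S" "h \<in> ring_hom R S" "x \<in> carrier R"
  shows "h (x [^]\<^bsub>R\<^esub> (n::nat)) = h x [^]\<^bsub>S\<^esub> n"
proof -
  interpret R: ring R by fact
  interpret S: ring S by fact
  interpret ring_hom_ring R S h by (rule ring_hom_ringI2) fact+
  show ?thesis by (induction n) (use assms in simp_all)
qed

lemma (in cring) pow_cancel:
  assumes y: "y \<in> carrier R" and cancel: "\<And>c. c \<in> carrier R \<Longrightarrow> y \<otimes> c = \<zero> \<Longrightarrow> c = \<zero>"
    and "c \<in> carrier R" "y [^] (n::nat) \<otimes> c = \<zero>"
  shows "c = \<zero>"
  using assms(3,4)
proof (induction n)
  case (Suc n)
  have "y \<otimes> (y [^] n \<otimes> c) = \<zero>" using Suc.prems y by (simp add: m_lcomm m_assoc)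
  then have "y [^] n \<otimes> c = \<zero>" by (rule cancel[rotated]) (use Suc.prems(1) y in simp)
  then show ?case by (rule Suc.IH[OF Suc.prems(1)])
qed simp

text \<open>Negatives come for free as multiples by minus one, and commutativity makes absorption on
  one side enough.\<close>

lemma (in cring) idealI_comm:
  assumes "I \<subseteq> carrier R" "\<zero> \<in> I" "\<And>a b. a \<in> I \<Longrightarrow> b \<in> I \<Longrightarrow> a \<oplus> b \<in> I"
    "\<And>a c. a \<in> I \<Longrightarrow> c \<in> carrier R \<Longrightarrow> c \<otimes> a \<in> I"
  shows "ideal I R"
proof (rule idealI)
  show "ring R" by (rule ring_axioms)
  show "subgroup I (add_monoid R)"
  proof (rule add.subgroupI)
    fix a assume "a \<in> I"
    then have "(\<ominus> \<one>) \<otimes> a \<in> I" "a \<in> carrier R" using assms by auto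
    then show "\<ominus> a \<in> I" by (simp add: l_minus)
  qed (use assms in auto)
  fix a x assume "a \<in> I" "x \<in> carrier R"
  then show "x \<otimes> a \<in> I" "a \<otimes> x \<in> I" using assms by (auto simp: m_comm subset_iff)
qed

definition dot_span :: "('a, 'c) ring_scheme \<Rightarrow> nat \<Rightarrow> (nat \<Rightarrow> 'a) \<Rightarrow> 'a set" where
  "dot_span R k f = {dot R k f g | g. \<forall>i. g i \<in> carrier R}"

lemma (in cring) dot_span_ideal:
  assumes "\<forall>i. f i \<in> carrier R"
  shows "ideal (dot_span R k f) R"
proof (rule idealI_comm)
  show "dot_span R k f \<subseteq> carrier R" unfolding dot_span_def using assms by auto
  show "\<zero> \<in> dot_span R k f" unfolding dot_span_def using dot_zero[OF assms, of k, symmetric] by (auto intro!: exI[of _ "\<lambda>i. \<zero>"])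
next
  fix a b assume "a \<in> dot_span R k f" "b \<in> dot_span R k f"
  then obtain g h where "a = dot R k f g" "b = dot R k f h" "\<forall>i. g i \<in> carrier R" "\<forall>i. h i \<in> carrier R"
    unfolding dot_span_def by auto
  then show "a \<oplus> b \<in> dot_span R k f" unfolding dot_span_def using assms
    by (auto intro!: exI[of _ "\<lambda>i. g i \<oplus> h i"] simp: dot_add)
next
  fix a c assume "a \<in> dot_span R k f" "c \<in> carrier R"
  then obtain g where "a = dot R k f g" "\<forall>i. g i \<in> carrier R"
    unfolding dot_span_def by auto
  then show "c \<otimes> a \<in> dot_span R k f" unfolding dot_span_def using assms \<open>c \<in> carrier R\<close>
    by (auto intro!: exI[of _ "\<lambda>i. c \<otimes> g i"] simp: dot_smult)
qed

lemma (in cring) dot_span_gen: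
  assumes f: "\<forall>i. f i \<in> carrier R" and "i < k"
  shows "f i \<in> dot_span R k f"
proof -
  have "dot R k f (\<lambda>j. if j = i then \<one> else \<zero>) = (if i < k then f i else \<zero>)"
    by (induction k) (use f in \<open>auto simp: less_Suc_eq\<close>)
  then show ?thesis unfolding dot_span_def using assms by (auto intro!: exI[of _ "\<lambda>j. if j = i then \<one> else \<zero>"])
qed

lemma (in cring) dot_span_eq_genideal:
  assumes f: "\<forall>i. f i \<in> carrier R"
  shows "dot_span R k f = Idl (f ` {..<k})"
proof
  have s: "f ` {..<k} \<subseteq> carrier R" using f by blast
  interpret J: ideal "Idl (f ` {..<k})" R by (rule genideal_ideal[OF s])
  have "dot R n f g \<in> Idl (f ` {..<k})" if "\<forall>i. g i \<in> carrier R" "n \<le> k" for g n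
    using that(2)
  proof (induction n)
    case (Suc n)
    have "f n \<in> Idl (f ` {..<k})" using genideal_self[OF s] Suc.prems by auto
    then have "f n \<otimes> g n \<in> Idl (f ` {..<k})" using J.I_r_closed that(1) by blast
    then show ?case using Suc J.a_closed by simp
  qed simp
  then show "dot_span R k f \<subseteq> Idl (f ` {..<k})" unfolding dot_span_def by auto
  show "Idl (f ` {..<k}) \<subseteq> dot_span R k f"
    by (rule genideal_minimal[OF dot_span_ideal[OF f]]) (use dot_span_gen[OF f] in auto)
qed

text \<open>A finite list of generators is padded by zeros to a total family. Zero lies in
  \<open>I\<close>, hence membership in \<open>I\<close> can be claimed for every index.\<close>

lemma (in noetherian_ring) ideal_eq_dot_span:
  assumes "cring R" "ideal I R"
  obtains k f where "\<forall>i. f i \<in> carrier R" "I = dot_span R k f" "\<forall>i. f i \<in> I"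
proof -
  interpret cring R by fact
  obtain A where A: "A \<subseteq> carrier R" "finite A" "I = Idl A" using finetely_gen assms(2) by blast
  obtain l where l: "set l = A" using A(2) finite_list by blast
  define f where "f i = (if i < length l then l ! i else \<zero>)" for i
  have f: "\<forall>i. f i \<in> carrier R" unfolding f_def using A(1) l nth_mem by auto
  have zI: "\<zero> \<in> I" using additive_subgroup.zero_closed assms(2) ideal_def by blast
  have fI: "\<forall>i. f i \<in> I" unfolding f_def using zI A(3) genideal_self[OF A(1)] l nth_mem by fastforce
  have "f ` {..<length l} = A" unfolding f_def using l by (auto simp: in_set_conv_nth image_iff)
  then have "I = dot_span R (length l) f" unfolding A(3) dot_span_eq_genideal[OF f] by simp
  then show ?thesis by (rule that[OF f _ fI])
qed

lemma (in noetherian_ring) ideal_sequence_stationary: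
  assumes "\<And>n. ideal (I n) R" "\<And>n. I n \<subseteq> I (Suc n)"
  shows "\<exists>n. \<forall>m\<ge>n. I m = I n"
proof -
  have mono: "m \<le> n \<Longrightarrow> I m \<subseteq> I n" for m n using assms(2) lift_Suc_mono_le[of I] by blast
  have "I m \<subset> I n \<or> I n \<subset> I m" if "I m \<noteq> I n" for m n
    using mono[of m n] mono[of n m] that nat_le_linear[of m n] by blast
  then have "subset.chain {I. ideal I R} (range I)" unfolding pred_on.chain_def
    using assms(1) by auto
  then have "\<Union>(range I) \<in> range I" using ideal_chain_is_trivial[of "range I"] by blast
  then obtain n where "\<Union>(range I) = I n" by auto
  then have "\<forall>m\<ge>n. I m = I n" using mono by blast
  then show ?thesis by blast
qed

text \<open>The colon ideals of \<open>J\<close> by \<open>y^n\<close> increase with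
  \<open>n\<close>, so they stop at some \<open>m\<close>. This exponent, uniform in
  \<open>g\<close>, serves in place of an Artin-Rees constant.\<close>

lemma (in noetherian_ring) saturation_bound:
  assumes "cring R" "ideal J R" "y \<in> carrier R"
  shows "\<exists>m. \<forall>g\<in>carrier R. \<forall>k. y [^] (k::nat) \<otimes> g \<in> J \<longrightarrow> y [^] (m::nat) \<otimes> g \<in> J"
proof -
  interpret cring R by fact
  interpret J: ideal J R by fact
  define I where "I n = {g \<in> carrier R. y [^] (n::nat) \<otimes> g \<in> J}" for n
  have "ideal (I n) R" for n unfolding I_def
  proof (rule idealI_comm)
    fix a c assume "a \<in> {g \<in> carrier R. y [^] n \<otimes> g \<in> J}" "c \<in> carrier R"
    then have "c \<otimes> (y [^] n \<otimes> a) \<in> J" "a \<in> carrier R" using J.I_l_closed by auto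
    then show "c \<otimes> a \<in> {g \<in> carrier R. y [^] n \<otimes> g \<in> J}" using \<open>c \<in> carrier R\<close> assms(3)
      by (simp add: m_lcomm)
  qed (use assms(3) in \<open>auto simp: r_distr\<close>)
  moreover have step: "I n \<subseteq> I (Suc n)" for n unfolding I_def
  proof safe
    fix a assume "a \<in> carrier R" "y [^] n \<otimes> a \<in> J"
    then have "y \<otimes> (y [^] n \<otimes> a) \<in> J" using J.I_l_closed assms(3) by auto
    then show "y [^] Suc n \<otimes> a \<in> J" using assms(3) \<open>a \<in> carrier R\<close> by (simp add: m_ac)
  qed
  ultimately obtain m where m: "\<forall>k\<ge>m. I k = I m" using ideal_sequence_stationary[of I] by blast
  have "I k \<subseteq> I m" for k
  proof (cases "k \<ge> m")
    case False
    then show ?thesis using lift_Suc_mono_le[of I k m] step by simp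
  qed (use m in blast)
  then show ?thesis unfolding I_def by blast
qed

section \<open>Lifting relations from specializations\<close>

text \<open>Abstract model of \<open>R\<close>, \<open>R[X]\<close> and the completion:
  \<open>K\<close> is the copy of \<open>R\<close> inside \<open>C\<close>, \<open>P\<close> the
  polynomial ring over it and \<open>V\<close> its variable. As \<open>K\<close> lies in
  \<open>C\<close>, evaluation at points of \<open>K\<close> and of \<open>C\<close> is one map
  \<open>ev\<close>. The condition \<open>one_minus_unit\<close> places \<open>y\<close> in the
  Jacobson radical of \<open>K\<close>, and \<open>y_pure\<close> says that \<open>K\<close> meets
  \<open>y^n C\<close> only in \<open>y^n K\<close>. Completeness is stated for power series in
  \<open>y\<close>, the form in which all limits are taken.\<close>

locale specialization = C: cring C + P: cring P + P: noetherian_ring P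
  for C (structure) and P (structure) +
  fixes K y V cst ev
  assumes K_subring: "subring K C"
    and K_noetherian: "noetherian_ring (C\<lparr>carrier := K\<rparr>)"
    and cst: "cst \<in> ring_hom (C\<lparr>carrier := K\<rparr>) P"
    and ev: "\<And>a. a \<in> carrier C \<Longrightarrow> ev a \<in> ring_hom P C"
    and ev_K: "\<And>t p. t \<in> K \<Longrightarrow> p \<in> carrier P \<Longrightarrow> ev t p \<in> K"
    and ev_cst: "\<And>a r. a \<in> carrier C \<Longrightarrow> r \<in> K \<Longrightarrow> ev a (cst r) = r"
    and V_closed: "V \<in> carrier P"
    and ev_V: "\<And>a. a \<in> carrier C \<Longrightarrow> ev a V = a"
    and ev_div: "\<And>t p. t \<in> K \<Longrightarrow> p \<in> carrier P \<Longrightarrow>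
        \<exists>g\<in>carrier P. p = cst (ev t p) \<oplus>\<^bsub>P\<^esub> (V \<ominus>\<^bsub>P\<^esub> cst t) \<otimes>\<^bsub>P\<^esub> g"
    and y_K: "y \<in> K"
    and one_minus_unit: "\<And>r. r \<in> K \<Longrightarrow> \<exists>u\<in>K. u \<otimes> (\<one> \<ominus> y \<otimes> r) = \<one>"
    and y_cancel: "\<And>c. c \<in> carrier C \<Longrightarrow> y \<otimes> c = \<zero> \<Longrightarrow> c = \<zero>"
    and y_pure: "\<And>c n. c \<in> carrier C \<Longrightarrow> y [^] (n::nat) \<otimes> c \<in> K \<Longrightarrow> c \<in> K"
    and dense: "\<And>c n. c \<in> carrier C \<Longrightarrow> \<exists>r\<in>K. \<exists>z\<in>carrier C. c = r \<oplus> y [^] (n::nat) \<otimes> z"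
    and separated: "\<And>c. c \<in> carrier C \<Longrightarrow> (\<And>n::nat. \<exists>z\<in>carrier C. c = y [^] n \<otimes> z) \<Longrightarrow> c = \<zero>"
    and complete: "\<And>c. \<forall>n::nat. c n \<in> carrier C \<Longrightarrow>
        \<exists>s\<in>carrier C. \<forall>n. \<exists>z\<in>carrier C. s = dot C n (\<lambda>i. y [^] i) c \<oplus> y [^] n \<otimes> z"
begin

lemma K_closed [simp]: "r \<in> K \<Longrightarrow> r \<in> carrier C"
  using subringE(1)[OF K_subring] by auto

lemma K_cring: "cring (C\<lparr>carrier := K\<rparr>)"
  by (rule C.subcring_iff[THEN iffD1, OF _ C.subcringI'[OF K_subring]]) (use subringE(1)[OF K_subring] in auto)

lemma K_ops [simp]:
  "a \<in> K \<Longrightarrow> b \<in> K \<Longrightarrow> a \<oplus> b \<in> K" "a \<in> K \<Longrightarrow> b \<in> K \<Longrightarrow> a \<otimes> b \<in> K"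
  "a \<in> K \<Longrightarrow> \<ominus> a \<in> K" "a \<in> K \<Longrightarrow> b \<in> K \<Longrightarrow> a \<ominus> b \<in> K" "\<one> \<in> K" "\<zero> \<in> K"
  using subringE[OF K_subring] by (auto simp: a_minus_def)

lemma K_pow [simp]: "a \<in> K \<Longrightarrow> a [^] (n::nat) \<in> K"
  by (induction n) auto

lemma y_closed [simp]: "y \<in> carrier C" using y_K by simp

lemma cst_closed [simp]: "r \<in> K \<Longrightarrow> cst r \<in> carrier P"
  using ring_hom_memE(1)[OF cst] by simp

lemma cst_mult: "a \<in> K \<Longrightarrow> b \<in> K \<Longrightarrow> cst (a \<otimes> b) = cst a \<otimes>\<^bsub>P\<^esub> cst b"
  and cst_add: "a \<in> K \<Longrightarrow> b \<in> K \<Longrightarrow> cst (a \<oplus> b) = cst a \<oplus>\<^bsub>P\<^esub> cst b"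
  and cst_one: "cst \<one> = \<one>\<^bsub>P\<^esub>"
  using ring_hom_memE(2-4)[OF cst] by simp_all

lemma cst_zero: "cst \<zero> = \<zero>\<^bsub>P\<^esub>"
proof -
  have "cst \<zero> \<oplus>\<^bsub>P\<^esub> cst \<zero> = cst \<zero>" by (simp add: cst_add[symmetric])
  then show ?thesis by (metis K_ops(6) P.add.r_cancel_one' cst_closed)
qed

lemma cst_minus: "a \<in> K \<Longrightarrow> b \<in> K \<Longrightarrow> cst (a \<ominus> b) = cst a \<ominus>\<^bsub>P\<^esub> cst b"
proof -
  assume a: "a \<in> K" "b \<in> K"
  then have "a = (a \<ominus> b) \<oplus> b" by (simp add: a_minus_def C.a_assoc C.l_neg)
  then have "cst a = cst (a \<ominus> b) \<oplus>\<^bsub>P\<^esub> cst b" using cst_add[of "a \<ominus> b" b] a by simp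
  then show ?thesis using a by (simp add: a_minus_def P.a_assoc P.r_neg)
qed

lemma cst_pow: "a \<in> K \<Longrightarrow> cst (a [^] (n::nat)) = cst a [^]\<^bsub>P\<^esub> n"
  by (induction n) (simp_all add: cst_one cst_mult)

lemma ev_closed [simp]: "a \<in> carrier C \<Longrightarrow> p \<in> carrier P \<Longrightarrow> ev a p \<in> carrier C"
  using ring_hom_memE(1)[OF ev] by blast

lemma ev_mult: "a \<in> carrier C \<Longrightarrow> p \<in> carrier P \<Longrightarrow> q \<in> carrier P \<Longrightarrow> ev a (p \<otimes>\<^bsub>P\<^esub> q) = ev a p \<otimes> ev a q"
  and ev_add: "a \<in> carrier C \<Longrightarrow> p \<in> carrier P \<Longrightarrow> q \<in> carrier P \<Longrightarrow> ev a (p \<oplus>\<^bsub>P\<^esub> q) = ev a p \<oplus> ev a q"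
  using ring_hom_memE(2-3)[OF ev] by simp_all

lemma ev_zero: "a \<in> carrier C \<Longrightarrow> ev a \<zero>\<^bsub>P\<^esub> = \<zero>"
  using ring_hom_zero[OF ev P.ring_axioms C.ring_axioms] .

lemma ev_minus: "a \<in> carrier C \<Longrightarrow> p \<in> carrier P \<Longrightarrow> q \<in> carrier P \<Longrightarrow> ev a (p \<ominus>\<^bsub>P\<^esub> q) = ev a p \<ominus> ev a q"
proof -
  assume a: "a \<in> carrier C" "p \<in> carrier P" "q \<in> carrier P"
  then have "p = (p \<ominus>\<^bsub>P\<^esub> q) \<oplus>\<^bsub>P\<^esub> q" by (simp add: a_minus_def P.a_assoc P.l_neg)
  then have "ev a p = ev a (p \<ominus>\<^bsub>P\<^esub> q) \<oplus> ev a q" using ev_add[of a "p \<ominus>\<^bsub>P\<^esub> q" q] a by simp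
  then show ?thesis using a by (simp add: a_minus_def C.a_assoc C.r_neg)
qed

lemma ev_dot: "a \<in> carrier C \<Longrightarrow> \<forall>i. f i \<in> carrier P \<Longrightarrow> \<forall>i. x i \<in> carrier P \<Longrightarrow>
    ev a (dot P k f x) = dot C k (\<lambda>i. ev a (f i)) (\<lambda>i. ev a (x i))"
  by (rule ring_hom_dot[OF P.ring_axioms C.ring_axioms ev])

lemma y_pow_cancel: "c \<in> carrier C \<Longrightarrow> y [^] (n::nat) \<otimes> c = \<zero> \<Longrightarrow> c = \<zero>"
  by (rule C.pow_cancel[OF y_closed]) (rule y_cancel)

text \<open>If \<open>V - t\<^sub>n\<close> is a zero divisor modulo \<open>J\<close> for every \<open>t\<^sub>n = t\<^sub>0 + y\<^sup>N\<^sup>+\<^sup>n\<close>, the ideals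
  \<open>(J : (V - t\<^sub>0)\<dots>(V - t\<^sub>n))\<close> never become stationary, because the differences of the \<open>t\<^sub>n\<close> are units
  times powers of \<open>y\<close>.\<close>

lemma generic_point:
  assumes J: "ideal J P" and t0: "t0 \<in> K"
    and sat: "\<And>g. g \<in> carrier P \<Longrightarrow> cst y \<otimes>\<^bsub>P\<^esub> g \<in> J \<Longrightarrow> g \<in> J"
  shows "\<exists>w\<in>K. \<forall>g\<in>carrier P. (V \<ominus>\<^bsub>P\<^esub> cst (t0 \<oplus> y [^] (N::nat) \<otimes> w)) \<otimes>\<^bsub>P\<^esub> g \<in> J \<longrightarrow> g \<in> J"
proof (rule ccontr)
  interpret J: ideal J P by fact
  define t where "t n = t0 \<oplus> y [^] N \<otimes> y [^] (n::nat)" for n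
  define D where "D n = V \<ominus>\<^bsub>P\<^esub> cst (t n)" for n
  have tK: "t n \<in> K" for n unfolding t_def using t0 y_K by simp
  have DP [simp]: "D n \<in> carrier P" for n unfolding D_def using tK V_closed by simp
  assume "\<not> ?thesis"
  then have "\<exists>g\<in>carrier P. D n \<otimes>\<^bsub>P\<^esub> g \<in> J \<and> g \<notin> J" for n
    unfolding D_def t_def using y_K by auto
  then obtain g where g: "\<And>n. g n \<in> carrier P" "\<And>n. D n \<otimes>\<^bsub>P\<^esub> g n \<in> J" "\<And>n. g n \<notin> J" by metis
  \<comment> \<open>\<open>I n\<close> is the colon ideal of \<open>J\<close> by the product of the
    first \<open>n\<close> factors \<open>D i\<close>.\<close>
  define I where "I = rec_nat J (\<lambda>n A. {h \<in> carrier P. D n \<otimes>\<^bsub>P\<^esub> h \<in> A})"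
  have I0: "I 0 = J" and IS: "I (Suc n) = {h \<in> carrier P. D n \<otimes>\<^bsub>P\<^esub> h \<in> I n}" for n
    unfolding I_def by simp_all
  have II: "ideal (I n) P" for n
  proof (induction n)
    case (Suc n)
    then interpret In: ideal "I n" P .
    show ?case unfolding IS
    proof (rule P.idealI_comm)
      fix a c assume "a \<in> {h \<in> carrier P. D n \<otimes>\<^bsub>P\<^esub> h \<in> I n}" "c \<in> carrier P"
      then have "c \<otimes>\<^bsub>P\<^esub> (D n \<otimes>\<^bsub>P\<^esub> a) \<in> I n" "a \<in> carrier P" using In.I_l_closed by auto
      then show "c \<otimes>\<^bsub>P\<^esub> a \<in> {h \<in> carrier P. D n \<otimes>\<^bsub>P\<^esub> h \<in> I n}" using \<open>c \<in> carrier P\<close>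
        by (simp add: P.m_lcomm)
    qed (auto simp: P.r_distr)
  qed (simp add: I0 J)
  have sub: "I n \<subseteq> I (Suc n)" for n
  proof -
    interpret In: ideal "I n" P by (rule II)
    show ?thesis unfolding IS using In.I_l_closed In.Icarr by auto
  qed
  obtain n where n: "\<forall>m\<ge>n. I m = I n" using P.ideal_sequence_stationary[of I] II sub by blast
  \<comment> \<open>Subtraction eliminates \<open>V\<close> and leaves \<open>t j - t n\<close>
    times \<open>h\<close> in \<open>J\<close>. Its two factors are removed separately: the power of
    \<open>y\<close> by saturation, the unit by multiplying with its inverse
    \<open>u\<close>.\<close>
  have diff: "h \<in> J" if h: "h \<in> carrier P" "D n \<otimes>\<^bsub>P\<^esub> h \<in> J" "D j \<otimes>\<^bsub>P\<^esub> h \<in> J" and "j < n" for h j n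
  proof -
    obtain i where i: "n = j + Suc i" using \<open>j < n\<close> less_iff_Suc_add by auto
    obtain u where u: "u \<in> K" "u \<otimes> (\<one> \<ominus> y \<otimes> y [^] i) = \<one>"
      using one_minus_unit[of "y [^] i"] y_K by auto
    have "D n \<otimes>\<^bsub>P\<^esub> h \<ominus>\<^bsub>P\<^esub> D j \<otimes>\<^bsub>P\<^esub> h = (cst (t j) \<ominus>\<^bsub>P\<^esub> cst (t n)) \<otimes>\<^bsub>P\<^esub> h"
      unfolding D_def using h(1) cst_closed[OF tK[of j]] cst_closed[OF tK[of n]] V_closed by algebra
    also have "\<dots> = cst (t j \<ominus> t n) \<otimes>\<^bsub>P\<^esub> h" using tK by (simp add: cst_minus)
    also have "t j \<ominus> t n = y [^] (N + j) \<otimes> (\<one> \<ominus> y \<otimes> y [^] i)"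
    proof -
      define a b c where "a = y [^] N" "b = y [^] j" "c = y [^] i"
      have "a \<in> carrier C" "b \<in> carrier C" "c \<in> carrier C" "t0 \<in> carrier C" "y \<in> carrier C"
        unfolding a_b_c_def using t0 by auto
      moreover have "y [^] n = b \<otimes> (c \<otimes> y)" "y [^] (N + j) = a \<otimes> b"
        unfolding a_b_c_def i by (simp_all add: C.nat_pow_mult[symmetric] C.m_assoc)
      moreover have "t j = t0 \<oplus> a \<otimes> b" "t n = t0 \<oplus> a \<otimes> y [^] n"
        unfolding t_def a_b_c_def by simp_all
      moreover have "(t0 \<oplus> a \<otimes> b) \<ominus> (t0 \<oplus> a \<otimes> (b \<otimes> (c \<otimes> y)))
          = a \<otimes> b \<otimes> (\<one> \<ominus> y \<otimes> c)"
        using calculation(1-5) by algebra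
      ultimately show ?thesis unfolding a_b_c_def(3)[symmetric] by simp
    qed
    finally have e: "D n \<otimes>\<^bsub>P\<^esub> h \<ominus>\<^bsub>P\<^esub> D j \<otimes>\<^bsub>P\<^esub> h
        = cst (y [^] (N + j) \<otimes> (\<one> \<ominus> y \<otimes> y [^] i)) \<otimes>\<^bsub>P\<^esub> h" .
    define v where "v = \<one> \<ominus> y \<otimes> y [^] i"
    have v: "v \<in> K" unfolding v_def using y_K by simp
    have "D n \<otimes>\<^bsub>P\<^esub> h \<ominus>\<^bsub>P\<^esub> D j \<otimes>\<^bsub>P\<^esub> h \<in> J" using h J.a_closed J.a_inv_closed unfolding a_minus_def by blast
    then have "cst (y [^] (N + j)) \<otimes>\<^bsub>P\<^esub> (cst v \<otimes>\<^bsub>P\<^esub> h) \<in> J" unfolding e v_def[symmetric]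
      using v y_K h(1) by (simp add: cst_mult P.m_assoc)
    then have 1: "cst y [^]\<^bsub>P\<^esub> (N + j) \<otimes>\<^bsub>P\<^esub> (cst v \<otimes>\<^bsub>P\<^esub> h) \<in> J" using y_K by (simp add: cst_pow)
    have sat_pow: "q \<in> J" if "q \<in> carrier P" "cst y [^]\<^bsub>P\<^esub> (e::nat) \<otimes>\<^bsub>P\<^esub> q \<in> J" for e q
      using that
    proof (induction e)
      case (Suc e)
      have "cst y \<otimes>\<^bsub>P\<^esub> (cst y [^]\<^bsub>P\<^esub> e \<otimes>\<^bsub>P\<^esub> q) \<in> J"
        using Suc.prems y_K by (simp add: P.m_lcomm P.m_assoc)
      then have "cst y [^]\<^bsub>P\<^esub> e \<otimes>\<^bsub>P\<^esub> q \<in> J"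
        by (rule sat[rotated]) (use Suc.prems(1) y_K in simp)
      then show ?case by (rule Suc.IH[OF Suc.prems(1)])
    qed simp
    have "cst v \<otimes>\<^bsub>P\<^esub> h \<in> J" using sat_pow[OF _ 1] v h(1) by simp
    then have "cst u \<otimes>\<^bsub>P\<^esub> (cst v \<otimes>\<^bsub>P\<^esub> h) \<in> J" using u(1) J.I_l_closed by simp
    moreover have "cst u \<otimes>\<^bsub>P\<^esub> (cst v \<otimes>\<^bsub>P\<^esub> h) = cst (u \<otimes> v) \<otimes>\<^bsub>P\<^esub> h"
      using u(1) v h(1) by (simp add: cst_mult P.m_assoc)
    ultimately show ?thesis using u(2) h(1) unfolding v_def by (simp add: cst_one)
  qed
  \<comment> \<open>Being killed by \<open>D n\<close> modulo \<open>J\<close> survives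
    multiplication by \<open>D j\<close>, so \<open>diff\<close> removes the factors of the product
    one after the other.\<close>
  have drop: "h \<in> J" if "h \<in> carrier P" "D n \<otimes>\<^bsub>P\<^esub> h \<in> J" "h \<in> I j" "j \<le> n" for h j n
    using that
  proof (induction j arbitrary: h)
    case (Suc j)
    have a: "D j \<otimes>\<^bsub>P\<^esub> h \<in> I j" using Suc.prems(3) unfolding IS by blast
    have b: "D n \<otimes>\<^bsub>P\<^esub> (D j \<otimes>\<^bsub>P\<^esub> h) \<in> J"
      using J.I_l_closed[OF Suc.prems(2), of "D j"] Suc.prems(1) by (simp add: P.m_lcomm)
    have c: "D j \<otimes>\<^bsub>P\<^esub> h \<in> carrier P" "j \<le> n" "j < n" using Suc.prems(1,4) by auto
    have "D j \<otimes>\<^bsub>P\<^esub> h \<in> J" by (rule Suc.IH[OF c(1) b a c(2)])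
    from this c(3) show ?case by (rule diff[OF Suc.prems(1,2)])
  qed (simp add: I0)
  have mono: "J \<subseteq> I j" for j
    by (induction j) (use sub I0 in auto)
  \<comment> \<open>Stationarity moves \<open>g n\<close> from \<open>I (Suc n)\<close> into
    \<open>I n\<close>, whose factors \<open>D j\<close> all differ from \<open>D n\<close>;
    \<open>drop\<close> then contradicts the choice of \<open>g n\<close>.\<close>
  have "g n \<in> I (Suc n)" unfolding IS using g(1,2)[of n] mono[of n] by blast
  moreover have "I (Suc n) = I n" using n[rule_format, of "Suc n"] by simp
  ultimately have "g n \<in> I n" by simp
  then have "g n \<in> J" by (rule drop[OF g(1) g(2) _ order_refl])
  then show False using g(3) by simp
qed

end

text \<open>The \<open>C\<close>-module generated by the images of the syzygies of \<open>f\<close>,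
  built one generator at a time so that its closure properties follow by induction. Vectors are
  total functions; entries from index \<open>k\<close> on are unconstrained.\<close>

inductive syzygy_span ::
    "('p, 'x) ring_scheme \<Rightarrow> ('b, 'z) ring_scheme \<Rightarrow> ('p \<Rightarrow> 'b) \<Rightarrow> nat \<Rightarrow> (nat \<Rightarrow> 'p) \<Rightarrow> (nat \<Rightarrow> 'b) \<Rightarrow> bool"
  for P C e k f where
  zero: "syzygy_span P C e k f (\<lambda>i. \<zero>\<^bsub>C\<^esub>)"
| step: "syzygy_span P C e k f x \<Longrightarrow> \<forall>i. \<sigma> i \<in> carrier P \<Longrightarrow> dot P k f \<sigma> = \<zero>\<^bsub>P\<^esub> \<Longrightarrow> z \<in> carrier C \<Longrightarrow>
    syzygy_span P C e k f (\<lambda>i. x i \<oplus>\<^bsub>C\<^esub> e (\<sigma> i) \<otimes>\<^bsub>C\<^esub> z)"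

text \<open>Collects the generators used in a derivation as the columns of a matrix
  \<open>\<sigma>\<close>, the shape required by the equational criterion.\<close>

lemma syzygy_span_explicit:
  assumes "syzygy_span P C e k f x" "ring P" "ring C" "e \<in> carrier P \<rightarrow> carrier C"
  shows "\<exists>l \<sigma> z. (\<forall>i j. \<sigma> i j \<in> carrier P) \<and> (\<forall>j. z j \<in> carrier C) \<and>
    (\<forall>j<l. dot P k f (\<lambda>i. \<sigma> i j) = \<zero>\<^bsub>P\<^esub>) \<and> (\<forall>i. x i = dot C l (\<lambda>j. e (\<sigma> i j)) z)"
  using assms(1)
proof induction
  case zero
  then show ?case
    using ring.ring_simprules(2)[OF assms(2)] ring.ring_simprules(2)[OF assms(3)]
    by (intro exI[of _ 0] exI[of _ "\<lambda>i j. \<zero>\<^bsub>P\<^esub>"] exI[of _ "\<lambda>j. \<zero>\<^bsub>C\<^esub>"]) simp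
next
  case (step x \<rho> w)
  then obtain l \<sigma> z where *: "\<forall>i j. \<sigma> i j \<in> carrier P" "\<forall>j. z j \<in> carrier C"
    "\<forall>j<l. dot P k f (\<lambda>i. \<sigma> i j) = \<zero>\<^bsub>P\<^esub>" "\<forall>i. x i = dot C l (\<lambda>j. e (\<sigma> i j)) z" by blast
  define \<sigma>' z' where "\<sigma>' i j = (if j = l then \<rho> i else \<sigma> i j)" and "z' j = (if j = l then w else z j)" for i j
  have "dot C l (\<lambda>j. e (\<sigma>' i j)) z' = dot C l (\<lambda>j. e (\<sigma> i j)) z" for i
    by (rule dot_cong) (simp_all add: \<sigma>'_def z'_def)
  moreover have "dot P k f (\<lambda>i. \<sigma>' i j) = \<zero>\<^bsub>P\<^esub>" if "j < Suc l" for j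
    using that * step unfolding \<sigma>'_def by (cases "j = l") auto
  moreover have "\<forall>i j. \<sigma>' i j \<in> carrier P" "\<forall>j. z' j \<in> carrier C" "\<sigma>' i l = \<rho> i" "z' l = w" for i
    unfolding \<sigma>'_def z'_def using * step.hyps by auto
  ultimately show ?case using *(4)
    by (intro exI[of _ "Suc l"] exI[of _ \<sigma>'] exI[of _ z']) simp
qed

context specialization
begin

text \<open>Division by \<open>V - t\<close> writes \<open>p\<close> as its value at
  \<open>t\<close> plus a multiple of \<open>V - t\<close>, and \<open>V - t\<close> specializes to
  \<open>y^N z\<close>.\<close>

lemma ev_cong:
  assumes "t \<in> K" "z \<in> carrier C" "p \<in> carrier P"
  shows "\<exists>u\<in>carrier C. ev (t \<oplus> y [^] (N::nat) \<otimes> z) p = ev t p \<oplus> y [^] N \<otimes> u"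
proof -
  define a where "a = y [^] N"
  define \<tau> where "\<tau> = t \<oplus> a \<otimes> z"
  have a: "a \<in> carrier C" "t \<in> carrier C" and \<tau>: "\<tau> \<in> carrier C" unfolding a_def \<tau>_def using assms by auto
  obtain g where g: "g \<in> carrier P" "p = cst (ev t p) \<oplus>\<^bsub>P\<^esub> (V \<ominus>\<^bsub>P\<^esub> cst t) \<otimes>\<^bsub>P\<^esub> g"
    using ev_div assms by blast
  define q where "q = ev t p"
  have q: "q \<in> K" unfolding q_def using assms ev_K by simp
  have p: "p = cst q \<oplus>\<^bsub>P\<^esub> (V \<ominus>\<^bsub>P\<^esub> cst t) \<otimes>\<^bsub>P\<^esub> g" using g(2) q_def by simp
  have "ev \<tau> p = q \<oplus> (\<tau> \<ominus> t) \<otimes> ev \<tau> g"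
    unfolding p using q g \<tau> assms V_closed by (simp add: ev_add ev_mult ev_minus ev_V ev_cst)
  also have "\<dots> = q \<oplus> a \<otimes> (z \<otimes> ev \<tau> g)"
  proof -
    have "ev \<tau> g \<in> carrier C" "q \<in> carrier C" using \<tau> g q by auto
    moreover have "\<tau> \<ominus> t = a \<otimes> z" unfolding \<tau>_def using a assms(2) by algebra
    ultimately show ?thesis using a assms(2) by (simp add: C.m_assoc)
  qed
  finally have e: "ev \<tau> p = ev t p \<oplus> a \<otimes> (z \<otimes> ev \<tau> g)" unfolding q_def .
  have "z \<otimes> ev \<tau> g \<in> carrier C" using assms(2) g(1) \<tau> by simp
  with e show ?thesis unfolding \<tau>_def a_def by (rule bexI)
qed

text \<open>A Nakayama argument over a complete ring, where \<open>S\<close> may be any subset: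
  repeating the decomposition produces coefficients \<open>b n\<close> whose power series in
  \<open>y\<close> converge to \<open>z\<close>.\<close>

lemma complete_span:
  assumes q: "\<forall>j. q j \<in> carrier C" and S: "S \<subseteq> carrier C"
    and step: "\<forall>s\<in>S. \<exists>b. (\<forall>j. b j \<in> carrier C) \<and> (\<exists>s'\<in>S. s = dot C l q b \<oplus> y \<otimes> s')"
    and s: "s \<in> S"
  shows "\<exists>z. (\<forall>j. z j \<in> carrier C) \<and> s = dot C l q z"
proof -
  obtain B nxt where B: "\<And>s. s \<in> S \<Longrightarrow> (\<forall>j. B s j \<in> carrier C) \<and> nxt s \<in> S \<and> s = dot C l q (B s) \<oplus> y \<otimes> nxt s"
    using step by metis
  define u where "u n = (nxt ^^ n) s" for n
  have u: "u n \<in> S" for n unfolding u_def by (induction n) (use s B in auto)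
  define b where "b n = B (u n)" for n
  have b: "b n j \<in> carrier C" for n j unfolding b_def using B[OF u] by blast
  have un: "u n = dot C l q (b n) \<oplus> y \<otimes> u (Suc n)" for n
    using B[OF u[of n]] unfolding b_def u_def by simp
  have uC: "u n \<in> carrier C" for n using u S by auto
  let ?p = "\<lambda>i. y [^] (i::nat)"
  have "\<exists>z\<in>carrier C. \<forall>n. \<exists>w\<in>carrier C. z = dot C n ?p (\<lambda>i. b i j) \<oplus> ?p n \<otimes> w" for j
    using complete[of "\<lambda>i. b i j"] b by blast
  then obtain z where z: "\<And>j. z j \<in> carrier C"
    "\<And>j n. \<exists>w\<in>carrier C. z j = dot C n ?p (\<lambda>i. b i j) \<oplus> ?p n \<otimes> w" by metis
  have part: "s = dot C l q (\<lambda>j. dot C n ?p (\<lambda>i. b i j)) \<oplus> ?p n \<otimes> u n" for n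
  proof (induction n)
    case 0
    then show ?case using q uC[of 0] by (simp add: C.dot_zero u_def)
  next
    case (Suc n)
    define A where "A j = dot C n ?p (\<lambda>i. b i j)" for j
    have A: "A j \<in> carrier C" for j unfolding A_def using b by simp
    define U v a where "U = u (Suc n)" "v = dot C l q (b n)" "a = ?p n"
    have c: "U \<in> carrier C" "v \<in> carrier C" "a \<in> carrier C" "dot C l q A \<in> carrier C"
      unfolding U_v_a_def using uC q b A by auto
    have "dot C l q (\<lambda>j. dot C (Suc n) ?p (\<lambda>i. b i j)) = dot C l q (\<lambda>j. A j \<oplus> a \<otimes> b n j)"
      unfolding A_def U_v_a_def by simp
    also have "\<dots> = dot C l q A \<oplus> a \<otimes> v"
      unfolding U_v_a_def using q A b by (simp add: C.dot_add C.dot_smult)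
    finally have e: "dot C l q (\<lambda>j. dot C (Suc n) ?p (\<lambda>i. b i j)) = dot C l q A \<oplus> a \<otimes> v" .
    have "s = dot C l q A \<oplus> a \<otimes> (v \<oplus> y \<otimes> U)"
      using Suc un[of n] unfolding A_def U_v_a_def by simp
    also have "\<dots> = dot C l q A \<oplus> a \<otimes> v \<oplus> (a \<otimes> y) \<otimes> U"
      using c y_closed by algebra
    finally show ?case unfolding e U_v_a_def by simp
  qed
  \<comment> \<open>For every \<open>n\<close>, both \<open>s\<close> and the combination with
    coefficients \<open>z\<close> agree with the \<open>n\<close>-th partial combination up to a
    multiple of \<open>y^n\<close>; separatedness then makes them equal.\<close>
  have "s \<ominus> dot C l q z = \<zero>"
  proof (rule separated)
    show "s \<ominus> dot C l q z \<in> carrier C" using s S q z by auto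
    fix n
    define A where "A j = dot C n ?p (\<lambda>i. b i j)" for j
    have A: "A j \<in> carrier C" for j unfolding A_def using b by simp
    obtain w where w: "\<And>j. w j \<in> carrier C" "\<And>j. z j = A j \<oplus> ?p n \<otimes> w j"
      using z(2)[of _ n] unfolding A_def by metis
    have "dot C l q z = dot C l q A \<oplus> ?p n \<otimes> dot C l q w"
      unfolding w(2) using w(1) q A by (simp add: C.dot_add C.dot_smult)
    moreover define v v' a where "v = dot C l q A" "v' = dot C l q w" "a = ?p n"
    moreover have "s = dot C l q A \<oplus> ?p n \<otimes> u n" using part[of n] unfolding A_def .
    moreover have "v \<in> carrier C" "v' \<in> carrier C" "a \<in> carrier C" "u n \<in> carrier C"
      unfolding v_v'_a_def using q A w uC by auto
    ultimately have "s \<ominus> dot C l q z = a \<otimes> (u n \<ominus> v')"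
      by (simp only:) algebra
    then show "\<exists>w\<in>carrier C. s \<ominus> dot C l q z = y [^] n \<otimes> w"
      unfolding v_v'_a_def using \<open>u n \<in> carrier C\<close> q w(1) by (meson C.minus_closed C.dot_closed)
  qed
  then have "s = dot C l q z" using s S q z by (simp add: subset_iff)
  then show ?thesis using z(1) by blast
qed

text \<open>One round of successive approximation. The left side is scaled by \<open>y^m\<close>
  only, while the remainder carries \<open>y^(m+1)\<close>, so each round gains a factor
  \<open>y\<close>; the remainder is again a relation, so rounds can be repeated.\<close>

definition lifts_syzygies :: "nat \<Rightarrow> nat \<Rightarrow> (nat \<Rightarrow> 'c) \<Rightarrow> 'a \<Rightarrow> bool" where
  "lifts_syzygies m k f \<tau> \<longleftrightarrow>
     (\<forall>x. (\<forall>i. x i \<in> carrier C) \<and> dot C k (\<lambda>i. ev \<tau> (f i)) x = \<zero> \<longrightarrow>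
       (\<exists>\<sigma> x'. (\<forall>i. \<sigma> i \<in> carrier P) \<and> dot P k f \<sigma> = \<zero>\<^bsub>P\<^esub> \<and>
          (\<forall>i. x' i \<in> carrier C) \<and> dot C k (\<lambda>i. ev \<tau> (f i)) x' = \<zero> \<and>
          (\<forall>i. y [^] m \<otimes> x i = ev \<tau> (\<sigma> i) \<oplus> y [^] Suc m \<otimes> x' i)))"

text \<open>Openness and density of the lifting condition: it holds on a whole ball around a generic
  point of the given ball. The exponent \<open>m\<close> is the same for all points of the ball
  because it comes from the ideal of \<open>f\<close> alone.\<close>

lemma lifts_syzygies_locally:
  assumes f: "\<forall>i. f i \<in> carrier P" and t0: "t0 \<in> K"
  shows "\<exists>w\<in>K. \<exists>N m. n \<le> N \<and> (\<forall>z\<in>carrier C.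
    lifts_syzygies m k f (t0 \<oplus> y [^] (n::nat) \<otimes> w \<oplus> y [^] N \<otimes> z))"
proof -
  interpret KR: cring "C\<lparr>carrier := K\<rparr>" by (rule K_cring)
  interpret KR: noetherian_ring "C\<lparr>carrier := K\<rparr>" by (rule K_noetherian)
  define J where "J = dot_span P k f"
  interpret J: ideal J P unfolding J_def using f by (rule P.dot_span_ideal)
  define Y where "Y = cst y"
  have Y: "Y \<in> carrier P" unfolding Y_def using y_K by simp
  from P.saturation_bound[OF P.is_cring J.ideal_axioms Y]
  obtain m where m: "\<forall>g\<in>carrier P. \<forall>e::nat. Y [^]\<^bsub>P\<^esub> e \<otimes>\<^bsub>P\<^esub> g \<in> J \<longrightarrow> Y [^]\<^bsub>P\<^esub> (m::nat) \<otimes>\<^bsub>P\<^esub> g \<in> J" ..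
  \<comment> \<open>By the choice of \<open>m\<close>, this single colon ideal is the full
    saturation of \<open>J\<close> with respect to \<open>y\<close>.\<close>
  define L where "L = {g \<in> carrier P. Y [^]\<^bsub>P\<^esub> m \<otimes>\<^bsub>P\<^esub> g \<in> J}"
  have "ideal L P" unfolding L_def
  proof (rule P.idealI_comm)
    fix a c assume "a \<in> {g \<in> carrier P. Y [^]\<^bsub>P\<^esub> m \<otimes>\<^bsub>P\<^esub> g \<in> J}" "c \<in> carrier P"
    then have "c \<otimes>\<^bsub>P\<^esub> (Y [^]\<^bsub>P\<^esub> m \<otimes>\<^bsub>P\<^esub> a) \<in> J" "a \<in> carrier P" using J.I_l_closed by auto
    then show "c \<otimes>\<^bsub>P\<^esub> a \<in> {g \<in> carrier P. Y [^]\<^bsub>P\<^esub> m \<otimes>\<^bsub>P\<^esub> g \<in> J}" using \<open>c \<in> carrier P\<close> Y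
      by (simp add: P.m_lcomm)
  qed (use Y in \<open>auto simp: P.r_distr\<close>)
  moreover have "g \<in> L" if "g \<in> carrier P" "cst y \<otimes>\<^bsub>P\<^esub> g \<in> L" for g
  proof -
    have "Y [^]\<^bsub>P\<^esub> Suc m \<otimes>\<^bsub>P\<^esub> g \<in> J" using that Y unfolding L_def Y_def[symmetric] by (simp add: P.m_assoc)
    then have "Y [^]\<^bsub>P\<^esub> m \<otimes>\<^bsub>P\<^esub> g \<in> J" by (rule m[rule_format, OF that(1)])
    then show ?thesis unfolding L_def using that(1) by simp
  qed
  ultimately obtain w where w: "w \<in> K"
    "\<forall>g\<in>carrier P. (V \<ominus>\<^bsub>P\<^esub> cst (t0 \<oplus> y [^] n \<otimes> w)) \<otimes>\<^bsub>P\<^esub> g \<in> L \<longrightarrow> g \<in> L"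
    using generic_point[of L t0 n] t0 by blast
  define t where "t = t0 \<oplus> y [^] n \<otimes> w"
  have t: "t \<in> K" unfolding t_def using t0 w y_K by simp
  define D where "D = V \<ominus>\<^bsub>P\<^esub> cst t"
  have D: "D \<in> carrier P" unfolding D_def using V_closed t by simp
  define a where "a i = ev t (f i)" for i
  have aK: "\<forall>i. a i \<in> K" unfolding a_def using t f ev_K by simp
  define I where "I = dot_span (C\<lparr>carrier := K\<rparr>) k a"
  have "ideal I (C\<lparr>carrier := K\<rparr>)" unfolding I_def using aK by (intro KR.dot_span_ideal) simp
  from KR.saturation_bound[OF K_cring this, of y] y_K
  have "\<exists>c. \<forall>r\<in>K. \<forall>e::nat. y [^] e \<otimes> r \<in> I \<longrightarrow> y [^] (c::nat) \<otimes> r \<in> I"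
    by (simp add: nat_pow_def)
  then obtain c where c: "\<forall>r\<in>K. \<forall>e::nat. y [^] e \<otimes> r \<in> I \<longrightarrow> y [^] (c::nat) \<otimes> r \<in> I" ..
  \<comment> \<open>\<open>Suc m\<close> is the order to be gained, \<open>c\<close> pays for the
    division by a power of \<open>y\<close> inside \<open>I\<close>, and \<open>n\<close> makes the
    new ball at least as small as the given one.\<close>
  define N where "N = Suc m + n + c"
  define A B E where "A = y [^] m" "B = y [^] n" "E = y [^] c"
  have ABE: "A \<in> K" "B \<in> K" "E \<in> K" unfolding A_B_E_def using y_K by auto
  then have ABEC: "A \<in> carrier C" "B \<in> carrier C" "E \<in> carrier C" by auto
  have yN: "y [^] N = A \<otimes> y \<otimes> B \<otimes> E" unfolding N_def A_B_E_def
    by (simp add: C.nat_pow_mult[symmetric] C.m_ac)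
  have "lifts_syzygies m k f (t \<oplus> y [^] N \<otimes> z)" if z: "z \<in> carrier C" for z
  proof -
    define \<tau> where "\<tau> = t \<oplus> y [^] N \<otimes> z"
    have \<tau>: "\<tau> \<in> carrier C" unfolding \<tau>_def using t z by auto
    define F where "F i = ev \<tau> (f i)" for i
    have F: "\<forall>i. F i \<in> carrier C" unfolding F_def using \<tau> f by auto
    have "\<exists>u\<in>carrier C. F i = a i \<oplus> y [^] N \<otimes> u" for i
      unfolding F_def a_def \<tau>_def by (rule ev_cong[OF t z]) (use f in blast)
    then obtain u where u: "\<And>i. u i \<in> carrier C" "\<And>i. F i = a i \<oplus> y [^] N \<otimes> u i"
      by metis
    show ?thesis unfolding lifts_syzygies_def \<tau>_def[symmetric] F_def[symmetric]
    proof (intro allI impI, elim conjE)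
      fix x assume x: "\<forall>i. x i \<in> carrier C" and x0: "dot C k F x = \<zero>"
      \<comment> \<open>Density replaces \<open>x\<close> by a vector \<open>r\<close> over
        \<open>K\<close>, which is a relation for the specialized family \<open>a\<close> only up to
        a multiple of \<open>y^N\<close>.\<close>
      have "\<exists>r\<in>K. \<exists>v\<in>carrier C. x i = r \<oplus> y [^] N \<otimes> v" for i
        by (rule dense) (use x in blast)
      then obtain r v where r: "\<And>i. r i \<in> K" "\<And>i. v i \<in> carrier C" "\<And>i. x i = r i \<oplus> y [^] N \<otimes> v i"
        by metis
      have rC: "\<forall>i. r i \<in> carrier C" and aC: "\<forall>i. a i \<in> carrier C" using r(1) aK by auto
      have "dot C k F x = dot C k F r \<oplus> y [^] N \<otimes> dot C k F v"
        unfolding r(3) using F rC r(2) by (simp add: C.dot_add C.dot_smult)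
      also have "dot C k F r = dot C k r F" using F rC by (rule C.dot_commute)
      also have "dot C k r F = dot C k r a \<oplus> y [^] N \<otimes> dot C k r u"
        unfolding u(2) using aC rC u(1) by (simp add: C.dot_add C.dot_smult)
      also have "dot C k r a = dot C k a r" using rC aC by (rule C.dot_commute)
      finally have 1: "dot C k a r \<oplus> y [^] N \<otimes> dot C k r u \<oplus> y [^] N \<otimes> dot C k F v = \<zero>"
        using x0 by simp
      define q where "q = \<ominus> (dot C k r u \<oplus> dot C k F v)"
      have cl: "dot C k a r \<in> carrier C" "dot C k r u \<in> carrier C" "dot C k F v \<in> carrier C"
        "y [^] N \<in> carrier C" using aC rC u(1) F r(2) by auto
      have qC: "q \<in> carrier C" unfolding q_def using cl by simp
      have "dot C k a r = (dot C k a r \<oplus> y [^] N \<otimes> dot C k r u \<oplus> y [^] N \<otimes> dot C k F v) \<oplus> y [^] N \<otimes> q"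
        unfolding q_def using cl by algebra
      then have q: "dot C k a r = y [^] N \<otimes> q" unfolding 1 using qC cl by simp
      have arI: "dot C k a r \<in> I" unfolding I_def dot_span_def using r(1) by auto
      have "dot (C\<lparr>carrier := K\<rparr>) k a r \<in> carrier (C\<lparr>carrier := K\<rparr>)" using aK r(1) by (intro KR.dot_closed) auto
      \<comment> \<open>The Artin-Rees step: purity brings the quotient \<open>q\<close> back into
        \<open>K\<close>, where the saturation bound of \<open>I\<close> applies to it.\<close>
      then have "q \<in> K" using y_pure[of q N] qC q by simp
      then have "E \<otimes> q \<in> I" unfolding A_B_E_def using c[rule_format, of q N] arI q by simp
      then obtain r' where r': "\<forall>i. r' i \<in> K" "E \<otimes> q = dot C k a r'"
        unfolding I_def dot_span_def by auto
      have r'C: "\<forall>i. r' i \<in> carrier C" using r' by auto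
      \<comment> \<open>The correction makes \<open>s\<close> an exact syzygy of \<open>a\<close>
        that is still congruent to \<open>x\<close> modulo \<open>y^(m+1+n)\<close>.\<close>
      define s where "s i = r i \<ominus> A \<otimes> y \<otimes> B \<otimes> r' i" for i
      have sK: "s i \<in> K" for i unfolding s_def using r(1) r'(1) ABE y_K by simp
      have "dot C k a s = dot C k a r \<ominus> A \<otimes> y \<otimes> B \<otimes> dot C k a r'"
        unfolding s_def using aC rC r'C ABEC by (simp add: C.dot_minus C.dot_smult)
      also have "\<dots> = \<zero>" unfolding q r'(2)[symmetric] yN using qC ABEC y_closed by algebra
      finally have s0: "dot C k a s = \<zero>" .
      \<comment> \<open>The constants \<open>s i\<close> need not form a syzygy of \<open>f\<close>.
        Their defect \<open>p\<close> vanishes at \<open>t\<close>, so it is a multiple of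
        \<open>D\<close>, and it lies in \<open>J\<close>; regularity of \<open>D\<close> modulo
        \<open>L\<close> puts the quotient \<open>g\<close> into \<open>L\<close>.\<close>
      define p where "p = dot P k f (\<lambda>i. cst (s i))"
      have pP: "p \<in> carrier P" unfolding p_def using f sK by auto
      have "ev t p = \<zero>"
        unfolding p_def using t f sK s0 by (simp add: ev_dot ev_cst a_def[abs_def])
      then obtain g where g: "g \<in> carrier P" "p = D \<otimes>\<^bsub>P\<^esub> g"
        using ev_div[OF t pP] D unfolding D_def[symmetric] by (auto simp: cst_zero)
      have pJ: "p \<in> J" unfolding J_def dot_span_def p_def using sK by auto
      then have "Y [^]\<^bsub>P\<^esub> m \<otimes>\<^bsub>P\<^esub> p \<in> J" using J.I_l_closed Y by auto
      then have "D \<otimes>\<^bsub>P\<^esub> g \<in> L" unfolding L_def using pP g by auto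
      then have "Y [^]\<^bsub>P\<^esub> m \<otimes>\<^bsub>P\<^esub> g \<in> J" using w(2) g(1) unfolding t_def[symmetric] D_def[symmetric] L_def by auto
      then obtain b where b: "\<forall>i. b i \<in> carrier P" "Y [^]\<^bsub>P\<^esub> m \<otimes>\<^bsub>P\<^esub> g = dot P k f b"
        unfolding J_def dot_span_def by auto
      \<comment> \<open>After scaling by \<open>A = y^m\<close> the defect is \<open>D\<close> times
        \<open>y^m g\<close>, and \<open>b\<close> expresses \<open>y^m g\<close> through
        \<open>f\<close>; subtracting \<open>D\<close> times \<open>b\<close> cancels it.\<close>
      define \<sigma> where "\<sigma> i = cst A \<otimes>\<^bsub>P\<^esub> cst (s i) \<ominus>\<^bsub>P\<^esub> D \<otimes>\<^bsub>P\<^esub> b i" for i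
      have \<sigma>: "\<forall>i. \<sigma> i \<in> carrier P" unfolding \<sigma>_def using ABE sK D b(1) by simp
      have YA: "Y [^]\<^bsub>P\<^esub> m = cst A" unfolding A_B_E_def Y_def using y_K by (simp add: cst_pow)
      have "dot P k f \<sigma> = cst A \<otimes>\<^bsub>P\<^esub> p \<ominus>\<^bsub>P\<^esub> D \<otimes>\<^bsub>P\<^esub> dot P k f b"
        unfolding \<sigma>_def p_def using f sK ABE D b(1) by (simp add: P.dot_minus P.dot_smult)
      also have "\<dots> = \<zero>\<^bsub>P\<^esub>"
        unfolding b(2)[symmetric] g(2) YA using cst_closed[OF ABE(1)] D g(1) by algebra
      finally have \<sigma>0: "dot P k f \<sigma> = \<zero>\<^bsub>P\<^esub>" .
      \<comment> \<open>The three summands are the errors from correcting \<open>r\<close>, from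
        approximating \<open>x\<close> by \<open>r\<close>, and from the value \<open>y^N z\<close>
        of \<open>D\<close> at \<open>\<tau>\<close>, each divided by
        \<open>A y = y^(m+1)\<close>.\<close>
      define x' where "x' i = A \<otimes> B \<otimes> r' i \<oplus> A \<otimes> B \<otimes> E \<otimes> v i \<oplus> B \<otimes> E \<otimes> z \<otimes> ev \<tau> (b i)" for i
      have x': "\<forall>i. x' i \<in> carrier C" unfolding x'_def using ABEC r'C r(2) z \<tau> b(1) by auto
      have D\<tau>: "ev \<tau> D = y [^] N \<otimes> z"
      proof -
        have "ev \<tau> D = \<tau> \<ominus> t" unfolding D_def using \<tau> V_closed t by (simp add: ev_minus ev_V ev_cst)
        also have "\<dots> = y [^] N \<otimes> z" unfolding \<tau>_def using K_closed[OF t] z cl(4) by algebra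
        finally show ?thesis .
      qed
      have eq: "A \<otimes> x i = ev \<tau> (\<sigma> i) \<oplus> (A \<otimes> y) \<otimes> x' i" for i
      proof -
        have e: "ev \<tau> (\<sigma> i) = A \<otimes> s i \<ominus> A \<otimes> y \<otimes> B \<otimes> E \<otimes> z \<otimes> ev \<tau> (b i)"
          unfolding \<sigma>_def using \<tau> ABE sK D b(1) D\<tau> yN by (simp add: ev_minus ev_mult ev_cst)
        have "ev \<tau> (b i) \<in> carrier C" "r i \<in> carrier C" "r' i \<in> carrier C" "v i \<in> carrier C"
          using \<tau> b(1) rC r'C r(2) by auto
        then show ?thesis unfolding e s_def x'_def r(3) yN using ABEC z y_closed by algebra
      qed
      have "(A \<otimes> y) \<otimes> dot C k F x' = dot C k F (\<lambda>i. (A \<otimes> y) \<otimes> x' i)"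
        using F x' ABEC by (simp add: C.dot_smult)
      also have "(\<lambda>i. (A \<otimes> y) \<otimes> x' i) = (\<lambda>i. A \<otimes> x i \<ominus> ev \<tau> (\<sigma> i))"
      proof
        fix i
        have "ev \<tau> (\<sigma> i) \<in> carrier C" "(A \<otimes> y) \<otimes> x' i \<in> carrier C" using \<tau> \<sigma> ABEC x' by auto
        then show "(A \<otimes> y) \<otimes> x' i = A \<otimes> x i \<ominus> ev \<tau> (\<sigma> i)" unfolding eq by algebra
      qed
      also have "dot C k F (\<lambda>i. A \<otimes> x i \<ominus> ev \<tau> (\<sigma> i)) = A \<otimes> dot C k F x \<ominus> ev \<tau> (dot P k f \<sigma>)"
        using F x ABEC \<tau> \<sigma> f by (simp add: C.dot_minus C.dot_smult ev_dot F_def[abs_def])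
      also have "\<dots> = \<zero>" unfolding x0 \<sigma>0 using ABEC \<tau> by (simp add: ev_zero C.minus_eq)
      finally have "y [^] Suc m \<otimes> dot C k F x' = \<zero>" unfolding A_B_E_def by simp
      then have "dot C k F x' = \<zero>"
        by (rule y_pow_cancel[rotated]) (rule C.dot_closed[OF F x'])
      then show "\<exists>\<sigma> x'. (\<forall>i. \<sigma> i \<in> carrier P) \<and> dot P k f \<sigma> = \<zero>\<^bsub>P\<^esub> \<and> (\<forall>i. x' i \<in> carrier C) \<and>
          dot C k F x' = \<zero> \<and> (\<forall>i. y [^] m \<otimes> x i = ev \<tau> (\<sigma> i) \<oplus> y [^] Suc m \<otimes> x' i)"
        using \<sigma> \<sigma>0 x' eq unfolding A_B_E_def by (intro exI[of _ \<sigma>] exI[of _ x']) simp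
    qed
  qed
  moreover have "n \<le> N" unfolding N_def by simp
  ultimately show ?thesis using w(1) unfolding t_def by blast
qed

section \<open>Relations at a fixed point of the completion\<close>

context
  fixes \<tau> assumes \<tau>: "\<tau> \<in> carrier C"
begin

abbreviation spn where "spn \<equiv> syzygy_span P C (ev \<tau>)"

lemma spn_closed: "spn k f x \<Longrightarrow> x i \<in> carrier C"
  by (induction arbitrary: i rule: syzygy_span.induct) (use \<tau> in auto)

lemma spn_syzygy:
  assumes "spn k f x" and f: "\<forall>i. f i \<in> carrier P"
  shows "dot C k (\<lambda>i. ev \<tau> (f i)) x = \<zero>"
  using assms(1)
proof induction
  case zero
  then show ?case using f \<tau> by (simp add: C.dot_zero)
next
  case (step x \<sigma> z)
  have "(\<lambda>i. x i \<oplus> ev \<tau> (\<sigma> i) \<otimes> z) = (\<lambda>i. x i \<oplus> z \<otimes> ev \<tau> (\<sigma> i))"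
    using \<tau> step.hyps by (simp add: C.m_comm)
  then have "dot C k (\<lambda>i. ev \<tau> (f i)) (\<lambda>i. x i \<oplus> ev \<tau> (\<sigma> i) \<otimes> z)
      = dot C k (\<lambda>i. ev \<tau> (f i)) x \<oplus> z \<otimes> ev \<tau> (dot P k f \<sigma>)"
    using f \<tau> step.hyps(2,4) spn_closed[OF step.hyps(1)] by (simp add: C.dot_add C.dot_smult ev_dot)
  then show ?case using step \<tau> by (simp add: ev_zero)
qed

text \<open>A syzygy of the shorter family becomes one of the longer family by putting zero in the
  new place.\<close>

lemma spn_extend:
  assumes "spn k f x" and f: "\<forall>i. f i \<in> carrier P"
  shows "\<exists>x'. spn (Suc k) f x' \<and> (\<forall>i<k. x' i = x i) \<and> x' k = \<zero>"
  using assms(1)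
proof induction
  case zero
  then show ?case using syzygy_span.zero by blast
next
  case (step x \<sigma> z)
  then obtain x' where x': "spn (Suc k) f x'" "\<forall>i<k. x' i = x i" "x' k = \<zero>" by blast
  define \<rho> where "\<rho> i = (if i = k then \<zero>\<^bsub>P\<^esub> else \<sigma> i)" for i
  have \<rho>: "\<forall>i. \<rho> i \<in> carrier P" unfolding \<rho>_def using step.hyps by simp
  have "dot P k f \<rho> = dot P k f \<sigma>" by (rule dot_cong) (auto simp: \<rho>_def)
  moreover have "\<rho> k = \<zero>\<^bsub>P\<^esub>" "f k \<in> carrier P" unfolding \<rho>_def using f by auto
  ultimately have "dot P (Suc k) f \<rho> = \<zero>\<^bsub>P\<^esub>" using step.hyps by simp
  then have "spn (Suc k) f (\<lambda>i. x' i \<oplus> ev \<tau> (\<rho> i) \<otimes> z)"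
    using syzygy_span.step[OF x'(1) \<rho>] step.hyps by blast
  moreover have "\<forall>i<k. x' i \<oplus> ev \<tau> (\<rho> i) \<otimes> z = x i \<oplus> ev \<tau> (\<sigma> i) \<otimes> z"
    using x'(2) by (simp add: \<rho>_def)
  moreover have "x' k \<oplus> ev \<tau> (\<rho> k) \<otimes> z = \<zero>"
    using x'(3) \<tau> step.hyps by (simp add: \<rho>_def ev_zero)
  ultimately show ?case by blast
qed

lemma spn_add:
  assumes "spn k f x'" "spn k f x"
  shows "spn k f (\<lambda>i. x i \<oplus> x' i)"
  using assms(1)
proof induction
  case zero
  have "(\<lambda>i. x i \<oplus> \<zero>) = x" using spn_closed[OF assms(2)] by simp
  then show ?case using assms(2) by simp
next
  case (step v \<sigma> z)
  have "(\<lambda>i. x i \<oplus> (v i \<oplus> ev \<tau> (\<sigma> i) \<otimes> z)) = (\<lambda>i. (x i \<oplus> v i) \<oplus> ev \<tau> (\<sigma> i) \<otimes> z)"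
    using spn_closed[OF assms(2)] spn_closed[OF step.hyps(1)] step.hyps \<tau> by (simp add: C.a_assoc)
  then show ?case using syzygy_span.step[OF step.IH] step.hyps by simp
qed

lemma spn_smult:
  assumes "spn k f x" "c \<in> carrier C"
  shows "spn k f (\<lambda>i. c \<otimes> x i)"
  using assms(1)
proof induction
  case zero
  then show ?case using assms(2) by (simp add: syzygy_span.zero)
next
  case (step v \<sigma> z)
  have "(\<lambda>i. c \<otimes> (v i \<oplus> ev \<tau> (\<sigma> i) \<otimes> z)) = (\<lambda>i. c \<otimes> v i \<oplus> ev \<tau> (\<sigma> i) \<otimes> (c \<otimes> z))"
    using spn_closed[OF step.hyps(1)] step.hyps \<tau> assms(2) by (simp add: C.r_distr C.m_lcomm)
  then show ?case using syzygy_span.step[OF step.IH step.hyps(2,3), of "c \<otimes> z"] step.hyps(4) assms(2) by simp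
qed

text \<open>Used to match one prescribed coordinate of a relation: the combination found for that
  coordinate is applied to the whole syzygies.\<close>

lemma spn_component:
  assumes "\<forall>j i. \<sigma> j i \<in> carrier P" "\<forall>j. dot P k f (\<sigma> j) = \<zero>\<^bsub>P\<^esub>" "\<forall>j. z j \<in> carrier C"
  shows "\<exists>x. spn k f x \<and> x i = dot C l (\<lambda>j. ev \<tau> (\<sigma> j i)) z"
proof (induction l)
  case 0
  then show ?case using syzygy_span.zero by (intro exI[of _ "\<lambda>i. \<zero>"]) auto
next
  case (Suc l)
  then obtain x where x: "spn k f x" "x i = dot C l (\<lambda>j. ev \<tau> (\<sigma> j i)) z" by blast
  then have "spn k f (\<lambda>i. x i \<oplus> ev \<tau> (\<sigma> l i) \<otimes> z l)"
    using syzygy_span.step[OF x(1), of "\<sigma> l" "z l"] assms by simp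
  then show ?case using x(2) by (intro exI conjI) (assumption, simp)
qed

text \<open>Induction on the length, removing the last coordinate. The last entries of syzygies form
  an ideal of the Noetherian ring \<open>P\<close>, so finitely many generators suffice for
  \<open>complete_span\<close>; subtracting a matching element of the span leaves a shorter
  relation.\<close>

theorem relation_in_syzygy_span:
  assumes good: "\<And>k f. \<forall>i. f i \<in> carrier P \<Longrightarrow> \<exists>m. lifts_syzygies m k f \<tau>"
    and "\<forall>i. f i \<in> carrier P" "\<forall>i. x i \<in> carrier C" "dot C k (\<lambda>i. ev \<tau> (f i)) x = \<zero>"
  shows "\<exists>M s. spn k f s \<and> (\<forall>i<k. y [^] (M::nat) \<otimes> x i = s i)"
  using assms(2-4)
proof (induction k arbitrary: f x)
  case 0
  show ?case using syzygy_span.zero by blast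
next
  case (Suc k)
  note f = Suc.prems(1) and x = Suc.prems(2,3)
  obtain m where m: "lifts_syzygies m (Suc k) f \<tau>" using good f by blast
  define F where "F i = ev \<tau> (f i)" for i
  have F: "\<forall>i. F i \<in> carrier C" unfolding F_def using \<tau> f by simp
  define Q where "Q = {\<sigma> k | \<sigma>. (\<forall>i. \<sigma> i \<in> carrier P) \<and> dot P (Suc k) f \<sigma> = \<zero>\<^bsub>P\<^esub>}"
  have "ideal Q P"
  proof (rule P.idealI_comm)
    show "Q \<subseteq> carrier P" unfolding Q_def by auto
    show "\<zero>\<^bsub>P\<^esub> \<in> Q" unfolding Q_def using P.dot_zero[OF f, of "Suc k"] by (auto intro!: exI[of _ "\<lambda>i. \<zero>\<^bsub>P\<^esub>"])
  next
    fix a b assume "a \<in> Q" "b \<in> Q"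
    then obtain \<sigma> \<rho> where *: "a = \<sigma> k" "b = \<rho> k" "\<forall>i. \<sigma> i \<in> carrier P" "\<forall>i. \<rho> i \<in> carrier P"
      "dot P (Suc k) f \<sigma> = \<zero>\<^bsub>P\<^esub>" "dot P (Suc k) f \<rho> = \<zero>\<^bsub>P\<^esub>" unfolding Q_def by blast
    then have "dot P (Suc k) f (\<lambda>i. \<sigma> i \<oplus>\<^bsub>P\<^esub> \<rho> i) = \<zero>\<^bsub>P\<^esub>"
      by (subst P.dot_add) (use f * in \<open>simp_all del: dot.simps\<close>)
    then show "a \<oplus>\<^bsub>P\<^esub> b \<in> Q" unfolding Q_def using *(1-4)
      by (intro CollectI exI[of _ "\<lambda>i. \<sigma> i \<oplus>\<^bsub>P\<^esub> \<rho> i"]) (simp del: dot.simps)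
  next
    fix a c assume "a \<in> Q" and c: "c \<in> carrier P"
    then obtain \<sigma> where *: "a = \<sigma> k" "\<forall>i. \<sigma> i \<in> carrier P"
      "dot P (Suc k) f \<sigma> = \<zero>\<^bsub>P\<^esub>" unfolding Q_def by blast
    then have "dot P (Suc k) f (\<lambda>i. c \<otimes>\<^bsub>P\<^esub> \<sigma> i) = \<zero>\<^bsub>P\<^esub>"
      by (subst P.dot_smult) (use f c * in \<open>simp_all del: dot.simps\<close>)
    then show "c \<otimes>\<^bsub>P\<^esub> a \<in> Q" unfolding Q_def using *(1,2) c
      by (intro CollectI exI[of _ "\<lambda>i. c \<otimes>\<^bsub>P\<^esub> \<sigma> i"]) (simp del: dot.simps)
  qed
  from P.ideal_eq_dot_span[OF P.is_cring this]
  obtain l q where q: "\<forall>i. q i \<in> carrier P" "Q = dot_span P l q" "\<forall>i. q i \<in> Q" .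
  have "\<forall>j. \<exists>\<sigma>. q j = \<sigma> k \<and> (\<forall>i. \<sigma> i \<in> carrier P) \<and> dot P (Suc k) f \<sigma> = \<zero>\<^bsub>P\<^esub>"
    using q(3) unfolding Q_def by blast
  then obtain \<Sigma> where \<Sigma>: "\<And>j. q j = \<Sigma> j k" "\<forall>j i. \<Sigma> j i \<in> carrier P" "\<forall>j. dot P (Suc k) f (\<Sigma> j) = \<zero>\<^bsub>P\<^esub>"
    by metis
  \<comment> \<open>With the factor \<open>y^m\<close> built in, \<open>lifts_syzygies\<close>
    decomposes each element into a combination of the specialized \<open>q j\<close> and
    \<open>y\<close> times an element of the same set.\<close>
  define S where "S = {y [^] m \<otimes> x k | x. (\<forall>i. x i \<in> carrier C) \<and> dot C (Suc k) F x = \<zero>}"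
  have SC: "S \<subseteq> carrier C" unfolding S_def by auto
  have "\<forall>s\<in>S. \<exists>b. (\<forall>j. b j \<in> carrier C) \<and> (\<exists>s'\<in>S. s = dot C l (\<lambda>j. ev \<tau> (q j)) b \<oplus> y \<otimes> s')"
  proof
    fix s assume "s \<in> S"
    then obtain x where x: "\<forall>i. x i \<in> carrier C" "dot C (Suc k) F x = \<zero>" "s = y [^] m \<otimes> x k"
      unfolding S_def by blast
    from m[unfolded lifts_syzygies_def, folded F_def, rule_format, OF conjI[OF x(1,2)]]
    obtain \<sigma> x' where *: "\<forall>i. \<sigma> i \<in> carrier P" "dot P (Suc k) f \<sigma> = \<zero>\<^bsub>P\<^esub>"
      "\<forall>i. x' i \<in> carrier C" "dot C (Suc k) F x' = \<zero>"
      "\<forall>i. y [^] m \<otimes> x i = ev \<tau> (\<sigma> i) \<oplus> y [^] Suc m \<otimes> x' i" by blast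
    have "\<sigma> k \<in> Q" unfolding Q_def using *(1,2) by blast
    then obtain g where g: "\<forall>i. g i \<in> carrier P" "\<sigma> k = dot P l q g" unfolding q(2) dot_span_def by blast
    have "ev \<tau> (\<sigma> k) = dot C l (\<lambda>j. ev \<tau> (q j)) (\<lambda>j. ev \<tau> (g j))"
      unfolding g(2) by (rule ev_dot[OF \<tau> q(1) g(1)])
    moreover have "y [^] Suc m \<otimes> x' k = y \<otimes> (y [^] m \<otimes> x' k)"
      using *(3) by (simp add: C.m_assoc C.m_lcomm)
    ultimately have "s = dot C l (\<lambda>j. ev \<tau> (q j)) (\<lambda>j. ev \<tau> (g j)) \<oplus> y \<otimes> (y [^] m \<otimes> x' k)"
      unfolding x(3) using *(5) by metis
    moreover have "y [^] m \<otimes> x' k \<in> S" unfolding S_def using *(3,4) by blast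
    ultimately have "\<exists>s'\<in>S. s = dot C l (\<lambda>j. ev \<tau> (q j)) (\<lambda>j. ev \<tau> (g j)) \<oplus> y \<otimes> s'" by (rule bexI)
    moreover have "\<forall>j. ev \<tau> (g j) \<in> carrier C" using \<tau> g(1) by simp
    ultimately show "\<exists>b. (\<forall>j. b j \<in> carrier C) \<and> (\<exists>s'\<in>S. s = dot C l (\<lambda>j. ev \<tau> (q j)) b \<oplus> y \<otimes> s')"
      by (intro exI conjI)
  qed
  moreover have "y [^] m \<otimes> x k \<in> S" unfolding S_def F_def using x by blast
  moreover have "\<forall>j. ev \<tau> (q j) \<in> carrier C" using \<tau> q(1) by simp
  ultimately have "\<exists>z. (\<forall>j. z j \<in> carrier C) \<and> y [^] m \<otimes> x k = dot C l (\<lambda>j. ev \<tau> (q j)) z"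
    by (intro complete_span[OF _ SC])
  then obtain z where z: "\<forall>j. z j \<in> carrier C" "y [^] m \<otimes> x k = dot C l (\<lambda>j. ev \<tau> (q j)) z"
    by blast
  obtain s where s: "spn (Suc k) f s" "s k = y [^] m \<otimes> x k"
    using spn_component[OF \<Sigma>(2,3) z(1), of k l] unfolding z(2) \<Sigma>(1) by blast
  have sC: "\<forall>i. s i \<in> carrier C" using spn_closed[OF s(1)] by blast
  \<comment> \<open>\<open>v\<close> is again a relation, since \<open>s\<close> is one, and its
    last entry vanishes; the induction hypothesis applies to it.\<close>
  define v where "v i = y [^] m \<otimes> x i \<ominus> s i" for i
  have v: "\<forall>i. v i \<in> carrier C" unfolding v_def using x sC by simp
  have "dot C (Suc k) F v = y [^] m \<otimes> dot C (Suc k) F x \<ominus> dot C (Suc k) F s"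
    unfolding v_def using F x sC by (simp add: C.dot_minus C.dot_smult del: dot.simps)
  also have "\<dots> = \<zero>" using x(2) spn_syzygy[OF s(1) f] unfolding F_def by (simp add: C.minus_eq)
  finally have "dot C k F v \<oplus> F k \<otimes> v k = \<zero>" by simp
  moreover have "v k = \<zero>" unfolding v_def using s(2) sC by (metis C.r_right_minus_eq)
  ultimately have "dot C k F v = \<zero>" using F v by simp
  then obtain M s1 where s1: "spn k f s1" "\<forall>i<k. y [^] (M::nat) \<otimes> v i = s1 i"
    using Suc.IH[OF f v] unfolding F_def by blast
  obtain s2 where s2: "spn (Suc k) f s2" "\<forall>i<k. s2 i = s1 i" "s2 k = \<zero>"
    using spn_extend[OF s1(1) f] by blast
  have vM: "y [^] M \<otimes> v i = s2 i" if "i < Suc k" for i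
    using that s1(2) s2(2,3) \<open>v k = \<zero>\<close> by (cases "i = k") auto
  have "y [^] (M + m) \<otimes> x i = s2 i \<oplus> y [^] M \<otimes> s i" if "i < Suc k" for i
  proof -
    define a b where "a = y [^] M" "b = y [^] m"
    have "a \<in> carrier C" "b \<in> carrier C" "x i \<in> carrier C" "s i \<in> carrier C"
      unfolding a_b_def using x sC by auto
    then have "(a \<otimes> b) \<otimes> x i = a \<otimes> (b \<otimes> x i \<ominus> s i) \<oplus> a \<otimes> s i" by algebra
    then show ?thesis unfolding vM[OF that, symmetric] v_def a_b_def by (simp add: C.nat_pow_mult)
  qed
  moreover have "spn (Suc k) f (\<lambda>i. s2 i \<oplus> y [^] M \<otimes> s i)"
    using spn_add[OF spn_smult[OF s(1)] s2(1)] by simp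
  ultimately show ?case by blast
qed

end

text \<open>Nested balls with centres in \<open>K\<close>: step \<open>n\<close> shrinks the ball
  until the condition for the \<open>n\<close>-th finite family holds on all of it. The limit of the
  centres lies in every ball.\<close>

lemma countable_lifting:
  assumes "countable (carrier P)"
  shows "\<exists>\<tau>\<in>carrier C. (\<exists>z\<in>carrier C. \<tau> = y \<otimes> z) \<and> (\<forall>k f. (\<forall>i. f i \<in> carrier P) \<longrightarrow> (\<exists>m. lifts_syzygies m k f \<tau>))"
proof -
  let ?p = "\<lambda>i. y [^] (i::nat)"
  \<comment> \<open>Finite families are enumerated as lists and padded by zeros; the lifting
    condition only sees the listed entries.\<close>
  define fn where "fn l i = (if i < length l then l ! i else \<zero>\<^bsub>P\<^esub>)" for l :: "'c list" and i
  define ls where "ls n = from_nat_into (lists (carrier P)) n" for n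
  have ls: "ls n \<in> lists (carrier P)" for n unfolding ls_def by (rule from_nat_into) auto
  have fnP: "\<forall>i. fn (ls n) i \<in> carrier P" for n unfolding fn_def using ls[of n] nth_mem by fastforce
  define good where "good n t N \<longleftrightarrow> (\<exists>m. \<forall>z\<in>carrier C. lifts_syzygies m (length (ls n)) (fn (ls n)) (t \<oplus> ?p N \<otimes> z))" for n t N
  \<comment> \<open>A state consists of the centre and the exponent of a ball; a transition passes
    to a smaller ball inside it.\<close>
  define T where "T n s s' \<longleftrightarrow> fst s' \<in> K \<and> snd s < snd s' \<and> good n (fst s') (snd s') \<and>
    (\<exists>w\<in>K. fst s' = fst s \<oplus> ?p (snd s) \<otimes> w)" for n and s s' :: "'a \<times> nat"
  have step: "\<exists>s'. T n s s'" if sK: "fst s \<in> K" for n s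
  proof -
    \<comment> \<open>Asking for \<open>Suc (snd s)\<close> instead of \<open>snd s\<close> forces
      the exponent to grow strictly.\<close>
    obtain w N m where w: "w \<in> K" "Suc (snd s) \<le> N"
      "\<forall>z\<in>carrier C. lifts_syzygies m (length (ls n)) (fn (ls n)) (fst s \<oplus> ?p (Suc (snd s)) \<otimes> w \<oplus> ?p N \<otimes> z)"
      using lifts_syzygies_locally[OF fnP sK, of "Suc (snd s)" "length (ls n)" n] by blast
    have "?p (Suc (snd s)) \<otimes> w = ?p (snd s) \<otimes> (y \<otimes> w)" using w(1) by (simp add: C.m_assoc)
    then have "T n s (fst s \<oplus> ?p (Suc (snd s)) \<otimes> w, N)"
      unfolding T_def good_def using w sK y_K by (auto intro!: bexI[of _ "y \<otimes> w"])
    then show ?thesis by blast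
  qed
  \<comment> \<open>Starting with centre zero and exponent one places the limit in
    \<open>y C\<close>.\<close>
  obtain st where st: "st 0 = (\<zero>, 1)" "\<And>n. fst (st n) \<in> K" "\<And>n. T n (st n) (st (Suc n))"
  proof -
    define st where "st = rec_nat (\<zero>, 1) (\<lambda>n s. SOME s'. T n s s')"
    have s: "st 0 = (\<zero>, 1)" "st (Suc n) = (SOME s'. T n (st n) s')" for n unfolding st_def by auto
    have K: "fst (st n) \<in> K" for n
    proof (induction n)
      case (Suc n)
      then show ?case unfolding s using someI_ex[OF step] unfolding T_def by blast
    qed (simp add: s)
    then show ?thesis using that[of st] s someI_ex[OF step] by simp
  qed
  define t N where "t n = fst (st n)" and "N n = snd (st n)" for n
  have t0: "t 0 = \<zero>" "N 0 = 1" unfolding t_def N_def using st(1) by auto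
  have tK: "t n \<in> K" and tC: "t n \<in> carrier C" for n unfolding t_def N_def using st(2)[of n] by auto
  have NS: "N n < N (Suc n)" and gd: "good n (t (Suc n)) (N (Suc n))" for n
    using st(3)[of n] unfolding T_def t_def N_def by auto
  have "\<exists>w\<in>K. t (Suc n) = t n \<oplus> ?p (N n) \<otimes> w" for n
    using st(3)[of n] unfolding T_def t_def N_def by auto
  then obtain w where w: "\<And>n. w n \<in> carrier C" "\<And>n. t (Suc n) = t n \<oplus> ?p (N n) \<otimes> w n" using K_closed by metis
  have Nn: "n \<le> N n" for n by (induction n) (use NS Suc_leI le_less_trans in \<open>auto, blast\<close>)
  have Nmono: "i \<le> j \<Longrightarrow> N i \<le> N j" for i j using NS lift_Suc_mono_le[of N] by (simp add: less_imp_le)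
  have psplit: "?p b = ?p a \<otimes> ?p (b - a)" if "a \<le> b" for a b
    using that C.nat_pow_mult[OF y_closed, of a "b - a"] by simp
  \<comment> \<open>The increments \<open>y^(N n) w n\<close> are rewritten with the exact power
    \<open>y^n\<close>, since completeness is stated for power series in \<open>y\<close>.\<close>
  define c where "c n = ?p (N n - n) \<otimes> w n" for n
  have c: "\<forall>n. c n \<in> carrier C" unfolding c_def using w(1) by simp
  have tsum: "t n = dot C n ?p c" for n
  proof (induction n)
    case (Suc n)
    have "?p (N n) \<otimes> w n = ?p n \<otimes> c n" unfolding c_def psplit[OF Nn[of n]] using w(1) by (simp add: C.m_assoc)
    then show ?case unfolding w(2) using Suc by simp
  qed (simp add: t0)
  obtain \<tau> where \<tau>: "\<tau> \<in> carrier C" "\<forall>n. \<exists>z\<in>carrier C. \<tau> = t n \<oplus> ?p n \<otimes> z"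
    unfolding tsum using complete[OF c] by blast
  have tt: "\<exists>z\<in>carrier C. t (n + j) = t n \<oplus> ?p (N n) \<otimes> z" for n j
  proof (induction j)
    case 0
    then show ?case using tC[of n] by (intro bexI[of _ "\<zero>"]) simp_all
  next
    case (Suc j)
    then obtain z where z: "z \<in> carrier C" "t (n + j) = t n \<oplus> ?p (N n) \<otimes> z" by blast
    define a b where "a = ?p (N n)" "b = ?p (N (n + j) - N n)"
    have "t (n + Suc j) = t n \<oplus> a \<otimes> z \<oplus> (a \<otimes> b) \<otimes> w (n + j)"
      unfolding a_b_def psplit[OF Nmono[OF le_add1[of n j]], symmetric] z(2)[symmetric] using w(2)[of "n + j"] by simp
    also have "\<dots> = t n \<oplus> a \<otimes> (z \<oplus> b \<otimes> w (n + j))"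
    proof -
      have "a \<in> carrier C" "b \<in> carrier C" unfolding a_b_def by auto
      then show ?thesis using tC[of n] z(1) w(1)[of "n + j"] by algebra
    qed
    finally have "t (n + Suc j) = t n \<oplus> ?p (N n) \<otimes> (z \<oplus> b \<otimes> w (n + j))" unfolding a_b_def .
    then show ?case by (rule bexI) (use z(1) w(1)[of "n + j"] in \<open>simp add: a_b_def\<close>)
  qed
  \<comment> \<open>Completeness gives agreement with \<open>t n\<close> only to order
    \<open>n\<close>; comparison with the later centre \<open>t (n + N n)\<close> raises it to
    \<open>N n\<close>.\<close>
  have \<tau>N: "\<exists>z\<in>carrier C. \<tau> = t n \<oplus> ?p (N n) \<otimes> z" for n
  proof -
    obtain z where z: "z \<in> carrier C" "\<tau> = t (n + N n) \<oplus> ?p (n + N n) \<otimes> z" using \<tau>(2) by blast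
    obtain v where v: "v \<in> carrier C" "t (n + N n) = t n \<oplus> ?p (N n) \<otimes> v" using tt by blast
    define a b where "a = ?p (N n)" "b = ?p n"
    have ab: "a \<in> carrier C" "b \<in> carrier C" unfolding a_b_def by auto
    have "\<tau> = t n \<oplus> a \<otimes> v \<oplus> (b \<otimes> a) \<otimes> z"
      unfolding z(2) v(2) a_b_def by (simp add: C.nat_pow_mult)
    also have "\<dots> = t n \<oplus> a \<otimes> (v \<oplus> b \<otimes> z)"
      using ab tC[of n] v(1) z(1) by algebra
    finally have "\<tau> = t n \<oplus> ?p (N n) \<otimes> (v \<oplus> b \<otimes> z)" unfolding a_b_def .
    then show ?thesis by (rule bexI) (use ab v(1) z(1) in simp)
  qed
  have "\<exists>z\<in>carrier C. \<tau> = y \<otimes> z" using \<tau>N[of 0] unfolding t0 by auto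
  moreover have "\<exists>m. lifts_syzygies m k f \<tau>" if f: "\<forall>i. f i \<in> carrier P" for k f
  proof -
    have "map f [0..<k] \<in> lists (carrier P)" using f by auto
    then obtain n where n: "ls n = map f [0..<k]"
      unfolding ls_def using from_nat_into_surj[of "lists (carrier P)"] assms by (metis countable_lists)
    have e: "length (ls n) = k" "\<And>i. i < k \<Longrightarrow> fn (ls n) i = f i" unfolding n fn_def by auto
    have "dot C k (\<lambda>i. ev \<tau> (fn (ls n) i)) x = dot C k (\<lambda>i. ev \<tau> (f i)) x" for x
      by (rule dot_cong) (simp_all add: e)
    moreover have "dot P k (fn (ls n)) x = dot P k f x" for x
      by (rule dot_cong) (simp_all add: e)
    moreover obtain m where "lifts_syzygies m (length (ls n)) (fn (ls n)) \<tau>"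
    proof -
      obtain z where z: "z \<in> carrier C" "\<tau> = t (Suc n) \<oplus> ?p (N (Suc n)) \<otimes> z" using \<tau>N by blast
      from gd[of n] obtain m where
        "\<forall>z\<in>carrier C. lifts_syzygies m (length (ls n)) (fn (ls n)) (t (Suc n) \<oplus> ?p (N (Suc n)) \<otimes> z)"
        unfolding good_def ..
      from bspec[OF this z(1)] show thesis unfolding z(2)[symmetric] by (rule that)
    qed
    ultimately have "lifts_syzygies m k f \<tau>" unfolding lifts_syzygies_def e(1) by simp
    then show ?thesis by blast
  qed
  ultimately show ?thesis using \<tau>(1) by blast
qed

end

section \<open>Polynomial rings over a Noetherian domain\<close>

text \<open>The classical argument by least degree: outside the ideal of its predecessors each
  \<open>p n\<close> is chosen as short as possible, and stationarity of the ideals of leading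
  coefficients yields a still shorter choice. Polynomials are coefficient lists with the leading
  coefficient at the head, so \<open>length\<close> is the degree plus one and ranks zero
  lowest.\<close>

lemma (in domain) Hilbert_basis:
  assumes "noetherian_ring R"
  shows "noetherian_ring ((carrier R)[X])"
proof -
  interpret N: noetherian_ring R by fact
  let ?P = "(carrier R)[X]"
  interpret P: domain ?P by (rule univ_poly_is_domain[OF carrier_is_subring])
  have pol: "p \<in> carrier ?P \<longleftrightarrow> polynomial (carrier R) p" for p by (simp add: univ_poly_carrier)
  show ?thesis
  proof (rule P.noetherian_ringI, rule ccontr)
    fix J assume "ideal J ?P" and nfg: "\<not> (\<exists>A\<subseteq>carrier ?P. finite A \<and> J = Idl\<^bsub>?P\<^esub> A)"
    interpret J: ideal J ?P by fact
    define G where "G l = Idl\<^bsub>?P\<^esub> (set l)" for l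
    define ok where "ok l p \<longleftrightarrow> p \<in> J \<and> p \<notin> G l \<and> (\<forall>q\<in>J. q \<notin> G l \<longrightarrow> length p \<le> length q)" for l p
    have ex: "\<exists>p. ok l p" if l: "set l \<subseteq> J" for l
    proof -
      have "set l \<subseteq> carrier ?P" using l J.Icarr by blast
      then have "G l \<noteq> J" "G l \<subseteq> J" unfolding G_def
        using nfg P.genideal_minimal[OF J.ideal_axioms l] by auto
      then obtain p where "p \<in> J \<and> p \<notin> G l" by blast
      from ex_has_least_nat[of "\<lambda>p. p \<in> J \<and> p \<notin> G l", OF this, of length]
      show ?thesis unfolding ok_def by blast
    qed
    define L where "L = rec_nat [] (\<lambda>n l. l @ [SOME p. ok l p])"
    define p where "p n = (SOME p. ok (L n) p)" for n
    have L: "L 0 = []" "L (Suc n) = L n @ [p n]" for n unfolding L_def p_def by simp_all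
    have LJ: "set (L n) \<subseteq> J" for n
    proof (induction n)
      case (Suc n)
      from someI_ex[OF ex[OF Suc]] show ?case unfolding L p_def ok_def using Suc by simp
    qed (simp add: L)
    have okp: "ok (L n) (p n)" for n unfolding p_def by (rule someI_ex[OF ex[OF LJ]])
    have pJ: "p n \<in> J" and pG: "p n \<notin> G (L n)" for n using okp[of n] unfolding ok_def by auto
    have pmin: "length (p n) \<le> length q" if "q \<in> J" "q \<notin> G (L n)" for n q
      using okp[of n] that unfolding ok_def by blast
    have pP: "p n \<in> carrier ?P" for n using J.Icarr pJ by blast
    have LP: "set (L n) \<subseteq> carrier ?P" for n using LJ J.Icarr by blast
    have G_ideal: "ideal (G (L n)) ?P" for n unfolding G_def by (rule P.genideal_ideal[OF LP])
    have pL: "p i \<in> G (L n)" if "i < n" for i n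
    proof -
      have "p i \<in> set (L n)" using that by (induction n) (auto simp: L less_Suc_eq)
      then show ?thesis unfolding G_def using P.genideal_self[OF LP] by blast
    qed
    have p_ne: "p n \<noteq> []" for n
      using pG[of n] additive_subgroup.zero_closed[OF ideal.axioms(1)[OF G_ideal]] by (auto simp: univ_poly_zero)
    have len: "length (p i) \<le> length (p n)" if "i \<le> n" for i n
    proof (rule pmin[OF pJ])
      have "G (L i) \<subseteq> G (L n)" unfolding G_def
      proof (rule P.genideal_minimal[OF P.genideal_ideal[OF LP]])
        have "set (L i) \<subseteq> set (L n)" using that by (induction rule: dec_induct) (auto simp: L)
        then show "set (L i) \<subseteq> Idl\<^bsub>?P\<^esub> (set (L n))" using P.genideal_self[OF LP] by blast
      qed
      then show "p n \<notin> G (L i)" using pG by blast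
    qed
    define a where "a n = hd (p n)" for n
    have a: "\<forall>n. a n \<in> carrier R" and a0: "a n \<noteq> \<zero>" for n
      using pP p_ne unfolding a_def pol polynomial_def by (metis hd_in_set subsetD, metis)
    define I where "I n = dot_span R n a" for n
    have "I n \<subseteq> I (Suc n)" for n
    proof
      fix x assume "x \<in> I n"
      then obtain g where g: "\<forall>i. g i \<in> carrier R" "x = dot R n a g" unfolding I_def dot_span_def by blast
      have "dot R (Suc n) a (\<lambda>i. if i = n then \<zero> else g i) = dot R n a (\<lambda>i. if i = n then \<zero> else g i) \<oplus> a n \<otimes> \<zero>" by simp
      also have "dot R n a (\<lambda>i. if i = n then \<zero> else g i) = x" unfolding g(2) by (rule dot_cong) auto
      finally have "dot R (Suc n) a (\<lambda>i. if i = n then \<zero> else g i) = x" using a g by simp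
      then show "x \<in> I (Suc n)" unfolding I_def dot_span_def using g(1)
        by (intro CollectI exI[of _ "\<lambda>i. if i = n then \<zero> else g i"]) simp
    qed
    moreover have "ideal (I n) R" for n unfolding I_def by (rule dot_span_ideal[OF a])
    ultimately obtain n where n: "\<forall>m\<ge>n. I m = I n" using N.ideal_sequence_stationary[of I] by blast
    have "a n \<in> I (Suc n)" unfolding I_def by (rule dot_span_gen[OF a]) simp
    moreover have "I (Suc n) = I n" using n[rule_format, of "Suc n"] by simp
    ultimately have "a n \<in> I n" by simp
    then obtain b where b: "\<forall>i. b i \<in> carrier R" "a n = dot R n a b" unfolding I_def dot_span_def by auto
    define N where "N = length (p n)"
    have N: "N > 0" unfolding N_def using p_ne by simp
    \<comment> \<open>The shift aligns the leading term of \<open>p i\<close> with that of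
      \<open>p n\<close>. A zero coefficient is treated apart because a list headed by zero is not a
      polynomial.\<close>
    define M where "M i = (if b i = \<zero> \<or> i \<ge> n then [] else monom (b i) (N - length (p i)))" for i
    have M: "\<forall>i. M i \<in> carrier ?P" unfolding M_def pol using b(1) monom_is_polynomial[OF carrier_is_subring] by auto
    have pP': "\<forall>i. p i \<in> carrier ?P" using pP by blast
    have trm: "length (p i \<otimes>\<^bsub>?P\<^esub> M i) \<le> N \<and> coeff (p i \<otimes>\<^bsub>?P\<^esub> M i) (N - 1) = a i \<otimes> b i" if i: "i < n" for i
    proof (cases "b i = \<zero>")
      case True
      then have "p i \<otimes>\<^bsub>?P\<^esub> M i = []" unfolding M_def using pP[of i] P.r_null[of "p i"] by (simp add: univ_poly_zero)
      then show ?thesis using a True by simp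
    next
      case False
      have Mi: "M i = monom (b i) (N - length (p i))" "M i \<noteq> []" unfolding M_def monom_def using False i by auto
      have l: "length (p i) \<le> N" "length (p i) > 0" unfolding N_def using len[of i n] i p_ne by auto
      have deg: "degree (M i) = N - length (p i)" unfolding Mi(1) monom_def by simp
      have pp: "polynomial (carrier R) (p i)" "polynomial (carrier R) (M i)" using pP M pol by auto
      have "degree (p i \<otimes>\<^bsub>?P\<^esub> M i) = degree (p i) + degree (M i)"
        using poly_mult_degree_eq[OF carrier_is_subring pp] p_ne Mi(2) by (simp add: univ_poly_mult)
      then have d: "degree (p i \<otimes>\<^bsub>?P\<^esub> M i) = N - 1" unfolding deg using l by simp
      have ne: "p i \<otimes>\<^bsub>?P\<^esub> M i \<noteq> []"
        using poly_mult_integral[OF carrier_is_subring pp] p_ne Mi(2) by (auto simp: univ_poly_mult)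
      have "hd (p i \<otimes>\<^bsub>?P\<^esub> M i) = a i \<otimes> b i"
        using poly_mult_lead_coeff[OF carrier_is_subring pp] p_ne Mi unfolding a_def by (simp add: univ_poly_mult monom_def)
      then have "coeff (p i \<otimes>\<^bsub>?P\<^esub> M i) (N - 1) = a i \<otimes> b i" using lead_coeff_simp[OF ne] d by simp
      moreover have "length (p i \<otimes>\<^bsub>?P\<^esub> M i) \<le> N" using d N by linarith
      ultimately show ?thesis by simp
    qed
    have incl: "set q \<subseteq> carrier R" if "q \<in> carrier ?P" for q
      using that polynomial_incl pol by blast
    have add_len: "length (q \<oplus>\<^bsub>?P\<^esub> r) \<le> max (length q) (length r)" for q r
      unfolding univ_poly_add by (rule poly_add_length_le)
    have add_coeff: "coeff (q \<oplus>\<^bsub>?P\<^esub> r) j = coeff q j \<oplus> coeff r j" if "q \<in> carrier ?P" "r \<in> carrier ?P" for q r j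
      unfolding univ_poly_add using poly_add_coeff[OF incl[OF that(1)] incl[OF that(2)]] by simp
    \<comment> \<open>The coefficient in position \<open>N - 1\<close> is followed rather than the
      leading one, because partial sums may drop in degree.\<close>
    have sum: "length (dot ?P k p M) \<le> N \<and> coeff (dot ?P k p M) (N - 1) = dot R k a b" if "k \<le> n" for k
      using that
    proof (induction k)
      case 0
      then show ?case by (simp add: univ_poly_zero)
    next
      case (Suc k)
      have IH: "length (dot ?P k p M) \<le> N" "coeff (dot ?P k p M) (N - 1) = dot R k a b" using Suc.IH Suc.prems by auto
      have t: "length (p k \<otimes>\<^bsub>?P\<^esub> M k) \<le> N" "coeff (p k \<otimes>\<^bsub>?P\<^esub> M k) (N - 1) = a k \<otimes> b k"
        using trm[of k] Suc.prems by auto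
      have cl: "dot ?P k p M \<in> carrier ?P" "p k \<otimes>\<^bsub>?P\<^esub> M k \<in> carrier ?P" using P.dot_closed[OF pP' M] pP M by auto
      show ?case using add_len[of "dot ?P k p M" "p k \<otimes>\<^bsub>?P\<^esub> M k"] IH t add_coeff[OF cl] by simp
    qed
    define q where "q = dot ?P n p M"
    have q: "q \<in> carrier ?P" "length q \<le> N" "coeff q (N - 1) = a n"
      unfolding q_def b(2) using P.dot_closed[OF pP' M] sum[of n] by auto
    have qG: "q \<in> G (L n)"
    proof -
      interpret G: ideal "G (L n)" ?P by (rule G_ideal)
      have "dot ?P k p M \<in> G (L n)" if "k \<le> n" for k
        using that
      proof (induction k)
        case (Suc k)
        have "p k \<otimes>\<^bsub>?P\<^esub> M k \<in> G (L n)" using G.I_r_closed[OF pL[of k n]] M Suc.prems by simp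
        then show ?case using Suc.IH Suc.prems G.a_closed by simp
      qed simp
      then show ?thesis unfolding q_def by simp
    qed
    interpret G: ideal "G (L n)" ?P by (rule G_ideal)
    have GJ: "G (L n) \<subseteq> J" unfolding G_def by (rule P.genideal_minimal[OF J.ideal_axioms LJ])
    \<comment> \<open>The leading terms cancel, so \<open>r\<close> is shorter than
      \<open>p n\<close>, yet it lies in \<open>J\<close> and outside the ideal of the
      predecessors.\<close>
    define r where "r = p n \<ominus>\<^bsub>?P\<^esub> q"
    have r: "r \<in> carrier ?P" unfolding r_def using pP q by simp
    have pr: "p n = r \<oplus>\<^bsub>?P\<^esub> q" unfolding r_def using pP[of n] q(1) by (simp add: P.minus_eq P.a_assoc P.l_neg)
    have rJ: "r \<in> J" unfolding r_def P.minus_eq using J.a_closed[OF pJ[of n]] J.a_inv_closed GJ qG by blast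
    have rG: "r \<notin> G (L n)"
      using pG[of n] G.a_closed[OF _ qG] unfolding pr by blast
    have "length r \<le> N" unfolding r_def P.minus_eq
      using add_len[of "p n" "\<ominus>\<^bsub>?P\<^esub> q"] univ_poly_a_inv_length[OF carrier_is_subring q(1)] q(2) N_def by simp
    moreover have "length r \<noteq> N"
    proof
      assume lr: "length r = N"
      then have rne: "r \<noteq> []" using N by auto
      have rc: "coeff r (N - 1) \<in> carrier R" using coeff_in_carrier[OF incl[OF r]] by blast
      have "coeff (p n) (N - 1) = coeff r (N - 1) \<oplus> a n"
        using add_coeff[OF r q(1)] q(3) pr by simp
      moreover have "coeff (p n) (N - 1) = a n" unfolding N_def a_def using lead_coeff_simp[OF p_ne] by simp
      ultimately have "coeff r (N - 1) = \<zero>" using a rc by (metis add.r_cancel_one)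
      then have "hd r = \<zero>" using lead_coeff_simp[OF rne] lr by simp
      then show False using r rne unfolding pol polynomial_def by auto
    qed
    moreover have "N \<le> length r" unfolding N_def by (rule pmin[OF rJ rG])
    ultimately show False by simp
  qed
qed

text \<open>Long division by the monic \<open>X - t\<close> leaves a constant remainder, which
  evaluation at \<open>t\<close> identifies.\<close>

lemma (in domain) univ_poly_linear_division:
  assumes t: "t \<in> carrier R" and p: "p \<in> carrier ((carrier R)[X])"
  shows "\<exists>g\<in>carrier ((carrier R)[X]). p = poly_of_const (eval p t) \<oplus>\<^bsub>(carrier R)[X]\<^esub>
    (X \<ominus>\<^bsub>(carrier R)[X]\<^esub> poly_of_const t) \<otimes>\<^bsub>(carrier R)[X]\<^esub> g"
proof -
  let ?P = "(carrier R)[X]"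
  interpret P: domain ?P by (rule univ_poly_is_domain[OF carrier_is_subring])
  have pol: "p \<in> carrier ?P \<longleftrightarrow> polynomial (carrier R) p" for p by (simp add: univ_poly_carrier)
  have cst: "poly_of_const c \<in> carrier ?P" if "c \<in> carrier R" for c
    using ring_hom_memE(1)[OF canonical_embedding_is_hom[OF carrier_is_subring]] that by simp
  have X: "X \<in> carrier ?P" by (rule var_closed[OF carrier_is_subring])
  let ?b = "X \<ominus>\<^bsub>?P\<^esub> poly_of_const t"
  have b: "?b \<in> carrier ?P" using X cst[OF t] by simp
  have bb: "?b = [\<one>, \<ominus> t]"
    unfolding P.minus_eq univ_poly_a_inv_def'[OF carrier_is_subring cst[OF t]]
    using t by (simp add: poly_of_const_def var_def univ_poly_add)
  have "lead_coeff ?b \<in> Units (R\<lparr>carrier := carrier R\<rparr>)" unfolding bb by simp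
  then obtain q r where qr: "polynomial (carrier R) q" "polynomial (carrier R) r"
      "p = ?b \<otimes>\<^bsub>?P\<^esub> q \<oplus>\<^bsub>?P\<^esub> r" "r = [] \<or> degree r < degree ?b"
    using long_division_theorem[OF carrier_is_subring, of p ?b] p b unfolding pol bb by auto
  have "\<exists>c\<in>carrier R. r = poly_of_const c"
  proof (cases r)
    case Nil
    then show ?thesis by (intro bexI[of _ \<zero>]) (simp_all add: poly_of_const_def)
  next
    case (Cons c r')
    then have "r' = []" using qr(4) unfolding bb by simp
    then show ?thesis using Cons qr(2) unfolding polynomial_def
      by (intro bexI[of _ c]) (auto simp: poly_of_const_def)
  qed
  then obtain c where c: "c \<in> carrier R" "r = poly_of_const c" by blast
  have hom: "(\<lambda>p. eval p t) \<in> ring_hom ?P R"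
    using eval_cring_hom[OF carrier_is_subring t] unfolding ring_hom_cring_def ring_hom_cring_axioms_def by simp
  have qP: "q \<in> carrier ?P" using qr(1) pol by simp
  have "eval ?b t = \<zero>" unfolding bb using t by (simp add: r_neg)
  moreover have "eval r t = c" unfolding c(2) poly_of_const_def using c(1) by simp
  ultimately have "eval p t = c" unfolding qr(3)
    using ring_hom_memE(2,3)[OF hom] qP b cst[OF c(1)] c t eval_poly_in_carrier[OF carrier_is_subring qr(1)]
    by simp
  then have "p = poly_of_const (eval p t) \<oplus>\<^bsub>?P\<^esub> ?b \<otimes>\<^bsub>?P\<^esub> q"
    using qr(3) c qP b cst[OF c(1)] by (simp add: P.a_comm)
  then show ?thesis using qP by blast
qed

section \<open>The equational criterion for flatness\<close>

text \<open>Associativity of the product of a row, a matrix and a column.\<close>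

lemma (in cring) dot_swap:
  assumes "\<forall>i. e i \<in> carrier R" "\<forall>i j. \<phi> i j \<in> carrier R" "\<forall>j. z j \<in> carrier R"
  shows "dot R n e (\<lambda>i. dot R l (\<phi> i) z) = dot R l (\<lambda>j. dot R n e (\<lambda>i. \<phi> i j)) z"
proof (induction l)
  case 0
  then show ?case using assms by (simp add: dot_zero)
next
  case (Suc l)
  have 1: "dot R n e (\<lambda>i. dot R l (\<phi> i) z \<oplus> \<phi> i l \<otimes> z l)
      = dot R n e (\<lambda>i. dot R l (\<phi> i) z) \<oplus> dot R n e (\<lambda>i. \<phi> i l \<otimes> z l)"
    using assms by (simp add: dot_add)
  have "(\<lambda>i. \<phi> i l \<otimes> z l) = (\<lambda>i. z l \<otimes> \<phi> i l)" using assms by (simp add: m_comm)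
  then have "dot R n e (\<lambda>i. \<phi> i l \<otimes> z l) = dot R n e (\<lambda>i. \<phi> i l) \<otimes> z l"
    using assms by (simp add: dot_smult m_comm)
  then show ?case using 1 Suc by simp
qed

lemma (in ring) dot_delta:
  assumes "\<forall>i. v i \<in> carrier R" "s < n"
  shows "dot R n v (\<lambda>j. if j = s then \<one> else \<zero>) = v s"
proof -
  have "dot R n v (\<lambda>j. if j = s then \<one> else \<zero>) = (if s < n then v s else \<zero>)"
    by (induction n) (use assms in \<open>auto simp: less_Suc_eq\<close>)
  then show ?thesis using assms by simp
qed

text \<open>Triviality of linear relations in the sense of the equational criterion; the columns of
  \<open>\<sigma>\<close> are the solutions over \<open>A\<close> from which the given solution is
  combined.\<close>

definition equationally_flat :: "('a, 'c) ring_scheme \<Rightarrow> ('b, 'd) ring_scheme \<Rightarrow> ('a \<Rightarrow> 'b) \<Rightarrow> bool" where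
  "equationally_flat A B f \<longleftrightarrow>
     (\<forall>k a x. (\<forall>i. a i \<in> carrier A) \<and> (\<forall>i. x i \<in> carrier B) \<and> dot B k (\<lambda>i. f (a i)) x = \<zero>\<^bsub>B\<^esub> \<longrightarrow>
       (\<exists>l \<sigma> z. (\<forall>i j. \<sigma> i j \<in> carrier A) \<and> (\<forall>j. z j \<in> carrier B) \<and>
          (\<forall>j<l. dot A k a (\<lambda>i. \<sigma> i j) = \<zero>\<^bsub>A\<^esub>) \<and>
          (\<forall>i<k. x i = dot B l (\<lambda>j. f (\<sigma> i j)) z)))"

locale flat_algebra = A: cring A + B: cring B for A (structure) and B (structure) and f +
  assumes hom: "f \<in> ring_hom A B" and eqflat: "equationally_flat A B f"
begin

lemma f_closed [simp]: "a \<in> carrier A \<Longrightarrow> f a \<in> carrier B"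
  using ring_hom_memE(1)[OF hom] .

lemma f_dot: "\<forall>i. c i \<in> carrier A \<Longrightarrow> \<forall>i. x i \<in> carrier A \<Longrightarrow>
    f (dot A k c x) = dot B k (\<lambda>i. f (c i)) (\<lambda>i. f (x i))"
  by (rule ring_hom_dot[OF A.ring_axioms B.ring_axioms hom])

lemmas eqflatD = eqflat[unfolded equationally_flat_def, THEN spec, THEN spec, THEN spec, THEN mp, OF conjI[OF _ conjI]]

text \<open>Equations are handled one at a time, starting from the identity matrix. Substituting the
  current parametrization turns the next equation into a single relation among the
  \<open>z j\<close>; the matrix that trivializes it is multiplied onto the previous one, which
  keeps the earlier equations solved.\<close>

lemma system_solution:
  assumes x: "\<forall>i. x i \<in> carrier B"
    and "\<forall>e\<in>set es. (\<forall>i. e i \<in> carrier A) \<and> dot B n (\<lambda>i. f (e i)) x = \<zero>\<^bsub>B\<^esub>"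
  shows "\<exists>l \<phi> z. (\<forall>i j. \<phi> i j \<in> carrier A) \<and> (\<forall>j. z j \<in> carrier B) \<and>
    (\<forall>i<n. x i = dot B l (\<lambda>j. f (\<phi> i j)) z) \<and> (\<forall>e\<in>set es. \<forall>j<l. dot A n e (\<lambda>i. \<phi> i j) = \<zero>)"
  using assms(2)
proof (induction es)
  case Nil
  have "x i = dot B n (\<lambda>j. f (if j = i then \<one> else \<zero>)) x" if "i < n" for i
  proof -
    have "(\<lambda>j. f (if j = i then \<one> else \<zero>)) = (\<lambda>j. if j = i then \<one>\<^bsub>B\<^esub> else \<zero>\<^bsub>B\<^esub>)"
      using ring_hom_one[OF hom] ring_hom_zero[OF hom A.ring_axioms B.ring_axioms] by auto
    moreover have "dot B n (\<lambda>j. if j = i then \<one>\<^bsub>B\<^esub> else \<zero>\<^bsub>B\<^esub>) x = dot B n x (\<lambda>j. if j = i then \<one>\<^bsub>B\<^esub> else \<zero>\<^bsub>B\<^esub>)"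
      using x by (intro B.dot_commute) auto
    ultimately show ?thesis using B.dot_delta[OF x that] by simp
  qed
  then show ?case using x
    by (intro exI[of _ n] exI[of _ "\<lambda>i j. if j = i then \<one> else \<zero>"] exI[of _ x]) simp
next
  case (Cons e es)
  then obtain l \<phi> z where *: "\<forall>i j. \<phi> i j \<in> carrier A" "\<forall>j. z j \<in> carrier B"
    "\<forall>i<n. x i = dot B l (\<lambda>j. f (\<phi> i j)) z" "\<forall>e\<in>set es. \<forall>j<l. dot A n e (\<lambda>i. \<phi> i j) = \<zero>"
    by auto
  have e: "\<forall>i. e i \<in> carrier A" "dot B n (\<lambda>i. f (e i)) x = \<zero>\<^bsub>B\<^esub>" using Cons.prems by auto
  have es: "\<forall>i. e' i \<in> carrier A" if "e' \<in> set es" for e' using Cons.prems that by simp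
  define b where "b j = dot A n e (\<lambda>i. \<phi> i j)" for j
  have b: "\<forall>j. b j \<in> carrier A" unfolding b_def using e(1) *(1) by simp
  have "dot B l (\<lambda>j. f (b j)) z = dot B l (\<lambda>j. dot B n (\<lambda>i. f (e i)) (\<lambda>i. f (\<phi> i j))) z"
    unfolding b_def using e(1) *(1) by (simp add: f_dot)
  also have "\<dots> = dot B n (\<lambda>i. f (e i)) (\<lambda>i. dot B l (\<lambda>j. f (\<phi> i j)) z)"
    by (rule B.dot_swap[symmetric]) (use e(1) *(1,2) in auto)
  also have "\<dots> = dot B n (\<lambda>i. f (e i)) x" by (rule dot_cong) (use *(3) in auto)
  finally have "dot B l (\<lambda>j. f (b j)) z = \<zero>\<^bsub>B\<^esub>" using e(2) by simp
  then obtain l' \<sigma> z' where s: "\<forall>i j. \<sigma> i j \<in> carrier A" "\<forall>j. z' j \<in> carrier B"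
    "\<forall>j<l'. dot A l b (\<lambda>i. \<sigma> i j) = \<zero>" "\<forall>i<l. z i = dot B l' (\<lambda>j. f (\<sigma> i j)) z'"
    using eqflatD[OF b *(2)] by blast
  define \<psi> where "\<psi> i k = dot A l (\<phi> i) (\<lambda>j. \<sigma> j k)" for i k
  have \<psi>: "\<forall>i k. \<psi> i k \<in> carrier A" unfolding \<psi>_def using *(1) s(1) by simp
  have 1: "x i = dot B l' (\<lambda>k. f (\<psi> i k)) z'" if "i < n" for i
  proof -
    have "x i = dot B l (\<lambda>j. f (\<phi> i j)) z" using *(3) that by simp
    also have "\<dots> = dot B l (\<lambda>j. f (\<phi> i j)) (\<lambda>j. dot B l' (\<lambda>k. f (\<sigma> j k)) z')"
      by (rule dot_cong) (use s(4) in auto)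
    also have "\<dots> = dot B l' (\<lambda>k. dot B l (\<lambda>j. f (\<phi> i j)) (\<lambda>j. f (\<sigma> j k))) z'"
      by (rule B.dot_swap) (use *(1) s(1,2) in auto)
    also have "\<dots> = dot B l' (\<lambda>k. f (\<psi> i k)) z'" unfolding \<psi>_def using *(1) s(1) by (simp add: f_dot)
    finally show ?thesis .
  qed
  have swap: "dot A n e' (\<lambda>i. \<psi> i k) = dot A l (\<lambda>j. dot A n e' (\<lambda>i. \<phi> i j)) (\<lambda>j. \<sigma> j k)"
    if "\<forall>i. e' i \<in> carrier A" for e' k
    unfolding \<psi>_def by (rule A.dot_swap) (use that *(1) s(1) in auto)
  have 2: "dot A n e' (\<lambda>i. \<psi> i k) = \<zero>" if "k < l'" "e' \<in> set (e # es)" for e' k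
  proof (cases "e' = e")
    case True
    then show ?thesis using swap[OF e(1)] s(3) that(1) unfolding b_def by simp
  next
    case False
    then have e': "e' \<in> set es" using that(2) by simp
    have "dot A l (\<lambda>j. dot A n e' (\<lambda>i. \<phi> i j)) (\<lambda>j. \<sigma> j k) = dot A l (\<lambda>j. \<zero>) (\<lambda>j. \<sigma> j k)"
      by (rule dot_cong) (use *(4) e' in auto)
    also have "\<dots> = dot A l (\<lambda>j. \<sigma> j k) (\<lambda>j. \<zero>)" by (rule A.dot_commute) (use s(1) in auto)
    also have "\<dots> = \<zero>" by (rule A.dot_zero) (use s(1) in auto)
    finally show ?thesis using swap[OF es[OF e']] by simp
  qed
  show ?case
    by (intro exI[of _ l'] exI[of _ \<psi>] exI[of _ z'] conjI ballI allI impI) (use \<psi> s(2) in blast, use s(2) in blast, erule 1, rule 2)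
qed

text \<open>The additivity and scaling identities listed in \<open>U\<close> and \<open>W\<close>
  form a finite linear system over \<open>A\<close>, solved by the elements of \<open>B\<close> that
  occur in them. Trivializing this system gives a matrix each of whose columns is a map obeying the
  same identities.\<close>

lemma partial_functionals:
  assumes F: "finite F" "F \<subseteq> carrier B"
    and U: "finite U" "U \<subseteq> carrier B \<times> carrier B"
    and W: "finite W" "W \<subseteq> carrier A \<times> carrier B"
  shows "\<exists>l \<phi> z. (\<forall>j b. \<phi> j b \<in> carrier A) \<and> (\<forall>j. z j \<in> carrier B) \<and>
    (\<forall>b\<in>F. b = dot B l (\<lambda>j. f (\<phi> j b)) z) \<and>
    (\<forall>j<l. (\<forall>(p, q)\<in>U. \<phi> j (p \<oplus>\<^bsub>B\<^esub> q) = \<phi> j p \<oplus> \<phi> j q) \<and>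
           (\<forall>(a, p)\<in>W. \<phi> j (f a \<otimes>\<^bsub>B\<^esub> p) = a \<otimes> \<phi> j p))"
proof -
  \<comment> \<open>Sums and multiples are listed as unknowns of their own, next to the elements
    they are formed from.\<close>
  define G where "G = F \<union> fst ` U \<union> snd ` U \<union> (\<lambda>(p, q). p \<oplus>\<^bsub>B\<^esub> q) ` U \<union> snd ` W \<union> (\<lambda>(a, p). f a \<otimes>\<^bsub>B\<^esub> p) ` W"
  have G: "finite G" "G \<subseteq> carrier B" unfolding G_def using F U W by auto
  obtain xs where xs: "set xs = G" using G(1) finite_list by blast
  define n where "n = length xs"
  define x where "x i = (if i < n then xs ! i else \<zero>\<^bsub>B\<^esub>)" for i
  have x: "\<forall>i. x i \<in> carrier B" unfolding x_def n_def using xs G(2) nth_mem by auto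
  \<comment> \<open>The index of an element outside \<open>G\<close> is arbitrary; as the matrix is
    total, the functional still takes values in \<open>A\<close> there.\<close>
  define idx where "idx b = (SOME i. i < n \<and> x i = b)" for b
  have idx: "idx b < n" "x (idx b) = b" if "b \<in> G" for b
  proof -
    have "\<exists>i. i < n \<and> x i = b" using that xs unfolding x_def n_def by (metis in_set_conv_nth)
    from someI_ex[OF this] show "idx b < n" "x (idx b) = b" unfolding idx_def by auto
  qed
  define \<delta> where "\<delta> s j = (if j = s then \<one> else \<zero>)" for s j :: nat
  have \<delta>: "\<forall>j. \<delta> s j \<in> carrier A" for s unfolding \<delta>_def by simp
  have dotA: "dot A n (\<delta> s) v = v s" if "\<forall>i. v i \<in> carrier A" "s < n" for s v
    using A.dot_commute[OF \<delta> that(1)] A.dot_delta[OF that] unfolding \<delta>_def by simp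
  have dotB: "dot B n (\<lambda>i. f (\<delta> s i)) v = v s" if "\<forall>i. v i \<in> carrier B" "s < n" for s v
  proof -
    have "(\<lambda>i. f (\<delta> s i)) = (\<lambda>j. if j = s then \<one>\<^bsub>B\<^esub> else \<zero>\<^bsub>B\<^esub>)"
      unfolding \<delta>_def using ring_hom_one[OF hom] ring_hom_zero[OF hom A.ring_axioms B.ring_axioms] by auto
    moreover have "dot B n (\<lambda>j. if j = s then \<one>\<^bsub>B\<^esub> else \<zero>\<^bsub>B\<^esub>) v = dot B n v (\<lambda>j. if j = s then \<one>\<^bsub>B\<^esub> else \<zero>\<^bsub>B\<^esub>)"
      by (rule B.dot_commute) (use that in auto)
    ultimately show ?thesis using B.dot_delta[OF that] by simp
  qed
  \<comment> \<open>The rows \<open>eU\<close> and \<open>eW\<close> are the coefficient vectors of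
    the equations \<open>x(p + q) = x(p) + x(q)\<close> and \<open>x(f(a) p) = a x(p)\<close>
    between unknowns.\<close>
  define eU where "eU = (\<lambda>(p, q) i. \<delta> (idx (p \<oplus>\<^bsub>B\<^esub> q)) i \<ominus> (\<delta> (idx p) i \<oplus> \<delta> (idx q) i))"
  define eW where "eW = (\<lambda>(a, p) i. \<delta> (idx (f a \<otimes>\<^bsub>B\<^esub> p)) i \<ominus> a \<otimes> \<delta> (idx p) i)"
  have fminus: "f (a \<ominus> b) = f a \<ominus>\<^bsub>B\<^esub> f b" if "a \<in> carrier A" "b \<in> carrier A" for a b
  proof -
    interpret ring_hom_ring A B f by (rule ring_hom_ringI2[OF A.ring_axioms B.ring_axioms hom])
    show ?thesis using that by (simp add: A.minus_eq B.minus_eq)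
  qed
  have UG: "p \<in> G" "q \<in> G" "p \<oplus>\<^bsub>B\<^esub> q \<in> G" if "(p, q) \<in> U" for p q
    using imageI[OF that, of fst] imageI[OF that, of snd] imageI[OF that, of "\<lambda>(p, q). p \<oplus>\<^bsub>B\<^esub> q"]
    unfolding G_def by simp_all
  have WG: "p \<in> G" "f a \<otimes>\<^bsub>B\<^esub> p \<in> G" "a \<in> carrier A" if "(a, p) \<in> W" for a p
    using imageI[OF that, of snd] imageI[OF that, of "\<lambda>(a, p). f a \<otimes>\<^bsub>B\<^esub> p"] subsetD[OF W(2) that]
    unfolding G_def by simp_all
  have eUA: "dot A n (eU (p, q)) v = v (idx (p \<oplus>\<^bsub>B\<^esub> q)) \<ominus> (v (idx p) \<oplus> v (idx q))"
    if "(p, q) \<in> U" and v: "\<forall>i. v i \<in> carrier A" for p q v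
  proof -
    have "dot A n (eU (p, q)) v = dot A n v (eU (p, q))"
      by (rule A.dot_commute) (use v \<delta> in \<open>auto simp: eU_def\<close>)
    also have "\<dots> = dot A n v (\<delta> (idx (p \<oplus>\<^bsub>B\<^esub> q))) \<ominus> (dot A n v (\<delta> (idx p)) \<oplus> dot A n v (\<delta> (idx q)))"
      unfolding eU_def using v \<delta> by (simp add: A.dot_minus A.dot_add)
    finally show ?thesis using dotA[OF v idx(1)[OF UG(1)[OF that(1)]]] dotA[OF v idx(1)[OF UG(2)[OF that(1)]]]
        dotA[OF v idx(1)[OF UG(3)[OF that(1)]]] A.dot_commute[OF v \<delta>] by simp
  qed
  have eWA: "dot A n (eW (a, p)) v = v (idx (f a \<otimes>\<^bsub>B\<^esub> p)) \<ominus> a \<otimes> v (idx p)"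
    if "(a, p) \<in> W" and v: "\<forall>i. v i \<in> carrier A" for a p v
  proof -
    note ww = WG[OF that(1)]
    have "dot A n (eW (a, p)) v = dot A n v (eW (a, p))"
      by (rule A.dot_commute) (use v \<delta> ww in \<open>auto simp: eW_def\<close>)
    also have "\<dots> = dot A n v (\<delta> (idx (f a \<otimes>\<^bsub>B\<^esub> p))) \<ominus> a \<otimes> dot A n v (\<delta> (idx p))"
      unfolding eW_def using v \<delta> ww(3) by (simp add: A.dot_minus A.dot_smult)
    finally show ?thesis using dotA[OF v idx(1)[OF ww(1)]] dotA[OF v idx(1)[OF ww(2)]] A.dot_commute[OF v \<delta>] by simp
  qed
  have x': "x (idx b) = b" if "b \<in> G" for b using idx that by simp
  have xc: "dot B n (\<lambda>i. f (\<delta> s i)) x = dot B n x (\<lambda>i. f (\<delta> s i))" for s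
    by (rule B.dot_commute) (use x \<delta> in auto)
  have eUB: "dot B n (\<lambda>i. f (eU (p, q) i)) x = \<zero>\<^bsub>B\<^esub>" if "(p, q) \<in> U" for p q
  proof -
    note uu = UG[OF that]
    have "dot B n (\<lambda>i. f (eU (p, q) i)) x = dot B n x (\<lambda>i. f (eU (p, q) i))"
      by (rule B.dot_commute) (use x \<delta> in \<open>auto simp: eU_def\<close>)
    also have 1: "(\<lambda>i. f (eU (p, q) i)) = (\<lambda>i. f (\<delta> (idx (p \<oplus>\<^bsub>B\<^esub> q)) i) \<ominus>\<^bsub>B\<^esub> (f (\<delta> (idx p) i) \<oplus>\<^bsub>B\<^esub> f (\<delta> (idx q) i)))"
      unfolding eU_def using \<delta> by (simp add: fminus ring_hom_add[OF hom])
    also have "dot B n x \<dots> = dot B n x (\<lambda>i. f (\<delta> (idx (p \<oplus>\<^bsub>B\<^esub> q)) i)) \<ominus>\<^bsub>B\<^esub>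
        (dot B n x (\<lambda>i. f (\<delta> (idx p) i)) \<oplus>\<^bsub>B\<^esub> dot B n x (\<lambda>i. f (\<delta> (idx q) i)))"
      using x \<delta> by (simp add: B.dot_minus B.dot_add)
    also have "\<dots> = p \<oplus>\<^bsub>B\<^esub> q \<ominus>\<^bsub>B\<^esub> (p \<oplus>\<^bsub>B\<^esub> q)"
      unfolding xc[symmetric] using dotB[OF x idx(1)[OF uu(1)]] dotB[OF x idx(1)[OF uu(2)]] dotB[OF x idx(1)[OF uu(3)]]
        x'[OF uu(1)] x'[OF uu(2)] x'[OF uu(3)] by simp
    also have "\<dots> = \<zero>\<^bsub>B\<^esub>" using uu(3) G(2) by (simp add: subset_iff)
    finally show ?thesis unfolding 1 .
  qed
  have eWB: "dot B n (\<lambda>i. f (eW (a, p) i)) x = \<zero>\<^bsub>B\<^esub>" if "(a, p) \<in> W" for a p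
  proof -
    note ww = WG[OF that]
    have "dot B n (\<lambda>i. f (eW (a, p) i)) x = dot B n x (\<lambda>i. f (eW (a, p) i))"
      by (rule B.dot_commute) (use x \<delta> ww in \<open>auto simp: eW_def\<close>)
    also have 1: "(\<lambda>i. f (eW (a, p) i)) = (\<lambda>i. f (\<delta> (idx (f a \<otimes>\<^bsub>B\<^esub> p)) i) \<ominus>\<^bsub>B\<^esub> f a \<otimes>\<^bsub>B\<^esub> f (\<delta> (idx p) i))"
      unfolding eW_def using \<delta> ww(3) by (simp add: fminus ring_hom_mult[OF hom])
    also have "dot B n x \<dots> = dot B n x (\<lambda>i. f (\<delta> (idx (f a \<otimes>\<^bsub>B\<^esub> p)) i)) \<ominus>\<^bsub>B\<^esub>
        f a \<otimes>\<^bsub>B\<^esub> dot B n x (\<lambda>i. f (\<delta> (idx p) i))"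
      using x \<delta> ww(3) by (simp add: B.dot_minus B.dot_smult)
    also have "\<dots> = f a \<otimes>\<^bsub>B\<^esub> p \<ominus>\<^bsub>B\<^esub> f a \<otimes>\<^bsub>B\<^esub> p"
      unfolding xc[symmetric] using dotB[OF x idx(1)[OF ww(1)]] dotB[OF x idx(1)[OF ww(2)]]
        x'[OF ww(1)] x'[OF ww(2)] by simp
    also have "\<dots> = \<zero>\<^bsub>B\<^esub>" using ww(2) G(2) by (simp add: subset_iff)
    finally show ?thesis unfolding 1 .
  qed
  obtain us where us: "set us = U" using U(1) finite_list by blast
  obtain ws where ws: "set ws = W" using W(1) finite_list by blast
  have "\<forall>e\<in>set (map eU us @ map eW ws). (\<forall>i. e i \<in> carrier A) \<and> dot B n (\<lambda>i. f (e i)) x = \<zero>\<^bsub>B\<^esub>"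
  proof
    fix e assume "e \<in> set (map eU us @ map eW ws)"
    then consider p q where "(p, q) \<in> U" "e = eU (p, q)" | a p where "(a, p) \<in> W" "e = eW (a, p)"
      using us ws by auto
    then show "(\<forall>i. e i \<in> carrier A) \<and> dot B n (\<lambda>i. f (e i)) x = \<zero>\<^bsub>B\<^esub>"
    proof cases
      case 1
      then show ?thesis using eUB \<delta> by (simp add: eU_def)
    next
      case 2
      then show ?thesis using eWB[OF 2(1)] \<delta> WG(3)[OF 2(1)] by (simp add: eW_def)
    qed
  qed
  from system_solution[OF x this] obtain l \<phi> z where *: "\<forall>i j. \<phi> i j \<in> carrier A" "\<forall>j. z j \<in> carrier B"
    "\<forall>i<n. x i = dot B l (\<lambda>j. f (\<phi> i j)) z"
    "\<forall>e\<in>set (map eU us @ map eW ws). \<forall>j<l. dot A n e (\<lambda>i. \<phi> i j) = \<zero>" by blast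
  define \<psi> where "\<psi> j b = \<phi> (idx b) j" for j b
  have "b = dot B l (\<lambda>j. f (\<psi> j b)) z" if "b \<in> F" for b
  proof -
    have "b \<in> G" using that unfolding G_def by blast
    then show ?thesis using *(3)[rule_format, of "idx b"] idx[of b] unfolding \<psi>_def by simp
  qed
  moreover have "\<psi> j (p \<oplus>\<^bsub>B\<^esub> q) = \<psi> j p \<oplus> \<psi> j q" if "j < l" "(p, q) \<in> U" for j p q
  proof -
    have "eU (p, q) \<in> set (map eU us @ map eW ws)" using that us by auto
    then have "dot A n (eU (p, q)) (\<lambda>i. \<phi> i j) = \<zero>" using *(4) that by blast
    then show ?thesis using eUA[OF that(2), of "\<lambda>i. \<phi> i j"] *(1) unfolding \<psi>_def by simp
  qed
  moreover have "\<psi> j (f a \<otimes>\<^bsub>B\<^esub> p) = a \<otimes> \<psi> j p" if "j < l" "(a, p) \<in> W" for j a p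
  proof -
    have "eW (a, p) \<in> set (map eU us @ map eW ws)" using that ws by auto
    then have "dot A n (eW (a, p)) (\<lambda>i. \<phi> i j) = \<zero>" using *(4) that by blast
    then show ?thesis using eWA[OF that(2), of "\<lambda>i. \<phi> i j"] *(1) WG(3)[OF that(2)] unfolding \<psi>_def by simp
  qed
  moreover have "\<forall>j b. \<psi> j b \<in> carrier A" unfolding \<psi>_def using *(1) by simp
  ultimately show ?thesis using *(2) by (intro exI[of _ l] exI[of _ \<psi>] exI[of _ z]) blast
qed

end

section \<open>Tensor products as quotients of free abelian groups\<close>

lemma (in abelian_group) add_minus_minus:
  assumes "a \<in> carrier G" "b \<in> carrier G"
  shows "(a \<oplus> b) \<ominus> a \<ominus> b = \<zero>"
proof -
  have "(a \<oplus> b) \<oplus> \<ominus> a \<oplus> \<ominus> b = (b \<oplus> (a \<oplus> \<ominus> a)) \<oplus> \<ominus> b" using assms by (simp add: a_ac)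
  then show ?thesis using assms by (simp add: minus_eq r_neg)
qed

lemma hom_free_Abelian_group:
  assumes "abelian_group M" and h: "h \<in> hom (free_Abelian_group S) (add_monoid M)"
  shows hom_free_closed: "Poly_Mapping.keys u \<subseteq> S \<Longrightarrow> h u \<in> carrier M"
    and hom_free_zero: "h 0 = \<zero>\<^bsub>M\<^esub>"
    and hom_free_add: "Poly_Mapping.keys u \<subseteq> S \<Longrightarrow> Poly_Mapping.keys v \<subseteq> S \<Longrightarrow> h (u + v) = h u \<oplus>\<^bsub>M\<^esub> h v"
    and hom_free_minus: "Poly_Mapping.keys u \<subseteq> S \<Longrightarrow> h (- u) = \<ominus>\<^bsub>M\<^esub> h u"
    and hom_free_diff: "Poly_Mapping.keys u \<subseteq> S \<Longrightarrow> Poly_Mapping.keys v \<subseteq> S \<Longrightarrow> h (u - v) = h u \<ominus>\<^bsub>M\<^esub> h v"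
proof -
  interpret M: abelian_group M by fact
  interpret h: group_hom "free_Abelian_group S" "add_monoid M" h
    by (intro group_hom.intro group_hom_axioms.intro group_free_Abelian_group M.a_group h)
  show cl: "h u \<in> carrier M" if "Poly_Mapping.keys u \<subseteq> S" for u using h.hom_closed[of u] that by simp
  show "h 0 = \<zero>\<^bsub>M\<^esub>" using h.hom_one by simp
  show add: "h (u + v) = h u \<oplus>\<^bsub>M\<^esub> h v" if "Poly_Mapping.keys u \<subseteq> S" "Poly_Mapping.keys v \<subseteq> S" for u v
    using h.hom_mult[of u v] that by simp
  show neg: "h (- u) = \<ominus>\<^bsub>M\<^esub> h u" if "Poly_Mapping.keys u \<subseteq> S" for u
    using h.hom_inv[of u] that by (simp add: a_inv_def)
  show "h (u - v) = h u \<ominus>\<^bsub>M\<^esub> h v" if "Poly_Mapping.keys u \<subseteq> S" "Poly_Mapping.keys v \<subseteq> S" for u v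
    using add[of u "- v"] neg[of v] that by (simp add: M.minus_eq keys_minus)
qed

lemma keys_diff3: "Poly_Mapping.keys (frag_of a - frag_of b - frag_of c) \<subseteq> {a, b, c}"
  using keys_diff[of "frag_of a - frag_of b" "frag_of c"] keys_diff[of "frag_of a" "frag_of b"] by auto

lemma keys_diff2: "Poly_Mapping.keys (frag_of a - frag_of b) \<subseteq> {a, b}"
  using keys_diff[of "frag_of a" "frag_of b"] by auto

lemma tensor_relators_cases:
  assumes "u \<in> tensor_relators A M N"
  obtains (left) x x' y where "x \<in> carrier M" "x' \<in> carrier M" "y \<in> carrier N"
      "u = frag_of (x \<oplus>\<^bsub>M\<^esub> x', y) - frag_of (x, y) - frag_of (x', y)"
    | (right) x y y' where "x \<in> carrier M" "y \<in> carrier N" "y' \<in> carrier N"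
      "u = frag_of (x, y \<oplus>\<^bsub>N\<^esub> y') - frag_of (x, y) - frag_of (x, y')"
    | (smult) a x y where "a \<in> carrier A" "x \<in> carrier M" "y \<in> carrier N"
      "u = frag_of (a \<odot>\<^bsub>M\<^esub> x, y) - frag_of (x, a \<odot>\<^bsub>N\<^esub> y)"
  using assms unfolding tensor_relators_def by (elim UnE CollectE exE conjE) (erule that; assumption)+

lemma hom_free_diff3:
  assumes "abelian_group M" and h: "h \<in> hom (free_Abelian_group S) (add_monoid M)" and "a \<in> S" "b \<in> S" "c \<in> S"
  shows "h (frag_of a - frag_of b - frag_of c) = h (frag_of a) \<ominus>\<^bsub>M\<^esub> h (frag_of b) \<ominus>\<^bsub>M\<^esub> h (frag_of c)"
proof -
  have "Poly_Mapping.keys (frag_of a - frag_of b) \<subseteq> S" using keys_diff2[of a b] assms(3,4) by auto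
  then show ?thesis using hom_free_diff[OF assms(1) h] assms(3-5) by simp
qed

locale tensor_pair = M: module A M + N: module A N
  for A :: "('a, 'x) ring_scheme" and M :: "('a, 'm, 'u) module_scheme" and N :: "('a, 'n, 'v) module_scheme"
begin

abbreviation "null \<equiv> tensor_null A M N"
abbreviation "free \<equiv> free_Abelian_group (carrier M \<times> carrier N)"

lemma relators_closed: "tensor_relators A M N \<subseteq> carrier free"
proof
  fix u assume "u \<in> tensor_relators A M N"
  then show "u \<in> carrier free"
  proof (cases rule: tensor_relators_cases)
    case (left x x' y)
    show ?thesis unfolding left(4) carrier_free_Abelian_group_iff
      by (rule order_trans[OF keys_diff3]) (use left(1-3) in simp)
  next
    case (right x y y')
    show ?thesis unfolding right(4) carrier_free_Abelian_group_iff
      by (rule order_trans[OF keys_diff3]) (use right(1-3) in simp)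
  next
    case (smult a x y)
    show ?thesis unfolding smult(4) carrier_free_Abelian_group_iff
      by (rule order_trans[OF keys_diff2]) (use smult(1-3) in simp)
  qed
qed

lemma null_subgroup: "subgroup null free"
  unfolding tensor_null_def by (rule group.generate_is_subgroup[OF group_free_Abelian_group relators_closed])

lemma null_keys: "u \<in> null \<Longrightarrow> Poly_Mapping.keys u \<subseteq> carrier M \<times> carrier N"
  using subgroup.mem_carrier[OF null_subgroup] by simp

lemma null_zero: "0 \<in> null"
  using subgroup.one_closed[OF null_subgroup] by simp

lemma null_add: "u \<in> null \<Longrightarrow> v \<in> null \<Longrightarrow> u + v \<in> null"
  using subgroup.m_closed[OF null_subgroup] by simp

lemma null_minus: "u \<in> null \<Longrightarrow> - u \<in> null"
  using subgroup.m_inv_closed[OF null_subgroup, of u] null_keys by simp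

lemma null_diff: "u \<in> null \<Longrightarrow> v \<in> null \<Longrightarrow> u - v \<in> null"
  using null_add[of u "- v"] null_minus by simp

lemma null_sum: "(\<And>i. i \<in> I \<Longrightarrow> u i \<in> null) \<Longrightarrow> sum u I \<in> null"
  by (induction I rule: infinite_finite_induct) (auto simp: null_zero null_add)

lemma null_relator: "u \<in> tensor_relators A M N \<Longrightarrow> u \<in> null"
  unfolding tensor_null_def by (rule generate.incl)

lemma null_add_left: "x \<in> carrier M \<Longrightarrow> x' \<in> carrier M \<Longrightarrow> y \<in> carrier N \<Longrightarrow>
    frag_of (x \<oplus>\<^bsub>M\<^esub> x', y) - frag_of (x, y) - frag_of (x', y) \<in> null"
  by (rule null_relator) (auto simp: tensor_relators_def)

lemma null_add_right: "x \<in> carrier M \<Longrightarrow> y \<in> carrier N \<Longrightarrow> y' \<in> carrier N \<Longrightarrow>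
    frag_of (x, y \<oplus>\<^bsub>N\<^esub> y') - frag_of (x, y) - frag_of (x, y') \<in> null"
  by (rule null_relator) (auto simp: tensor_relators_def)

lemma null_smult: "a \<in> carrier A \<Longrightarrow> x \<in> carrier M \<Longrightarrow> y \<in> carrier N \<Longrightarrow>
    frag_of (a \<odot>\<^bsub>M\<^esub> x, y) - frag_of (x, a \<odot>\<^bsub>N\<^esub> y) \<in> null"
  by (rule null_relator) (auto simp: tensor_relators_def)

lemma null_zero_left: "y \<in> carrier N \<Longrightarrow> frag_of (\<zero>\<^bsub>M\<^esub>, y) \<in> null"
  using null_minus[OF null_add_left[of "\<zero>\<^bsub>M\<^esub>" "\<zero>\<^bsub>M\<^esub>" y]] by simp

lemma null_zero_right: "x \<in> carrier M \<Longrightarrow> frag_of (x, \<zero>\<^bsub>N\<^esub>) \<in> null"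
  using null_minus[OF null_add_right[of x "\<zero>\<^bsub>N\<^esub>" "\<zero>\<^bsub>N\<^esub>"]] by simp

lemma null_diff_left:
  assumes "x \<in> carrier M" "x' \<in> carrier M" "y \<in> carrier N"
  shows "frag_of (x, y) - frag_of (x', y) - frag_of (x \<ominus>\<^bsub>M\<^esub> x', y) \<in> null"
proof -
  have "x = (x \<ominus>\<^bsub>M\<^esub> x') \<oplus>\<^bsub>M\<^esub> x'" using assms by (simp add: M.minus_eq M.a_assoc M.l_neg)
  then have "frag_of (x, y) - frag_of (x \<ominus>\<^bsub>M\<^esub> x', y) - frag_of (x', y) \<in> null"
    using null_add_left[of "x \<ominus>\<^bsub>M\<^esub> x'" x' y] assms by simp
  then show ?thesis by (simp add: algebra_simps)
qed

lemma coset_eq: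
  assumes "Poly_Mapping.keys u \<subseteq> carrier M \<times> carrier N" "Poly_Mapping.keys v \<subseteq> carrier M \<times> carrier N"
  shows "null #>\<^bsub>free\<^esub> u = null #>\<^bsub>free\<^esub> v \<longleftrightarrow> u - v \<in> null"
proof
  assume "null #>\<^bsub>free\<^esub> u = null #>\<^bsub>free\<^esub> v"
  moreover have "u \<in> null #>\<^bsub>free\<^esub> u" unfolding r_coset_def using null_zero by force
  ultimately obtain n where "n \<in> null" "u = n + v" unfolding r_coset_def by auto
  then show "u - v \<in> null" by simp
next
  assume d: "u - v \<in> null"
  have sub: "null #>\<^bsub>free\<^esub> u \<subseteq> null #>\<^bsub>free\<^esub> v" if "u - v \<in> null" for u v
  proof
    fix w assume "w \<in> null #>\<^bsub>free\<^esub> u"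
    then obtain n where n: "n \<in> null" "w = n + u" unfolding r_coset_def by auto
    then have "w = (n + (u - v)) + v" by simp
    then show "w \<in> null #>\<^bsub>free\<^esub> v" unfolding r_coset_def
      using null_add[OF n(1) that] by (auto intro!: bexI[of _ "n + (u - v)"])
  qed
  have "v - u \<in> null" using null_minus[OF d] by simp
  then show "null #>\<^bsub>free\<^esub> u = null #>\<^bsub>free\<^esub> v" using sub d by blast
qed

lemma functional_hom:
  assumes "\<forall>b. \<phi> b \<in> carrier A"
  shows "\<exists>h. h \<in> hom free (add_monoid M) \<and> (\<forall>x\<in>carrier M. \<forall>b\<in>carrier N. h (frag_of (x, b)) = \<phi> b \<odot>\<^bsub>M\<^esub> x)"
proof -
  have "(\<lambda>(x, b). \<phi> b \<odot>\<^bsub>M\<^esub> x) ` (carrier M \<times> carrier N) \<subseteq> carrier (add_monoid M)" using assms by auto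
  from comm_group.free_Abelian_group_universal[OF M.a_comm_group this]
  obtain h where "h \<in> hom free (add_monoid M)"
    "\<And>x. x \<in> carrier M \<times> carrier N \<Longrightarrow> h (frag_of x) = (case x of (x, b) \<Rightarrow> \<phi> b \<odot>\<^bsub>M\<^esub> x)" by blast
  then show ?thesis by (intro exI[of _ h]) simp
qed

text \<open>
  A relation between tensors involves only finitely many sums and scalar multiples in \<open>N\<close>. A map
  \<open>\<phi> : N \<rightarrow> A\<close> that is linear on these alone therefore still sends the relation to zero in \<open>M\<close>, and
  equational flatness provides enough such maps to detect the vanishing of a tensor.
\<close>

definition annihilated :: "('n \<times> 'n) set \<Rightarrow> ('a \<times> 'n) set \<Rightarrow> ('m \<times> 'n \<Rightarrow>\<^sub>0 int) \<Rightarrow> bool" where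
  "annihilated U W v \<longleftrightarrow> (\<forall>\<phi> h. (\<forall>b. \<phi> b \<in> carrier A) \<longrightarrow> h \<in> hom free (add_monoid M) \<longrightarrow>
     (\<forall>(p, q)\<in>U. \<phi> (p \<oplus>\<^bsub>N\<^esub> q) = \<phi> p \<oplus>\<^bsub>A\<^esub> \<phi> q) \<longrightarrow> (\<forall>(a, p)\<in>W. \<phi> (a \<odot>\<^bsub>N\<^esub> p) = a \<otimes>\<^bsub>A\<^esub> \<phi> p) \<longrightarrow>
     (\<forall>x\<in>carrier M. \<forall>b\<in>carrier N. h (frag_of (x, b)) = \<phi> b \<odot>\<^bsub>M\<^esub> x) \<longrightarrow> h v = \<zero>\<^bsub>M\<^esub>)"

text \<open>Additivity in the first argument is respected by every \<open>\<phi>\<close>, because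
  \<open>M\<close> is a module. The other two kinds of relators each use one instance of additivity
  or homogeneity of \<open>\<phi>\<close>, recorded in \<open>U\<close> or \<open>W\<close>.\<close>

lemma relator_annihilated:
  assumes "u \<in> tensor_relators A M N"
  shows "\<exists>U W. finite U \<and> U \<subseteq> carrier N \<times> carrier N \<and> finite W \<and> W \<subseteq> carrier A \<times> carrier N \<and> annihilated U W u"
proof -
  note hd = hom_free_diff[OF M.abelian_group_axioms]
  from assms show ?thesis
  proof (cases rule: tensor_relators_cases)
    case (left x x' y)
    have "annihilated {} {} u" unfolding annihilated_def
    proof (intro allI impI)
      fix \<phi> h assume \<phi>: "\<forall>b. \<phi> b \<in> carrier A" and h: "h \<in> hom free (add_monoid M)"
        and hf: "\<forall>x\<in>carrier M. \<forall>b\<in>carrier N. h (frag_of (x, b)) = \<phi> b \<odot>\<^bsub>M\<^esub> x"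
      have "h u = h (frag_of (x \<oplus>\<^bsub>M\<^esub> x', y)) \<ominus>\<^bsub>M\<^esub> h (frag_of (x, y)) \<ominus>\<^bsub>M\<^esub> h (frag_of (x', y))"
        unfolding left(4) by (rule hom_free_diff3[OF M.abelian_group_axioms h]) (use left(1-3) in auto)
      also have "\<dots> = (\<phi> y \<odot>\<^bsub>M\<^esub> x \<oplus>\<^bsub>M\<^esub> \<phi> y \<odot>\<^bsub>M\<^esub> x') \<ominus>\<^bsub>M\<^esub> \<phi> y \<odot>\<^bsub>M\<^esub> x \<ominus>\<^bsub>M\<^esub> \<phi> y \<odot>\<^bsub>M\<^esub> x'"
        using hf left(1-3) \<phi> by (simp add: M.smult_r_distr)
      also have "\<dots> = \<zero>\<^bsub>M\<^esub>" using left(1,2) \<phi> by (intro M.add_minus_minus) auto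
      finally show "h u = \<zero>\<^bsub>M\<^esub>" .
    qed
    then show ?thesis by (intro exI[of _ "{}"]) simp
  next
    case (right x y y')
    have "annihilated {(y, y')} {} u" unfolding annihilated_def
    proof (intro allI impI)
      fix \<phi> h assume \<phi>: "\<forall>b. \<phi> b \<in> carrier A" and h: "h \<in> hom free (add_monoid M)"
        and c: "\<forall>(p, q)\<in>{(y, y')}. \<phi> (p \<oplus>\<^bsub>N\<^esub> q) = \<phi> p \<oplus>\<^bsub>A\<^esub> \<phi> q"
        and hf: "\<forall>x\<in>carrier M. \<forall>b\<in>carrier N. h (frag_of (x, b)) = \<phi> b \<odot>\<^bsub>M\<^esub> x"
      have "h u = h (frag_of (x, y \<oplus>\<^bsub>N\<^esub> y')) \<ominus>\<^bsub>M\<^esub> h (frag_of (x, y)) \<ominus>\<^bsub>M\<^esub> h (frag_of (x, y'))"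
        unfolding right(4) by (rule hom_free_diff3[OF M.abelian_group_axioms h]) (use right(1-3) in auto)
      also have "\<dots> = (\<phi> y \<odot>\<^bsub>M\<^esub> x \<oplus>\<^bsub>M\<^esub> \<phi> y' \<odot>\<^bsub>M\<^esub> x) \<ominus>\<^bsub>M\<^esub> \<phi> y \<odot>\<^bsub>M\<^esub> x \<ominus>\<^bsub>M\<^esub> \<phi> y' \<odot>\<^bsub>M\<^esub> x"
        using hf right(1-3) \<phi> c by (simp add: M.smult_l_distr)
      also have "\<dots> = \<zero>\<^bsub>M\<^esub>" using right(1) \<phi> by (intro M.add_minus_minus) auto
      finally show "h u = \<zero>\<^bsub>M\<^esub>" .
    qed
    then show ?thesis using right by (intro exI[of _ "{(y, y')}"] exI[of _ "{}"]) simp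
  next
    case (smult a x y)
    have "annihilated {} {(a, y)} u" unfolding annihilated_def
    proof (intro allI impI)
      fix \<phi> h assume \<phi>: "\<forall>b. \<phi> b \<in> carrier A" and h: "h \<in> hom free (add_monoid M)"
        and c: "\<forall>(b, p)\<in>{(a, y)}. \<phi> (b \<odot>\<^bsub>N\<^esub> p) = b \<otimes>\<^bsub>A\<^esub> \<phi> p"
        and hf: "\<forall>x\<in>carrier M. \<forall>b\<in>carrier N. h (frag_of (x, b)) = \<phi> b \<odot>\<^bsub>M\<^esub> x"
      have "h u = h (frag_of (a \<odot>\<^bsub>M\<^esub> x, y)) \<ominus>\<^bsub>M\<^esub> h (frag_of (x, a \<odot>\<^bsub>N\<^esub> y))"
        unfolding smult(4) using smult(1-3) by (subst hd[OF h]) auto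
      also have "\<dots> = \<phi> y \<odot>\<^bsub>M\<^esub> (a \<odot>\<^bsub>M\<^esub> x) \<ominus>\<^bsub>M\<^esub> (a \<otimes>\<^bsub>A\<^esub> \<phi> y) \<odot>\<^bsub>M\<^esub> x"
        using hf smult(1-3) c by simp
      also have "\<phi> y \<odot>\<^bsub>M\<^esub> (a \<odot>\<^bsub>M\<^esub> x) = (a \<otimes>\<^bsub>A\<^esub> \<phi> y) \<odot>\<^bsub>M\<^esub> x"
        using \<phi> smult(1-3) by (simp add: M.smult_assoc1[symmetric] M.m_comm)
      finally show "h u = \<zero>\<^bsub>M\<^esub>" using \<phi> smult(1-3) by (simp add: M.minus_eq M.r_neg)
    qed
    then show ?thesis using smult by (intro exI[of _ "{}"] exI[of _ "{(a, y)}"]) simp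
  qed
qed

text \<open>The instances accumulate along the finite derivation of \<open>v\<close>; enlarging
  \<open>U\<close> and \<open>W\<close> only leaves fewer maps to be tested.\<close>

lemma null_annihilated:
  assumes "v \<in> null"
  shows "\<exists>U W. finite U \<and> U \<subseteq> carrier N \<times> carrier N \<and> finite W \<and> W \<subseteq> carrier A \<times> carrier N \<and> annihilated U W v"
  using assms unfolding tensor_null_def
proof induction
  case one
  have "annihilated {} {} 0" unfolding annihilated_def
    using hom_free_zero[OF M.abelian_group_axioms] by blast
  then show ?case by (intro exI[of _ "{}"]) simp
next
  case (incl u)
  then show ?case by (rule relator_annihilated)
next
  case (inv u)
  have u: "Poly_Mapping.keys u \<subseteq> carrier M \<times> carrier N" using null_keys[OF null_relator[OF inv]] .
  have "annihilated U W (- u)" if "annihilated U W u" for U W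
    unfolding annihilated_def
  proof (intro allI impI)
    fix \<phi> h assume *: "\<forall>b. \<phi> b \<in> carrier A" "h \<in> hom free (add_monoid M)"
      "\<forall>(p, q)\<in>U. \<phi> (p \<oplus>\<^bsub>N\<^esub> q) = \<phi> p \<oplus>\<^bsub>A\<^esub> \<phi> q" "\<forall>(a, p)\<in>W. \<phi> (a \<odot>\<^bsub>N\<^esub> p) = a \<otimes>\<^bsub>A\<^esub> \<phi> p"
      "\<forall>x\<in>carrier M. \<forall>b\<in>carrier N. h (frag_of (x, b)) = \<phi> b \<odot>\<^bsub>M\<^esub> x"
    have "h u = \<zero>\<^bsub>M\<^esub>" by (rule that[unfolded annihilated_def, rule_format, OF *(1)[rule_format] *(2) _ _ *(5)[rule_format]]) (use *(3,4) in auto)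
    then show "h (- u) = \<zero>\<^bsub>M\<^esub>" using hom_free_minus[OF M.abelian_group_axioms *(2) u] by simp
  qed
  then show ?case using relator_annihilated[OF inv] u by (metis inv_free_Abelian_group)
next
  case (eng u v)
  have uv: "Poly_Mapping.keys u \<subseteq> carrier M \<times> carrier N" "Poly_Mapping.keys v \<subseteq> carrier M \<times> carrier N"
    using eng.hyps null_keys unfolding tensor_null_def by auto
  obtain U W where 1: "finite U" "U \<subseteq> carrier N \<times> carrier N" "finite W" "W \<subseteq> carrier A \<times> carrier N" "annihilated U W u"
    using eng.IH(1) by blast
  obtain U' W' where 2: "finite U'" "U' \<subseteq> carrier N \<times> carrier N" "finite W'" "W' \<subseteq> carrier A \<times> carrier N" "annihilated U' W' v"
    using eng.IH(2) by blast
  have "annihilated (U \<union> U') (W \<union> W') (u + v)" unfolding annihilated_def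
  proof (intro allI impI)
    fix \<phi> h assume *: "\<forall>b. \<phi> b \<in> carrier A" "h \<in> hom free (add_monoid M)"
      "\<forall>(p, q)\<in>U \<union> U'. \<phi> (p \<oplus>\<^bsub>N\<^esub> q) = \<phi> p \<oplus>\<^bsub>A\<^esub> \<phi> q" "\<forall>(a, p)\<in>W \<union> W'. \<phi> (a \<odot>\<^bsub>N\<^esub> p) = a \<otimes>\<^bsub>A\<^esub> \<phi> p"
      "\<forall>x\<in>carrier M. \<forall>b\<in>carrier N. h (frag_of (x, b)) = \<phi> b \<odot>\<^bsub>M\<^esub> x"
    have "h u = \<zero>\<^bsub>M\<^esub>" by (rule 1(5)[unfolded annihilated_def, rule_format, OF *(1)[rule_format] *(2) _ _ *(5)[rule_format]]) (use *(3,4) in auto)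
    moreover have "h v = \<zero>\<^bsub>M\<^esub>" by (rule 2(5)[unfolded annihilated_def, rule_format, OF *(1)[rule_format] *(2) _ _ *(5)[rule_format]]) (use *(3,4) in auto)
    ultimately show "h (u + v) = \<zero>\<^bsub>M\<^esub>" using hom_free_add[OF M.abelian_group_axioms *(2) uv] by simp
  qed
  then show ?case using 1 2 by (intro exI[of _ "U \<union> U'"] exI[of _ "W \<union> W'"]) simp
qed

text \<open>The iterated sum is written by recursion because \<open>N\<close> is merely a module
  here; over an algebra, with multiples as summands, it becomes \<open>dot\<close>.\<close>

lemma null_smult_right_sum:
  assumes "x \<in> carrier M" "\<forall>j. c j \<in> carrier N"
  shows "frag_of (x, rec_nat \<zero>\<^bsub>N\<^esub> (\<lambda>j s. s \<oplus>\<^bsub>N\<^esub> c j) l) - (\<Sum>j<l. frag_of (x, c j)) \<in> null"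
proof (induction l)
  case 0
  then show ?case using null_zero_right[OF assms(1)] by simp
next
  case (Suc l)
  define s where "s = rec_nat \<zero>\<^bsub>N\<^esub> (\<lambda>j s. s \<oplus>\<^bsub>N\<^esub> c j) l"
  have "rec_nat \<zero>\<^bsub>N\<^esub> (\<lambda>j s. s \<oplus>\<^bsub>N\<^esub> c j) n \<in> carrier N" for n by (induction n) (use assms in auto)
  then have "s \<in> carrier N" unfolding s_def .
  then have "frag_of (x, s \<oplus>\<^bsub>N\<^esub> c l) - frag_of (x, s) - frag_of (x, c l) \<in> null"
    using null_add_right assms by simp
  from null_add[OF this Suc[folded s_def]]
  show ?case unfolding s_def by (simp add: algebra_simps)
qed

end

lemma module_algebra_via:
  assumes "cring A" "cring B" "f \<in> ring_hom A B"
  shows "module A (algebra_via f B)"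
proof -
  interpret A: cring A by fact
  interpret B: cring B by fact
  have "abelian_group (algebra_via f B)"
    by (rule abelian_groupI)
      (auto simp: algebra_via_def B.a_ac intro: B.add.l_inv_ex)
  then show ?thesis
    by (intro module.intro module_axioms.intro)
      (auto simp: assms algebra_via_def ring_hom_memE[OF assms(3)] B.l_distr B.r_distr B.m_assoc)
qed

section \<open>Injectivity of the induced map on tensor products\<close>

locale flat_tensor = flat_algebra A B f + M: module A M + M': module A M'
  for A :: "('a, 'x) ring_scheme" and B :: "('b, 'v) ring_scheme" and f
    and M :: "('a, 'm, 'u) module_scheme" and M' :: "('a, 'n, 'w) module_scheme" +
  fixes g
  assumes g: "g \<in> module_maps A M M'" and g_inj: "inj_on g (carrier M)"
begin

abbreviation "N \<equiv> algebra_via f B"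

lemma N_simps [simp]: "carrier N = carrier B" "x \<oplus>\<^bsub>N\<^esub> z = x \<oplus>\<^bsub>B\<^esub> z" "\<zero>\<^bsub>N\<^esub> = \<zero>\<^bsub>B\<^esub>" "a \<odot>\<^bsub>N\<^esub> b = f a \<otimes>\<^bsub>B\<^esub> b"
  by (simp_all add: algebra_via_def)

lemma N_module: "module A N"
  by (rule module_algebra_via[OF A.is_cring B.is_cring hom])

sublocale T: tensor_pair A M N
  by (intro tensor_pair.intro M.module_axioms N_module)

sublocale T': tensor_pair A M' N
  by (intro tensor_pair.intro M'.module_axioms N_module)

lemma g_closed [simp]: "x \<in> carrier M \<Longrightarrow> g x \<in> carrier M'"
  and g_add: "x \<in> carrier M \<Longrightarrow> z \<in> carrier M \<Longrightarrow> g (x \<oplus>\<^bsub>M\<^esub> z) = g x \<oplus>\<^bsub>M'\<^esub> g z"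
  and g_smult: "a \<in> carrier A \<Longrightarrow> x \<in> carrier M \<Longrightarrow> g (a \<odot>\<^bsub>M\<^esub> x) = a \<odot>\<^bsub>M'\<^esub> g x"
  using g unfolding module_maps_def by auto

lemma g_zero: "g \<zero>\<^bsub>M\<^esub> = \<zero>\<^bsub>M'\<^esub>"
  using g_add[of "\<zero>\<^bsub>M\<^esub>" "\<zero>\<^bsub>M\<^esub>"] g_closed[of "\<zero>\<^bsub>M\<^esub>"] by (metis M.l_zero M.zero_closed M'.add.r_cancel_one')

lemma g_diff: "x \<in> carrier M \<Longrightarrow> z \<in> carrier M \<Longrightarrow> g (x \<ominus>\<^bsub>M\<^esub> z) = g x \<ominus>\<^bsub>M'\<^esub> g z"
proof -
  assume x: "x \<in> carrier M" "z \<in> carrier M"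
  then have "x = (x \<ominus>\<^bsub>M\<^esub> z) \<oplus>\<^bsub>M\<^esub> z" by (simp add: M.minus_eq M.a_assoc M.l_neg)
  then have "g x = g (x \<ominus>\<^bsub>M\<^esub> z) \<oplus>\<^bsub>M'\<^esub> g z" using g_add[of "x \<ominus>\<^bsub>M\<^esub> z" z] x by simp
  then show ?thesis using x by (simp add: M'.minus_eq M'.a_assoc M'.r_neg)
qed

definition lift :: "('m \<times> 'b \<Rightarrow>\<^sub>0 int) \<Rightarrow> ('n \<times> 'b \<Rightarrow>\<^sub>0 int)" where
  "lift = frag_extend (\<lambda>(x, b). frag_of (g x, b))"

lemma lift_simps [simp]: "lift 0 = 0" "lift (frag_of (x, b)) = frag_of (g x, b)" "lift (u + v) = lift u + lift v"
  "lift (u - v) = lift u - lift v" "lift (- u) = - lift u"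
  unfolding lift_def by (simp_all add: frag_extend_add frag_extend_diff frag_extend_minus)

lemma lift_keys: "Poly_Mapping.keys u \<subseteq> carrier M \<times> carrier B \<Longrightarrow> Poly_Mapping.keys (lift u) \<subseteq> carrier M' \<times> carrier B"
  unfolding lift_def by (rule order_trans[OF keys_frag_extend]) auto

lemma lift_null:
  assumes "u \<in> T.null"
  shows "lift u \<in> T'.null"
  using assms unfolding tensor_null_def
proof induction
  case one
  then show ?case using T'.null_zero unfolding tensor_null_def by simp
next
  have rel: "lift u \<in> T'.null" if "u \<in> tensor_relators A M N" for u
    using that
  proof (cases rule: tensor_relators_cases)
    case (left x x' y)
    then show ?thesis using T'.null_add_left[of "g x" "g x'" y] by (simp add: g_add)
  next
    case (right x y y')
    then show ?thesis using T'.null_add_right[of "g x" y y'] by simp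
  next
    case (smult a x y)
    then show ?thesis using T'.null_smult[of a "g x" y] by (simp add: g_smult)
  qed
  {
    case (incl u)
    then show ?case using rel unfolding tensor_null_def by blast
  next
    case (inv u)
    then have "Poly_Mapping.keys u \<subseteq> carrier M \<times> carrier N" by (intro T.null_keys T.null_relator)
    then show ?case using T'.null_minus[OF rel[OF inv]] unfolding tensor_null_def by simp
  next
    case (eng u v)
    then show ?case using T'.null_add[of "lift u" "lift v"] unfolding tensor_null_def by simp
  }
qed

text \<open>Functionals are chosen that kill \<open>lift u\<close> and expand every second component
  of \<open>u\<close> in the \<open>z j\<close>. Each sends \<open>u\<close> to an element of
  \<open>M\<close> with vanishing image under \<open>g\<close>, hence to zero by injectivity; and
  \<open>u\<close> is congruent to the sum of these elements tensored with the
  \<open>z j\<close>.\<close>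

lemma lift_null_iff:
  assumes u: "Poly_Mapping.keys u \<subseteq> carrier M \<times> carrier B" and lu: "lift u \<in> T'.null"
  shows "u \<in> T.null"
proof -
  obtain U W where UW: "finite U" "U \<subseteq> carrier B \<times> carrier B" "finite W" "W \<subseteq> carrier A \<times> carrier B"
    "T'.annihilated U W (lift u)" using T'.null_annihilated[OF lu] by auto
  define F where "F = snd ` Poly_Mapping.keys u"
  have F: "finite F" "F \<subseteq> carrier B" unfolding F_def using u by auto
  from partial_functionals[OF F UW(1-4)]
  obtain l \<phi> z where \<phi>: "\<forall>j b. \<phi> j b \<in> carrier A" and z: "\<forall>j. z j \<in> carrier B"
    and Fz: "\<forall>b\<in>F. b = dot B l (\<lambda>j. f (\<phi> j b)) z"
    and c: "\<forall>j<l. (\<forall>(p, q)\<in>U. \<phi> j (p \<oplus>\<^bsub>B\<^esub> q) = \<phi> j p \<oplus>\<^bsub>A\<^esub> \<phi> j q) \<and>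
           (\<forall>(a, p)\<in>W. \<phi> j (f a \<otimes>\<^bsub>B\<^esub> p) = a \<otimes>\<^bsub>A\<^esub> \<phi> j p)" by blast
  have "\<exists>h. h \<in> hom T.free (add_monoid M) \<and> (\<forall>x\<in>carrier M. \<forall>b\<in>carrier B. h (frag_of (x, b)) = \<phi> j b \<odot>\<^bsub>M\<^esub> x)" for j
    using T.functional_hom[of "\<phi> j"] \<phi> by simp
  then obtain h where h: "\<And>j. h j \<in> hom T.free (add_monoid M)"
    "\<And>j x b. x \<in> carrier M \<Longrightarrow> b \<in> carrier B \<Longrightarrow> h j (frag_of (x, b)) = \<phi> j b \<odot>\<^bsub>M\<^esub> x" by metis
  have "\<exists>h. h \<in> hom T'.free (add_monoid M') \<and> (\<forall>x\<in>carrier M'. \<forall>b\<in>carrier B. h (frag_of (x, b)) = \<phi> j b \<odot>\<^bsub>M'\<^esub> x)" for j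
    using T'.functional_hom[of "\<phi> j"] \<phi> by simp
  then obtain h' where h': "\<And>j. h' j \<in> hom T'.free (add_monoid M')"
    "\<And>j x b. x \<in> carrier M' \<Longrightarrow> b \<in> carrier B \<Longrightarrow> h' j (frag_of (x, b)) = \<phi> j b \<odot>\<^bsub>M'\<^esub> x" by metis
  note hM = hom_free_Abelian_group[OF M.abelian_group_axioms h(1), simplified]
  note hM' = hom_free_Abelian_group[OF M'.abelian_group_axioms h'(1), simplified]
  \<comment> \<open>Applying a functional in the second component commutes with the linear map
    \<open>g\<close> in the first.\<close>
  have nat: "g (h j w) = h' j (lift w)" if "Poly_Mapping.keys w \<subseteq> carrier M \<times> carrier B" for j w
    using that
  proof (induction w rule: free_Abelian_group_induct[consumes 1, case_names 1 2 3])
    case 1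
    then show ?case by (simp add: hM hM' g_zero)
  next
    case (2 u v)
    then show ?case using hM(1)[of u j] hM(1)[of v j] by (simp add: hM(5) hM'(5) lift_keys g_diff)
  next
    case (3 a)
    then show ?case using \<phi> by (auto simp: h h' g_smult)
  qed
  have h0: "h j u = \<zero>\<^bsub>M\<^esub>" if "j < l" for j
  proof -
    have "h' j (lift u) = \<zero>\<^bsub>M'\<^esub>"
      by (rule UW(5)[unfolded T'.annihilated_def, rule_format, where \<phi>="\<phi> j"])
        (use \<phi> c that h' in auto)
    then have "g (h j u) = g \<zero>\<^bsub>M\<^esub>" using nat[OF u] g_zero by simp
    then show ?thesis using inj_onD[OF g_inj, of "h j u" "\<zero>\<^bsub>M\<^esub>"] hM(1)[OF u] by simp
  qed
  \<comment> \<open>Restricted to second components in \<open>F\<close>, since the expansion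
    \<open>Fz\<close> is available only there.\<close>
  have key: "w - (\<Sum>j<l. frag_of (h j w, z j)) \<in> T.null" if "Poly_Mapping.keys w \<subseteq> carrier M \<times> F" for w
    using that
  proof (induction w rule: free_Abelian_group_induct[consumes 1, case_names 1 2 3])
    case 1
    have "(\<Sum>j<l. frag_of (h j 0, z j)) \<in> T.null"
      by (rule T.null_sum) (use z in \<open>simp add: hM T.null_zero_left\<close>)
    then show ?case using T.null_minus by simp
  next
    case (2 u v)
    have k: "Poly_Mapping.keys u \<subseteq> carrier M \<times> carrier B" "Poly_Mapping.keys v \<subseteq> carrier M \<times> carrier B"
      using 2(1,2) F(2) by auto
    have "(\<Sum>j<l. frag_of (h j u, z j) - frag_of (h j v, z j) - frag_of (h j u \<ominus>\<^bsub>M\<^esub> h j v, z j)) \<in> T.null"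
      by (rule T.null_sum, rule T.null_diff_left) (use z hM(1) k in auto)
    then have "(\<Sum>j<l. frag_of (h j u, z j)) - (\<Sum>j<l. frag_of (h j v, z j)) - (\<Sum>j<l. frag_of (h j (u - v), z j)) \<in> T.null"
      by (simp add: sum_subtractf hM(5) k)
    from T.null_add[OF this T.null_diff[OF 2(3,4)]] show ?case by (simp add: algebra_simps)
  next
    case (3 a)
    then obtain x b where a: "a = (x, b)" "x \<in> carrier M" "b \<in> F" by auto
    have b: "b \<in> carrier B" using a F by auto
    have cB: "\<forall>j. f (\<phi> j b) \<otimes>\<^bsub>B\<^esub> z j \<in> carrier B" using \<phi> z by simp
    have "rec_nat \<zero>\<^bsub>N\<^esub> (\<lambda>j s. s \<oplus>\<^bsub>N\<^esub> f (\<phi> j b) \<otimes>\<^bsub>B\<^esub> z j) n = dot B n (\<lambda>j. f (\<phi> j b)) z" for n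
      by (induction n) simp_all
    then have "rec_nat \<zero>\<^bsub>N\<^esub> (\<lambda>j s. s \<oplus>\<^bsub>N\<^esub> f (\<phi> j b) \<otimes>\<^bsub>B\<^esub> z j) l = b" using Fz a(3) by simp
    then have 1: "frag_of (x, b) - (\<Sum>j<l. frag_of (x, f (\<phi> j b) \<otimes>\<^bsub>B\<^esub> z j)) \<in> T.null"
      using T.null_smult_right_sum[OF a(2), of "\<lambda>j. f (\<phi> j b) \<otimes>\<^bsub>B\<^esub> z j" l] cB by simp
    have "(\<Sum>j<l. frag_of (\<phi> j b \<odot>\<^bsub>M\<^esub> x, z j) - frag_of (x, \<phi> j b \<odot>\<^bsub>N\<^esub> z j)) \<in> T.null"
      by (rule T.null_sum, rule T.null_smult) (use \<phi> z a in auto)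
    then have "(\<Sum>j<l. frag_of (h j (frag_of (x, b)), z j)) - (\<Sum>j<l. frag_of (x, f (\<phi> j b) \<otimes>\<^bsub>B\<^esub> z j)) \<in> T.null"
      using a(2) b by (simp add: sum_subtractf h(2))
    from T.null_diff[OF 1 this] show ?case unfolding a(1) by simp
  qed
  have "Poly_Mapping.keys u \<subseteq> carrier M \<times> F"
  proof
    fix p assume p: "p \<in> Poly_Mapping.keys u"
    then have "fst p \<in> carrier M" "snd p \<in> F" using u unfolding F_def by auto
    then show "p \<in> carrier M \<times> F" by (simp add: mem_Times_iff)
  qed
  from key[OF this] have 1: "u - (\<Sum>j<l. frag_of (h j u, z j)) \<in> T.null" .
  have "(\<Sum>j<l. frag_of (h j u, z j)) \<in> T.null"
    by (rule T.null_sum) (use z h0 in \<open>simp add: T.null_zero_left\<close>)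
  from T.null_add[OF 1 this] show ?thesis by simp
qed

lemma tensor_map_coset:
  "tensor_map A M' N g (T.null #>\<^bsub>T.free\<^esub> u) = T'.null #>\<^bsub>T'.free\<^esub> lift u"
  if u: "Poly_Mapping.keys u \<subseteq> carrier M \<times> carrier B"
proof -
  have "T'.null #>\<^bsub>T'.free\<^esub> lift (n + u) = T'.null #>\<^bsub>T'.free\<^esub> lift u" if n: "n \<in> T.null" for n
  proof -
    have "Poly_Mapping.keys (n + u) \<subseteq> carrier M \<times> carrier B"
      using T.null_keys[OF n] u keys_add[of n u] by auto
    from T'.coset_eq[unfolded N_simps(1), OF lift_keys[OF this] lift_keys[OF u]] lift_null[OF n]
    show ?thesis by simp
  qed
  moreover have "T.null #>\<^bsub>T.free\<^esub> u = (\<lambda>n. n + u) ` T.null" unfolding r_coset_def by auto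
  ultimately show ?thesis unfolding tensor_map_def lift_def[symmetric] using T.null_zero by auto
qed

lemma tensor_map_inj: "inj_on (tensor_map A M' N g) (carrier (tensor_group A M N))"
proof (rule inj_onI)
  fix w v assume "w \<in> carrier (tensor_group A M N)" "v \<in> carrier (tensor_group A M N)"
    and eq: "tensor_map A M' N g w = tensor_map A M' N g v"
  then obtain u u' where u: "w = T.null #>\<^bsub>T.free\<^esub> u" "v = T.null #>\<^bsub>T.free\<^esub> u'"
    "Poly_Mapping.keys u \<subseteq> carrier M \<times> carrier B" "Poly_Mapping.keys u' \<subseteq> carrier M \<times> carrier B"
    unfolding tensor_group_def FactGroup_def RCOSETS_def by auto
  have "T'.null #>\<^bsub>T'.free\<^esub> lift u = T'.null #>\<^bsub>T'.free\<^esub> lift u'"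
    using eq unfolding u(1,2) tensor_map_coset[OF u(3)] tensor_map_coset[OF u(4)] .
  then have "lift u - lift u' \<in> T'.null"
    using T'.coset_eq[unfolded N_simps(1), OF lift_keys[OF u(3)] lift_keys[OF u(4)]] by simp
  then have "lift (u - u') \<in> T'.null" by simp
  moreover have "Poly_Mapping.keys (u - u') \<subseteq> carrier M \<times> carrier B" using u(3,4) keys_diff[of u u'] by auto
  ultimately have "u - u' \<in> T.null" by (intro lift_null_iff)
  then show "w = v" unfolding u(1,2) using T.coset_eq[of u u'] u(3,4) by simp
qed

end

theorem equationally_flat_imp_flat_hom:
  assumes "cring A" "cring B" "f \<in> ring_hom A B" "equationally_flat A B f"
  shows "flat_hom A B f"
  unfolding flat_hom_def flat_module_def
proof (intro conjI assms allI impI)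
  show "module A (algebra_via f B)" by (rule module_algebra_via[OF assms(1-3)])
  fix M M' :: "('a, 'a list) module" and g
  assume *: "module A M \<and> module A M' \<and> g \<in> module_maps A M M' \<and> inj_on g (carrier M)"
  interpret flat_tensor A B f M M' g
    using * assms by (intro flat_tensor.intro flat_algebra.intro flat_algebra_axioms.intro flat_tensor_axioms.intro) auto
  show "inj_on (tensor_map A M' (algebra_via f B) g) (carrier (tensor_group A M (algebra_via f B)))"
    by (rule tensor_map_inj)
qed

section \<open>Localization\<close>

lemma UN_constant:
  assumes "\<And>p. p \<in> F \<Longrightarrow> f p = c" "F \<noteq> {}"
  shows "(\<Union>p\<in>F. f p) = c"
  using assms by auto

text \<open>Operations on fractions are defined as unions over all representatives; well-definedness
  makes all members of such a union equal, so that any pair of representatives computes it.\<close>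

lemma UN_constant2:
  assumes "\<And>a s b t. (a, s) \<in> F \<Longrightarrow> (b, t) \<in> G \<Longrightarrow> f a s b t = c" "F \<noteq> {}" "G \<noteq> {}"
  shows "(\<Union>(a, s)\<in>F. \<Union>(b, t)\<in>G. f a s b t) = c"
proof (rule UN_constant)
  fix p assume p: "p \<in> F"
  obtain a s where e: "p = (a, s)" by (cases p)
  have "(\<Union>(b, t)\<in>G. f a s b t) = c"
  proof (rule UN_constant)
    fix q assume "q \<in> G"
    then show "(case q of (b, t) \<Rightarrow> f a s b t) = c" using assms(1)[of a s "fst q" "snd q"] p e by (cases q) simp
  qed (rule assms(3))
  then show "(case p of (a, s) \<Rightarrow> \<Union>(b, t)\<in>G. f a s b t) = c" by (simp add: e)
qed (rule assms(2))

locale fractions = cring A for A (structure) +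
  fixes S
  assumes S_sub: "S \<subseteq> carrier A" and S_one: "\<one> \<in> S" and S_mult: "s \<in> S \<Longrightarrow> t \<in> S \<Longrightarrow> s \<otimes> t \<in> S"
begin

lemma S_closed [simp]: "s \<in> S \<Longrightarrow> s \<in> carrier A"
  using S_sub by blast

lemma loc_rel_iff: "((a, s), (b, t)) \<in> loc_rel A S \<longleftrightarrow>
    a \<in> carrier A \<and> s \<in> S \<and> b \<in> carrier A \<and> t \<in> S \<and> (\<exists>u\<in>S. u \<otimes> (t \<otimes> a) = u \<otimes> (s \<otimes> b))"
  unfolding loc_rel_def by simp

lemma loc_rel_equiv: "equiv (carrier A \<times> S) (loc_rel A S)"
proof (rule equivI)
  show "loc_rel A S \<subseteq> (carrier A \<times> S) \<times> (carrier A \<times> S)" unfolding loc_rel_def by auto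
  show "refl_on (carrier A \<times> S) (loc_rel A S)"
    by (rule refl_onI) (use S_one in \<open>auto simp: loc_rel_iff\<close>)
  show "sym (loc_rel A S)"
    by (rule symI) (auto simp: loc_rel_iff, metis)
  show "trans (loc_rel A S)"
  proof (rule transI)
    fix p q r assume "(p, q) \<in> loc_rel A S" "(q, r) \<in> loc_rel A S"
    moreover obtain a s b t c w where e: "p = (a, s)" "q = (b, t)" "r = (c, w)" by (metis surj_pair)
    ultimately obtain u v where *: "a \<in> carrier A" "s \<in> S" "b \<in> carrier A" "t \<in> S" "c \<in> carrier A" "w \<in> S"
      "u \<in> S" "u \<otimes> (t \<otimes> a) = u \<otimes> (s \<otimes> b)" "v \<in> S" "v \<otimes> (w \<otimes> b) = v \<otimes> (t \<otimes> c)"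
      by (auto simp: loc_rel_iff)
    note cl = *(1) S_closed[OF *(2)] *(3) S_closed[OF *(4)] *(5) S_closed[OF *(6)] S_closed[OF *(7)] S_closed[OF *(9)]
    \<comment> \<open>The witness includes the middle denominator \<open>t\<close>, which may be a
      zero divisor and so cannot be cancelled.\<close>
    have "(u \<otimes> v \<otimes> t) \<otimes> (w \<otimes> a) = (v \<otimes> w) \<otimes> (u \<otimes> (t \<otimes> a))" using cl by algebra
    also have "\<dots> = (u \<otimes> s) \<otimes> (v \<otimes> (w \<otimes> b))" unfolding *(8) using cl by algebra
    also have "\<dots> = (u \<otimes> v \<otimes> t) \<otimes> (s \<otimes> c)" unfolding *(10) using cl by algebra
    finally have "(u \<otimes> v \<otimes> t) \<otimes> (w \<otimes> a) = (u \<otimes> v \<otimes> t) \<otimes> (s \<otimes> c)" .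
    moreover have "u \<otimes> v \<otimes> t \<in> S" using * S_mult by blast
    ultimately show "(p, r) \<in> loc_rel A S" unfolding e loc_rel_iff using * by blast
  qed
qed

lemma fraction_eq_iff:
  assumes "a \<in> carrier A" "s \<in> S" "b \<in> carrier A" "t \<in> S"
  shows "fraction A S a s = fraction A S b t \<longleftrightarrow> (\<exists>u\<in>S. u \<otimes> (t \<otimes> a) = u \<otimes> (s \<otimes> b))"
  using eq_equiv_class_iff[OF loc_rel_equiv, of "(a, s)" "(b, t)"] assms unfolding fraction_def
  by (simp add: loc_rel_iff)

abbreviation "L \<equiv> localization A S"

lemma L_simps:
  "carrier L = (carrier A \<times> S) // loc_rel A S" "\<one>\<^bsub>L\<^esub> = fraction A S \<one> \<one>" "\<zero>\<^bsub>L\<^esub> = fraction A S \<zero> \<one>"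
  by (simp_all add: localization_def)

lemma fraction_closed [simp]: "a \<in> carrier A \<Longrightarrow> s \<in> S \<Longrightarrow> fraction A S a s \<in> carrier L"
  unfolding L_simps fraction_def by (rule quotientI) simp

lemma L_cases:
  assumes "x \<in> carrier L"
  obtains a s where "a \<in> carrier A" "s \<in> S" "x = fraction A S a s"
  using assms unfolding L_simps fraction_def by (auto elim!: quotientE)

lemma in_fraction:
  assumes "a \<in> carrier A" "s \<in> S"
  shows "(b, t) \<in> fraction A S a s \<longleftrightarrow> b \<in> carrier A \<and> t \<in> S \<and> fraction A S b t = fraction A S a s"
proof -
  have "(b, t) \<in> fraction A S a s \<longleftrightarrow> ((a, s), (b, t)) \<in> loc_rel A S" by (simp add: fraction_def)
  also have "\<dots> \<longleftrightarrow> b \<in> carrier A \<and> t \<in> S \<and> (\<exists>u\<in>S. u \<otimes> (t \<otimes> a) = u \<otimes> (s \<otimes> b))" using assms by (auto simp: loc_rel_iff)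
  also have "\<dots> \<longleftrightarrow> b \<in> carrier A \<and> t \<in> S \<and> fraction A S b t = fraction A S a s"
    using fraction_eq_iff[OF assms, of b t] by auto
  finally show ?thesis .
qed

lemma fraction_mult:
  assumes "a \<in> carrier A" "s \<in> S" "b \<in> carrier A" "t \<in> S"
  shows "fraction A S a s \<otimes>\<^bsub>L\<^esub> fraction A S b t = fraction A S (a \<otimes> b) (s \<otimes> t)"
proof -
  have wd: "fraction A S (a' \<otimes> b') (s' \<otimes> t') = fraction A S (a \<otimes> b) (s \<otimes> t)"
    if ab: "(a', s') \<in> fraction A S a s" "(b', t') \<in> fraction A S b t" for a' s' b' t'
  proof -
    have c: "a' \<in> carrier A" "s' \<in> S" "b' \<in> carrier A" "t' \<in> S" using ab assms by (auto simp: in_fraction)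
    obtain u where u: "u \<in> S" "u \<otimes> (s \<otimes> a') = u \<otimes> (s' \<otimes> a)"
      using ab(1) unfolding in_fraction[OF assms(1,2)] fraction_eq_iff[OF c(1,2) assms(1,2)] by blast
    obtain v where v: "v \<in> S" "v \<otimes> (t \<otimes> b') = v \<otimes> (t' \<otimes> b)"
      using ab(2) unfolding in_fraction[OF assms(3,4)] fraction_eq_iff[OF c(3,4) assms(3,4)] by blast
    note cl = assms(1,3) c(1,3) S_closed[OF assms(2)] S_closed[OF assms(4)] S_closed[OF c(2)] S_closed[OF c(4)] S_closed[OF u(1)] S_closed[OF v(1)]
    have "(u \<otimes> v) \<otimes> ((s \<otimes> t) \<otimes> (a' \<otimes> b')) = (u \<otimes> (s \<otimes> a')) \<otimes> (v \<otimes> (t \<otimes> b'))" using cl by algebra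
    also have "\<dots> = (u \<otimes> v) \<otimes> ((s' \<otimes> t') \<otimes> (a \<otimes> b))" unfolding u(2) v(2) using cl by algebra
    finally show ?thesis using assms c S_mult[OF u(1) v(1)] S_mult by (subst fraction_eq_iff) auto
  qed
  have ne: "(a, s) \<in> fraction A S a s" "(b, t) \<in> fraction A S b t" using assms by (auto simp: in_fraction)
  have "fraction A S a s \<otimes>\<^bsub>L\<^esub> fraction A S b t
      = (\<Union>(a', s')\<in>fraction A S a s. \<Union>(b', t')\<in>fraction A S b t. fraction A S (a' \<otimes> b') (s' \<otimes> t'))"
    by (simp add: localization_def)
  also have "\<dots> = fraction A S (a \<otimes> b) (s \<otimes> t)"
    using ne by (intro UN_constant2 wd) auto
  finally show ?thesis .
qed

lemma fraction_add:
  assumes "a \<in> carrier A" "s \<in> S" "b \<in> carrier A" "t \<in> S"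
  shows "fraction A S a s \<oplus>\<^bsub>L\<^esub> fraction A S b t = fraction A S (t \<otimes> a \<oplus> s \<otimes> b) (s \<otimes> t)"
proof -
  have wd: "fraction A S (t' \<otimes> a' \<oplus> s' \<otimes> b') (s' \<otimes> t') = fraction A S (t \<otimes> a \<oplus> s \<otimes> b) (s \<otimes> t)"
    if ab: "(a', s') \<in> fraction A S a s" "(b', t') \<in> fraction A S b t" for a' s' b' t'
  proof -
    have c: "a' \<in> carrier A" "s' \<in> S" "b' \<in> carrier A" "t' \<in> S" using ab assms by (auto simp: in_fraction)
    obtain u where u: "u \<in> S" "u \<otimes> (s \<otimes> a') = u \<otimes> (s' \<otimes> a)"
      using ab(1) unfolding in_fraction[OF assms(1,2)] fraction_eq_iff[OF c(1,2) assms(1,2)] by blast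
    obtain v where v: "v \<in> S" "v \<otimes> (t \<otimes> b') = v \<otimes> (t' \<otimes> b)"
      using ab(2) unfolding in_fraction[OF assms(3,4)] fraction_eq_iff[OF c(3,4) assms(3,4)] by blast
    note cl = assms(1,3) c(1,3) S_closed[OF assms(2)] S_closed[OF assms(4)] S_closed[OF c(2)] S_closed[OF c(4)] S_closed[OF u(1)] S_closed[OF v(1)]
    have "(u \<otimes> v) \<otimes> ((s \<otimes> t) \<otimes> (t' \<otimes> a' \<oplus> s' \<otimes> b'))
        = (v \<otimes> t \<otimes> t') \<otimes> (u \<otimes> (s \<otimes> a')) \<oplus> (u \<otimes> s \<otimes> s') \<otimes> (v \<otimes> (t \<otimes> b'))" using cl by algebra
    also have "\<dots> = (u \<otimes> v) \<otimes> ((s' \<otimes> t') \<otimes> (t \<otimes> a \<oplus> s \<otimes> b))" unfolding u(2) v(2) using cl by algebra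
    finally show ?thesis using assms c S_mult[OF u(1) v(1)] S_mult by (subst fraction_eq_iff) auto
  qed
  have ne: "(a, s) \<in> fraction A S a s" "(b, t) \<in> fraction A S b t" using assms by (auto simp: in_fraction)
  have "fraction A S a s \<oplus>\<^bsub>L\<^esub> fraction A S b t
      = (\<Union>(a', s')\<in>fraction A S a s. \<Union>(b', t')\<in>fraction A S b t. fraction A S (t' \<otimes> a' \<oplus> s' \<otimes> b') (s' \<otimes> t'))"
    by (simp add: localization_def)
  also have "\<dots> = fraction A S (t \<otimes> a \<oplus> s \<otimes> b) (s \<otimes> t)"
    using ne by (intro UN_constant2 wd) auto
  finally show ?thesis .
qed

lemma fraction_eqI:
  assumes "a \<in> carrier A" "s \<in> S" "b \<in> carrier A" "t \<in> S" "t \<otimes> a = s \<otimes> b"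
  shows "fraction A S a s = fraction A S b t"
  using assms S_one by (subst fraction_eq_iff) auto

lemma L_cring: "cring L"
proof (rule cringI)
  show "abelian_group L"
  proof (rule abelian_groupI)
    show "\<zero>\<^bsub>L\<^esub> \<in> carrier L" unfolding L_simps(3) using S_one by simp
    fix x assume x: "x \<in> carrier L"
    then obtain a s where a: "a \<in> carrier A" "s \<in> S" "x = fraction A S a s" by (rule L_cases)
    show "\<zero>\<^bsub>L\<^esub> \<oplus>\<^bsub>L\<^esub> x = x" unfolding L_simps(3) a(3) using a S_one by (simp add: fraction_add)
    have "s \<otimes> \<ominus> a \<oplus> s \<otimes> a = \<zero>" using a(1) S_closed[OF a(2)] by algebra
    then have "fraction A S (\<ominus> a) s \<oplus>\<^bsub>L\<^esub> x = fraction A S \<zero> (s \<otimes> s)" unfolding a(3)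
      using a by (simp add: fraction_add)
    also have "\<dots> = \<zero>\<^bsub>L\<^esub>" unfolding L_simps(3) using a S_one S_mult by (intro fraction_eqI) simp_all
    finally have "fraction A S (\<ominus> a) s \<oplus>\<^bsub>L\<^esub> x = \<zero>\<^bsub>L\<^esub>" .
    then show "\<exists>z\<in>carrier L. z \<oplus>\<^bsub>L\<^esub> x = \<zero>\<^bsub>L\<^esub>" using a by (intro bexI[of _ "fraction A S (\<ominus> a) s"]) simp_all
    fix z assume "z \<in> carrier L"
    then obtain b t where b: "b \<in> carrier A" "t \<in> S" "z = fraction A S b t" by (rule L_cases)
    show "x \<oplus>\<^bsub>L\<^esub> z \<in> carrier L" unfolding a b using a b S_mult by (simp add: fraction_add)
    show "x \<oplus>\<^bsub>L\<^esub> z = z \<oplus>\<^bsub>L\<^esub> x" unfolding a b using a b by (simp add: fraction_add m_comm a_comm)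
    fix w assume "w \<in> carrier L"
    then obtain c v where c: "c \<in> carrier A" "v \<in> S" "w = fraction A S c v" by (rule L_cases)
    note cl = a(1) b(1) c(1) S_closed[OF a(2)] S_closed[OF b(2)] S_closed[OF c(2)]
    have e: "v \<otimes> (t \<otimes> a \<oplus> s \<otimes> b) \<oplus> s \<otimes> (t \<otimes> c) = t \<otimes> (v \<otimes> a) \<oplus> s \<otimes> (v \<otimes> b \<oplus> t \<otimes> c)" using cl by algebra
    show "x \<oplus>\<^bsub>L\<^esub> z \<oplus>\<^bsub>L\<^esub> w = x \<oplus>\<^bsub>L\<^esub> (z \<oplus>\<^bsub>L\<^esub> w)" unfolding a(3) b(3) c(3)
      using a b c S_mult by (simp add: fraction_add e m_assoc)
  qed
  show "comm_monoid L"
  proof (rule comm_monoidI)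
    show "\<one>\<^bsub>L\<^esub> \<in> carrier L" unfolding L_simps(2) using S_one by simp
    fix x assume x: "x \<in> carrier L"
    then obtain a s where a: "a \<in> carrier A" "s \<in> S" "x = fraction A S a s" by (rule L_cases)
    show "\<one>\<^bsub>L\<^esub> \<otimes>\<^bsub>L\<^esub> x = x" unfolding L_simps(2) a(3) using a S_one by (simp add: fraction_mult)
    fix z assume "z \<in> carrier L"
    then obtain b t where b: "b \<in> carrier A" "t \<in> S" "z = fraction A S b t" by (rule L_cases)
    show "x \<otimes>\<^bsub>L\<^esub> z \<in> carrier L" unfolding a b using a b S_mult by (simp add: fraction_mult)
    show "x \<otimes>\<^bsub>L\<^esub> z = z \<otimes>\<^bsub>L\<^esub> x" unfolding a b using a b by (simp add: fraction_mult m_comm)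
    fix w assume "w \<in> carrier L"
    then obtain c v where c: "c \<in> carrier A" "v \<in> S" "w = fraction A S c v" by (rule L_cases)
    show "x \<otimes>\<^bsub>L\<^esub> z \<otimes>\<^bsub>L\<^esub> w = x \<otimes>\<^bsub>L\<^esub> (z \<otimes>\<^bsub>L\<^esub> w)" unfolding a(3) b(3) c(3)
      using a b c S_mult by (simp add: fraction_mult m_assoc)
  qed
  fix x z w assume "x \<in> carrier L" "z \<in> carrier L" "w \<in> carrier L"
  then obtain a s b t c v where a: "a \<in> carrier A" "s \<in> S" "x = fraction A S a s"
    and b: "b \<in> carrier A" "t \<in> S" "z = fraction A S b t"
    and c: "c \<in> carrier A" "v \<in> S" "w = fraction A S c v" by (meson L_cases)
  note cl = a(1) b(1) c(1) S_closed[OF a(2)] S_closed[OF b(2)] S_closed[OF c(2)]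
  have "((s \<otimes> v) \<otimes> (t \<otimes> v)) \<otimes> ((t \<otimes> a \<oplus> s \<otimes> b) \<otimes> c) = ((s \<otimes> t) \<otimes> v) \<otimes> ((t \<otimes> v) \<otimes> (a \<otimes> c) \<oplus> (s \<otimes> v) \<otimes> (b \<otimes> c))"
    using cl by algebra
  then show "(x \<oplus>\<^bsub>L\<^esub> z) \<otimes>\<^bsub>L\<^esub> w = x \<otimes>\<^bsub>L\<^esub> w \<oplus>\<^bsub>L\<^esub> z \<otimes>\<^bsub>L\<^esub> w" unfolding a(3) b(3) c(3)
    using a(1,2) b(1,2) c(1,2) S_mult by (simp add: fraction_mult fraction_add) (rule fraction_eqI, simp_all)
qed

lemma loc_map_hom: "loc_map A S \<in> ring_hom A L"
  by (rule ring_hom_memI)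
    (auto simp: loc_map_def L_simps(2) S_one fraction_mult fraction_add)

lemma fraction_common_add:
  assumes "a \<in> carrier A" "b \<in> carrier A" "s \<in> S"
  shows "fraction A S a s \<oplus>\<^bsub>L\<^esub> fraction A S b s = fraction A S (a \<oplus> b) s"
proof -
  have "s \<otimes> (s \<otimes> a \<oplus> s \<otimes> b) = (s \<otimes> s) \<otimes> (a \<oplus> b)" using assms(1,2) S_closed[OF assms(3)] by algebra
  then show ?thesis using assms S_mult by (simp add: fraction_add) (rule fraction_eqI, simp_all)
qed

lemma fraction_dot:
  assumes "\<forall>i. a i \<in> carrier A" "\<forall>i. c i \<in> carrier A" "s \<in> S"
  shows "dot L k (\<lambda>i. loc_map A S (a i)) (\<lambda>i. fraction A S (c i) s) = fraction A S (dot A k a c) s"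
proof (induction k)
  case 0
  then show ?case unfolding dot.simps L_simps(3) using assms S_one by (intro fraction_eqI) simp_all
next
  case (Suc k)
  have "loc_map A S (a k) \<otimes>\<^bsub>L\<^esub> fraction A S (c k) s = fraction A S (a k \<otimes> c k) s"
    unfolding loc_map_def using assms S_one by (simp add: fraction_mult)
  then show ?case unfolding dot.simps Suc using assms by (simp add: fraction_common_add)
qed

end

text \<open>Relations over \<open>C[1/y]\<close> are cleared of denominators, so it suffices that the solutions in \<open>C\<close> of
  a linear equation over \<open>A\<close> become trivial after multiplication by a power of \<open>y\<close>.\<close>

lemma equationally_flat_localization:
  assumes "cring C" and y: "y \<in> carrier C" and cancel: "\<And>c. c \<in> carrier C \<Longrightarrow> y \<otimes>\<^bsub>C\<^esub> c = \<zero>\<^bsub>C\<^esub> \<Longrightarrow> c = \<zero>\<^bsub>C\<^esub>"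
    and A: "carrier A \<subseteq> carrier C"
    and rel: "\<And>k a x. \<forall>i. a i \<in> carrier A \<Longrightarrow> \<forall>i. x i \<in> carrier C \<Longrightarrow> dot C k a x = \<zero>\<^bsub>C\<^esub> \<Longrightarrow>
      \<exists>M l \<sigma> z. (\<forall>i j. \<sigma> i j \<in> carrier A) \<and> (\<forall>j. z j \<in> carrier C) \<and>
          (\<forall>j<l. dot A k a (\<lambda>i. \<sigma> i j) = \<zero>\<^bsub>A\<^esub>) \<and>
          (\<forall>i<k. y [^]\<^bsub>C\<^esub> (M::nat) \<otimes>\<^bsub>C\<^esub> x i = dot C l (\<sigma> i) z)"
  shows "equationally_flat A (localization C (powers_of C y)) (loc_map C (powers_of C y))"
proof -
  interpret C: cring C by fact
  let ?S = "powers_of C y"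
  have pow: "y [^]\<^bsub>C\<^esub> (n::nat) \<in> ?S" for n unfolding powers_of_def by blast
  have S: "\<exists>n::nat. s = y [^]\<^bsub>C\<^esub> n" if "s \<in> ?S" for s using that unfolding powers_of_def by blast
  interpret fractions C ?S
  proof
    show "?S \<subseteq> carrier C" using S y by force
    show "\<one>\<^bsub>C\<^esub> \<in> ?S" using pow[of 0] by simp
    fix s t assume "s \<in> ?S" "t \<in> ?S"
    then obtain m n :: nat where "s = y [^]\<^bsub>C\<^esub> m" "t = y [^]\<^bsub>C\<^esub> n" using S by blast
    then show "s \<otimes>\<^bsub>C\<^esub> t \<in> ?S" using pow[of "m + n"] y by (simp add: C.nat_pow_mult)
  qed
  show ?thesis unfolding equationally_flat_def
  proof (intro allI impI, elim conjE)
    fix k a \<xi> assume a: "\<forall>i. a i \<in> carrier A" and \<xi>: "\<forall>i. \<xi> i \<in> carrier L"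
      and d: "dot L k (\<lambda>i. loc_map C ?S (a i)) \<xi> = \<zero>\<^bsub>L\<^esub>"
    have aC: "\<forall>i. a i \<in> carrier C" using a A by blast
    have "\<exists>c n. c \<in> carrier C \<and> \<xi> i = fraction C ?S c (y [^]\<^bsub>C\<^esub> (n::nat))" for i
    proof -
      obtain c s where "c \<in> carrier C" "s \<in> ?S" "\<xi> i = fraction C ?S c s" using L_cases[OF \<xi>[rule_format, of i]] .
      then show ?thesis using S[of s] by auto
    qed
    then obtain c n where c: "\<And>i. c i \<in> carrier C" "\<And>i. \<xi> i = fraction C ?S (c i) (y [^]\<^bsub>C\<^esub> (n i :: nat))" by metis
    \<comment> \<open>The sum of the exponents is a crude upper bound for them and gives a common
      denominator.\<close>
    define N where "N = (\<Sum>i<k. n i)"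
    have nN: "n i \<le> N" if "i < k" for i unfolding N_def using that by (intro member_le_sum) auto
    define x where "x i = y [^]\<^bsub>C\<^esub> (N - n i) \<otimes>\<^bsub>C\<^esub> c i" for i
    have x: "\<forall>i. x i \<in> carrier C" unfolding x_def using c y by simp
    have \<xi>x: "\<xi> i = fraction C ?S (x i) (y [^]\<^bsub>C\<^esub> N)" if "i < k" for i
    proof -
      have "y [^]\<^bsub>C\<^esub> N = y [^]\<^bsub>C\<^esub> n i \<otimes>\<^bsub>C\<^esub> y [^]\<^bsub>C\<^esub> (N - n i)" using nN[OF that] y by (simp add: C.nat_pow_mult)
      then show ?thesis unfolding c(2) x_def using c(1) y by (intro fraction_eqI pow) (simp_all add: C.m_assoc)
    qed
    have "dot L k (\<lambda>i. loc_map C ?S (a i)) \<xi> = dot L k (\<lambda>i. loc_map C ?S (a i)) (\<lambda>i. fraction C ?S (x i) (y [^]\<^bsub>C\<^esub> N))"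
      by (rule dot_cong) (simp_all add: \<xi>x)
    also have "\<dots> = fraction C ?S (dot C k a x) (y [^]\<^bsub>C\<^esub> N)" by (rule fraction_dot[OF aC x pow])
    finally have "fraction C ?S (dot C k a x) (y [^]\<^bsub>C\<^esub> N) = fraction C ?S \<zero>\<^bsub>C\<^esub> \<one>\<^bsub>C\<^esub>" using d L_simps(3) by simp
    then obtain u where "u \<in> ?S" "u \<otimes>\<^bsub>C\<^esub> (\<one>\<^bsub>C\<^esub> \<otimes>\<^bsub>C\<^esub> dot C k a x) = u \<otimes>\<^bsub>C\<^esub> (y [^]\<^bsub>C\<^esub> N \<otimes>\<^bsub>C\<^esub> \<zero>\<^bsub>C\<^esub>)"
      using aC x pow S_one by (subst (asm) fraction_eq_iff) auto
    then obtain e :: nat where "y [^]\<^bsub>C\<^esub> e \<otimes>\<^bsub>C\<^esub> dot C k a x = \<zero>\<^bsub>C\<^esub>" using S[of u] aC x y by auto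
    from C.pow_cancel[OF y _ C.dot_closed[OF aC x] this] cancel have "dot C k a x = \<zero>\<^bsub>C\<^esub>" by blast
    from rel[OF a x this] obtain M l \<sigma> z where *: "\<forall>i j. \<sigma> i j \<in> carrier A" "\<forall>j. z j \<in> carrier C"
      "\<forall>j<l. dot A k a (\<lambda>i. \<sigma> i j) = \<zero>\<^bsub>A\<^esub>" "\<forall>i<k. y [^]\<^bsub>C\<^esub> (M::nat) \<otimes>\<^bsub>C\<^esub> x i = dot C l (\<sigma> i) z" by blast
    \<comment> \<open>The denominator undoes both the common denominator \<open>y^N\<close> of the
      \<open>\<xi> i\<close> and the factor \<open>y^M\<close> spent on trivializing the
      relation.\<close>
    define \<zeta> where "\<zeta> j = fraction C ?S (z j) (y [^]\<^bsub>C\<^esub> (M + N))" for j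
    have "\<xi> i = dot L l (\<lambda>j. loc_map C ?S (\<sigma> i j)) \<zeta>" if "i < k" for i
    proof -
      have "\<xi> i = fraction C ?S (y [^]\<^bsub>C\<^esub> M \<otimes>\<^bsub>C\<^esub> x i) (y [^]\<^bsub>C\<^esub> (M + N))"
        unfolding \<xi>x[OF that]
      proof (rule fraction_eqI)
        define p q where "p = y [^]\<^bsub>C\<^esub> M" "q = y [^]\<^bsub>C\<^esub> N"
        have "p \<in> carrier C" "q \<in> carrier C" "x i \<in> carrier C" unfolding p_q_def using x y by auto
        then have "(p \<otimes>\<^bsub>C\<^esub> q) \<otimes>\<^bsub>C\<^esub> x i = q \<otimes>\<^bsub>C\<^esub> (p \<otimes>\<^bsub>C\<^esub> x i)" by algebra
        then show "y [^]\<^bsub>C\<^esub> (M + N) \<otimes>\<^bsub>C\<^esub> x i = y [^]\<^bsub>C\<^esub> N \<otimes>\<^bsub>C\<^esub> (y [^]\<^bsub>C\<^esub> M \<otimes>\<^bsub>C\<^esub> x i)"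
          unfolding p_q_def using y by (simp add: C.nat_pow_mult)
      qed (use x y pow in auto)
      also have "\<dots> = dot L l (\<lambda>j. loc_map C ?S (\<sigma> i j)) \<zeta>"
        unfolding \<zeta>_def using *(1,2,4) A pow that by (subst fraction_dot) auto
      finally show ?thesis .
    qed
    moreover have "\<forall>j. \<zeta> j \<in> carrier L" unfolding \<zeta>_def using *(2) pow by simp
    ultimately show "\<exists>l \<sigma> z. (\<forall>i j. \<sigma> i j \<in> carrier A) \<and> (\<forall>j. z j \<in> carrier L) \<and>
        (\<forall>j<l. dot A k a (\<lambda>i. \<sigma> i j) = \<zero>\<^bsub>A\<^esub>) \<and> (\<forall>i<k. \<xi> i = dot L l (\<lambda>j. loc_map C ?S (\<sigma> i j)) z)"
      using *(1,3) by (intro exI[of _ l] exI[of _ \<sigma>] exI[of _ \<zeta>]) simp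
  qed
qed

section \<open>The adic completion of a domain at a principal ideal\<close>

locale y_adic = domain R for R (structure) +
  fixes y assumes y_closed [simp]: "y \<in> carrier R" and y_nonzero: "y \<noteq> \<zero>"
begin

abbreviation "pw n \<equiv> y [^] (n::nat)"

lemma pw_cancel:
  assumes "a \<in> carrier R" "b \<in> carrier R" "pw n \<otimes> a = pw n \<otimes> b"
  shows "a = b"
proof -
  have "pw n \<noteq> \<zero>"
  proof (induction n)
    case (Suc n)
    then show ?case using integral[of "pw n" y] y_nonzero by auto
  qed simp
  then show ?thesis using m_lcancel assms by simp
qed

section \<open>Congruence modulo powers of y\<close>

definition near :: "nat \<Rightarrow> 'a \<Rightarrow> 'a \<Rightarrow> bool" where
  "near n a b \<longleftrightarrow> (\<exists>c\<in>carrier R. a = b \<oplus> pw n \<otimes> c)"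

lemma near_refl: "a \<in> carrier R \<Longrightarrow> near n a a"
  unfolding near_def by (rule bexI[of _ \<zero>]) simp_all

lemma near_sym:
  assumes "near n a b" "b \<in> carrier R"
  shows "near n b a"
proof -
  obtain c where c: "c \<in> carrier R" "a = b \<oplus> pw n \<otimes> c" using assms unfolding near_def by blast
  define p where "p = pw n"
  have "p \<in> carrier R" unfolding p_def by simp
  then have "b = (b \<oplus> p \<otimes> c) \<oplus> p \<otimes> \<ominus> c" using c(1) assms(2) by algebra
  then show ?thesis unfolding near_def c(2) p_def using c(1) by (intro bexI[of _ "\<ominus> c"]) simp_all
qed

lemma near_trans:
  assumes "near n a b" "near n b c" "c \<in> carrier R"
  shows "near n a c"
proof -
  obtain d e where d: "d \<in> carrier R" "a = b \<oplus> pw n \<otimes> d" "e \<in> carrier R" "b = c \<oplus> pw n \<otimes> e"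
    using assms unfolding near_def by blast
  then have "a = c \<oplus> pw n \<otimes> (e \<oplus> d)" using assms(3) by (simp add: r_distr a_assoc)
  then show ?thesis unfolding near_def using d by (intro bexI[of _ "e \<oplus> d"]) simp_all
qed

lemma near_mono:
  assumes "near n a b" "m \<le> n"
  shows "near m a b"
proof -
  obtain c where c: "c \<in> carrier R" "a = b \<oplus> pw n \<otimes> c" using assms unfolding near_def by blast
  have "pw n = pw m \<otimes> pw (n - m)" using assms(2) by (simp add: nat_pow_mult)
  then have "a = b \<oplus> pw m \<otimes> (pw (n - m) \<otimes> c)" using c by (simp add: m_assoc)
  then show ?thesis unfolding near_def using c(1) by (intro bexI[of _ "pw (n - m) \<otimes> c"]) simp_all
qed

lemma near_add:
  assumes "near n a b" "near n c d" "b \<in> carrier R" "d \<in> carrier R"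
  shows "near n (a \<oplus> c) (b \<oplus> d)"
proof -
  obtain u v where u: "u \<in> carrier R" "a = b \<oplus> pw n \<otimes> u" "v \<in> carrier R" "c = d \<oplus> pw n \<otimes> v"
    using assms unfolding near_def by blast
  define p where "p = pw n"
  have "p \<in> carrier R" unfolding p_def by simp
  then have "(b \<oplus> p \<otimes> u) \<oplus> (d \<oplus> p \<otimes> v) = (b \<oplus> d) \<oplus> p \<otimes> (u \<oplus> v)" using u(1,3) assms(3,4) by algebra
  then show ?thesis unfolding near_def u(2,4) p_def using u by (intro bexI[of _ "u \<oplus> v"]) simp_all
qed

lemma near_mult:
  assumes "near n a b" "near n c d" "b \<in> carrier R" "d \<in> carrier R"
  shows "near n (a \<otimes> c) (b \<otimes> d)"
proof -
  obtain u v where u: "u \<in> carrier R" "a = b \<oplus> pw n \<otimes> u" "v \<in> carrier R" "c = d \<oplus> pw n \<otimes> v"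
    using assms unfolding near_def by blast
  define p where "p = pw n"
  have p: "p \<in> carrier R" unfolding p_def by simp
  then have "(b \<oplus> p \<otimes> u) \<otimes> (d \<oplus> p \<otimes> v) = (b \<otimes> d) \<oplus> p \<otimes> (u \<otimes> d \<oplus> b \<otimes> v \<oplus> u \<otimes> (p \<otimes> v))"
    using u(1,3) assms(3,4) by algebra
  then show ?thesis unfolding near_def u(2,4) p_def[symmetric] using u p assms by (intro bexI[of _ "u \<otimes> d \<oplus> b \<otimes> v \<oplus> u \<otimes> (p \<otimes> v)"]) simp_all
qed

abbreviation "I n \<equiv> ideal_power R (PIdl y) n"

lemma ideal_power_eq: "I n = PIdl (pw n)"
proof (induction n)
  case 0
  show ?case by (auto simp: cgenideal_def) (metis r_one)
next
  case (Suc n)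
  have "ideal_prod R (PIdl y) (PIdl (pw n)) = PIdl (pw (Suc n))"
  proof
    show "ideal_prod R (PIdl y) (PIdl (pw n)) \<subseteq> PIdl (pw (Suc n))"
    proof
      fix x assume "x \<in> ideal_prod R (PIdl y) (PIdl (pw n))"
      then show "x \<in> PIdl (pw (Suc n))"
      proof induction
        case (prod i j)
        then obtain u v where "u \<in> carrier R" "v \<in> carrier R" "i = u \<otimes> y" "j = v \<otimes> pw n"
          unfolding cgenideal_def by blast
        then have "i \<otimes> j = (u \<otimes> v) \<otimes> pw (Suc n)" "u \<otimes> v \<in> carrier R" by (simp_all add: m_ac)
        then show ?case unfolding cgenideal_def by blast
      next
        case (sum i j)
        then show ?case
          using additive_subgroup.a_closed[OF ideal.axioms(1)[OF cgenideal_ideal[of "pw (Suc n)"]]] by simp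
      qed
    qed
    show "PIdl (pw (Suc n)) \<subseteq> ideal_prod R (PIdl y) (PIdl (pw n))"
    proof
      fix x assume "x \<in> PIdl (pw (Suc n))"
      then obtain u where u: "u \<in> carrier R" "x = u \<otimes> pw (Suc n)" unfolding cgenideal_def by blast
      then have "x = (u \<otimes> y) \<otimes> (\<one> \<otimes> pw n)" by (simp add: m_ac)
      moreover have "u \<otimes> y \<in> PIdl y" "\<one> \<otimes> pw n \<in> PIdl (pw n)" unfolding cgenideal_def using u by blast+
      ultimately show "x \<in> ideal_prod R (PIdl y) (PIdl (pw n))" using ideal_prod.prod by metis
    qed
  qed
  then show ?case using Suc by simp
qed

lemma I_ideal: "ideal (I n) R"
  unfolding ideal_power_eq by (rule cgenideal_ideal) simp

lemma coset_mem: "a \<in> carrier R \<Longrightarrow> x \<in> I n +> a \<longleftrightarrow> near n x a"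
  unfolding ideal_power_eq unfolding a_r_coset_def' cgenideal_def near_def by (auto simp: a_comm m_comm)

lemma coset_eq: "a \<in> carrier R \<Longrightarrow> b \<in> carrier R \<Longrightarrow> I n +> a = I n +> b \<longleftrightarrow> near n a b"
proof
  assume ab: "a \<in> carrier R" "b \<in> carrier R"
  { assume "I n +> a = I n +> b"
    then show "near n a b" using coset_mem[of a a n] coset_mem[of b a n] near_refl ab by blast }
  { assume n: "near n a b"
    show "I n +> a = I n +> b"
      using coset_mem ab near_trans near_sym[OF n ab(2)] n by blast }
qed

section \<open>Elements of the completion as coherent sequences\<close>

definition mk :: "(nat \<Rightarrow> 'a) \<Rightarrow> (nat \<Rightarrow> 'a set)" where
  "mk a = (\<lambda>n. I n +> a n)"

definition coherent :: "(nat \<Rightarrow> 'a) \<Rightarrow> bool" where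
  "coherent a \<longleftrightarrow> (\<forall>n. a n \<in> carrier R) \<and> (\<forall>n. near n (a (Suc n)) (a n))"

abbreviation "C \<equiv> y_completion R y"

lemma coherent_closed: "coherent a \<Longrightarrow> a n \<in> carrier R"
  unfolding coherent_def by blast

lemma coherent_near:
  assumes "coherent a"
  shows "near n (a (n + j)) (a n)"
proof (induction j)
  case 0
  show ?case using near_refl coherent_closed[OF assms] by simp
next
  case (Suc j)
  have "near n (a (Suc (n + j))) (a (n + j))"
    by (rule near_mono[of "n + j"]) (use assms in \<open>auto simp: coherent_def\<close>)
  then show ?case using near_trans[OF _ Suc coherent_closed[OF assms]] by simp
qed

text \<open>Choosing a representative of each coset gives the sequence; the inclusion of consecutive
  cosets is the congruence of consecutive terms.\<close>

lemma C_carrier: "x \<in> carrier C \<longleftrightarrow> (\<exists>a. coherent a \<and> x = mk a)"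
proof
  assume "x \<in> carrier C"
  then have x: "x n \<in> carrier (R Quot I n)" "x (Suc n) \<subseteq> x n" for n
    unfolding y_completion_def adic_completion_def by auto
  have "\<exists>a\<in>carrier R. x n = I n +> a" for n
    using x(1)[of n] unfolding FactRing_def A_RCOSETS_def' a_r_coset_def' by auto
  then obtain a where a: "\<And>n. a n \<in> carrier R" "\<And>n. x n = I n +> a n" by metis
  have "near n (a (Suc n)) (a n)" for n
    using x(2)[of n] coset_mem[OF a(1), of "a (Suc n)" "Suc n" "Suc n"] coset_mem[OF a(1), of "a (Suc n)" n n]
      near_refl[OF a(1)] unfolding a(2) by blast
  then have "coherent a" unfolding coherent_def using a(1) by blast
  moreover have "x = mk a" unfolding mk_def using a(2) by auto
  ultimately show "\<exists>a. coherent a \<and> x = mk a" by blast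
next
  assume "\<exists>a. coherent a \<and> x = mk a"
  then obtain a where a: "coherent a" "x = mk a" by blast
  have "mk a n \<in> carrier (R Quot I n)" for n
    using coherent_closed[OF a(1), of n] unfolding mk_def FactRing_def A_RCOSETS_def' a_r_coset_def' by auto
  moreover have "mk a (Suc n) \<subseteq> mk a n" for n
  proof
    fix z assume "z \<in> mk a (Suc n)"
    then have "near (Suc n) z (a (Suc n))" unfolding mk_def
      using coset_mem[OF coherent_closed[OF a(1)]] by blast
    then have "near n z (a (Suc n))" by (rule near_mono) simp
    moreover have "near n (a (Suc n)) (a n)" using a(1) unfolding coherent_def by blast
    ultimately have "near n z (a n)" using near_trans coherent_closed[OF a(1)] by blast
    then show "z \<in> mk a n" unfolding mk_def using coset_mem[OF coherent_closed[OF a(1)]] by blast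
  qed
  ultimately show "x \<in> carrier C" unfolding a(2) y_completion_def adic_completion_def by simp
qed

lemma mk_closed: "coherent a \<Longrightarrow> mk a \<in> carrier C"
  using C_carrier by blast

lemma mk_eq: "coherent a \<Longrightarrow> coherent b \<Longrightarrow> mk a = mk b \<longleftrightarrow> (\<forall>n. near n (a n) (b n))"
  unfolding mk_def fun_eq_iff using coset_eq coherent_closed by blast

lemma coherent_const: "r \<in> carrier R \<Longrightarrow> coherent (\<lambda>n. r)"
  unfolding coherent_def using near_refl by blast

lemma coherent_add: "coherent a \<Longrightarrow> coherent b \<Longrightarrow> coherent (\<lambda>n. a n \<oplus> b n)"
  unfolding coherent_def using near_add by blast

lemma coherent_mult: "coherent a \<Longrightarrow> coherent b \<Longrightarrow> coherent (\<lambda>n. a n \<otimes> b n)"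
  unfolding coherent_def using near_mult by blast

lemma mk_add: "coherent a \<Longrightarrow> coherent b \<Longrightarrow> mk a \<oplus>\<^bsub>C\<^esub> mk b = mk (\<lambda>n. a n \<oplus> b n)"
proof -
  assume ab: "coherent a" "coherent b"
  have "(I n +> a n) \<oplus>\<^bsub>R Quot I n\<^esub> (I n +> b n) = I n +> (a n \<oplus> b n)" for n
    using ring_hom_memE(3)[OF ideal.rcos_ring_hom[OF I_ideal], of "a n" "b n" n] ab coherent_closed by simp
  then show ?thesis unfolding mk_def y_completion_def adic_completion_def by simp
qed

lemma mk_mult: "coherent a \<Longrightarrow> coherent b \<Longrightarrow> mk a \<otimes>\<^bsub>C\<^esub> mk b = mk (\<lambda>n. a n \<otimes> b n)"
proof -
  assume ab: "coherent a" "coherent b"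
  have "(I n +> a n) \<otimes>\<^bsub>R Quot I n\<^esub> (I n +> b n) = I n +> (a n \<otimes> b n)" for n
    using ring_hom_memE(2)[OF ideal.rcos_ring_hom[OF I_ideal], of "a n" "b n" n] ab coherent_closed by simp
  then show ?thesis unfolding mk_def y_completion_def adic_completion_def by simp
qed

lemma mk_one: "\<one>\<^bsub>C\<^esub> = mk (\<lambda>n. \<one>)"
  unfolding mk_def y_completion_def adic_completion_def by (simp add: FactRing_def)

lemma mk_zero: "\<zero>\<^bsub>C\<^esub> = mk (\<lambda>n. \<zero>)"
proof -
  have "\<zero>\<^bsub>R Quot I n\<^esub> = I n +> \<zero>" for n
    using ring_hom_zero[OF ideal.rcos_ring_hom[OF I_ideal] ring_axioms ideal.quotient_is_ring[OF I_ideal]] by simp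
  then show ?thesis unfolding mk_def y_completion_def adic_completion_def by simp
qed

lemma coherent_minus: "coherent a \<Longrightarrow> coherent (\<lambda>n. \<ominus> a n)"
proof -
  assume a: "coherent a"
  have "coherent (\<lambda>n. (\<ominus> \<one>) \<otimes> a n)" by (rule coherent_mult[OF coherent_const a]) simp
  then show ?thesis using coherent_closed[OF a] by (simp add: l_minus)
qed

lemma C_cring: "cring C"
proof (rule cringI)
  show "abelian_group C"
  proof (rule abelian_groupI)
    show "\<zero>\<^bsub>C\<^esub> \<in> carrier C" unfolding mk_zero by (intro mk_closed coherent_const) simp
    fix x assume "x \<in> carrier C"
    then obtain a where a: "coherent a" "x = mk a" unfolding C_carrier by blast
    show "\<zero>\<^bsub>C\<^esub> \<oplus>\<^bsub>C\<^esub> x = x" unfolding mk_zero a(2) using a(1) coherent_closed[OF a(1)]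
      by (simp add: mk_add coherent_const)
    have "mk (\<lambda>n. \<ominus> a n) \<oplus>\<^bsub>C\<^esub> x = \<zero>\<^bsub>C\<^esub>" unfolding mk_zero a(2) using a(1) coherent_closed[OF a(1)]
      by (simp add: mk_add coherent_minus l_neg)
    then show "\<exists>z\<in>carrier C. z \<oplus>\<^bsub>C\<^esub> x = \<zero>\<^bsub>C\<^esub>" using mk_closed[OF coherent_minus[OF a(1)]] by blast
    fix z assume "z \<in> carrier C"
    then obtain b where b: "coherent b" "z = mk b" unfolding C_carrier by blast
    show "x \<oplus>\<^bsub>C\<^esub> z \<in> carrier C" unfolding a b using a b by (simp add: mk_add mk_closed coherent_add)
    show "x \<oplus>\<^bsub>C\<^esub> z = z \<oplus>\<^bsub>C\<^esub> x" unfolding a b using a b coherent_closed by (simp add: mk_add a_comm)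
    fix w assume "w \<in> carrier C"
    then obtain c where c: "coherent c" "w = mk c" unfolding C_carrier by blast
    show "x \<oplus>\<^bsub>C\<^esub> z \<oplus>\<^bsub>C\<^esub> w = x \<oplus>\<^bsub>C\<^esub> (z \<oplus>\<^bsub>C\<^esub> w)" unfolding a b c using a b c coherent_closed
      by (simp add: mk_add coherent_add a_assoc)
  qed
  show "comm_monoid C"
  proof (rule comm_monoidI)
    show "\<one>\<^bsub>C\<^esub> \<in> carrier C" unfolding mk_one by (intro mk_closed coherent_const) simp
    fix x assume "x \<in> carrier C"
    then obtain a where a: "coherent a" "x = mk a" unfolding C_carrier by blast
    show "\<one>\<^bsub>C\<^esub> \<otimes>\<^bsub>C\<^esub> x = x" unfolding mk_one a(2) using a(1) coherent_closed[OF a(1)]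
      by (simp add: mk_mult coherent_const)
    fix z assume "z \<in> carrier C"
    then obtain b where b: "coherent b" "z = mk b" unfolding C_carrier by blast
    show "x \<otimes>\<^bsub>C\<^esub> z \<in> carrier C" unfolding a b using a b by (simp add: mk_mult mk_closed coherent_mult)
    show "x \<otimes>\<^bsub>C\<^esub> z = z \<otimes>\<^bsub>C\<^esub> x" unfolding a b using a b coherent_closed by (simp add: mk_mult m_comm)
    fix w assume "w \<in> carrier C"
    then obtain c where c: "coherent c" "w = mk c" unfolding C_carrier by blast
    show "x \<otimes>\<^bsub>C\<^esub> z \<otimes>\<^bsub>C\<^esub> w = x \<otimes>\<^bsub>C\<^esub> (z \<otimes>\<^bsub>C\<^esub> w)" unfolding a b c using a b c coherent_closed
      by (simp add: mk_mult coherent_mult m_assoc)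
  qed
  fix x z w assume "x \<in> carrier C" "z \<in> carrier C" "w \<in> carrier C"
  then obtain a b c where "coherent a" "x = mk a" "coherent b" "z = mk b" "coherent c" "w = mk c"
    unfolding C_carrier by blast
  then show "(x \<oplus>\<^bsub>C\<^esub> z) \<otimes>\<^bsub>C\<^esub> w = x \<otimes>\<^bsub>C\<^esub> w \<oplus>\<^bsub>C\<^esub> z \<otimes>\<^bsub>C\<^esub> w"
    using coherent_closed by (simp add: mk_mult mk_add coherent_mult coherent_add l_distr)
qed

sublocale C: cring C by (rule C_cring)

section \<open>Density, separation, purity and completeness of the adic completion\<close>

definition \<kappa> :: "'a \<Rightarrow> (nat \<Rightarrow> 'a set)" where
  "\<kappa> = y_completion_map R y"

lemma \<kappa>_mk: "\<kappa> r = mk (\<lambda>n. r)"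
  unfolding \<kappa>_def y_completion_map_def completion_map_def mk_def by simp

lemma \<kappa>_hom: "\<kappa> \<in> ring_hom R C"
  by (rule ring_hom_memI) (auto simp: \<kappa>_mk mk_mult mk_add mk_one coherent_const mk_closed)

lemma \<kappa>_closed [simp]: "r \<in> carrier R \<Longrightarrow> \<kappa> r \<in> carrier C"
  using ring_hom_memE(1)[OF \<kappa>_hom] .

lemma \<kappa>_pow: "\<kappa> y [^]\<^bsub>C\<^esub> (n::nat) = \<kappa> (pw n)"
  by (rule ring_hom_pow[OF ring_axioms C.ring_axioms \<kappa>_hom y_closed, symmetric])

lemma pow_mk: "coherent a \<Longrightarrow> \<kappa> y [^]\<^bsub>C\<^esub> (N::nat) \<otimes>\<^bsub>C\<^esub> mk a = mk (\<lambda>n. pw N \<otimes> a n)"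
  unfolding \<kappa>_pow unfolding \<kappa>_mk by (rule mk_mult) (simp_all add: coherent_const)

text \<open>The differences of \<open>a (N + n)\<close> and \<open>a N\<close> are multiples of
  \<open>y^N\<close>, and the quotients form a coherent sequence because \<open>y^N\<close> cancels
  in the domain \<open>R\<close>.\<close>

lemma C_dense_mk:
  assumes a: "coherent a"
  shows "\<exists>z\<in>carrier C. mk a = \<kappa> (a N) \<oplus>\<^bsub>C\<^esub> \<kappa> y [^]\<^bsub>C\<^esub> (N::nat) \<otimes>\<^bsub>C\<^esub> z"
proof -
  have "\<exists>b\<in>carrier R. a (N + n) = a N \<oplus> pw N \<otimes> b" for n
    using coherent_near[OF a, of N n] unfolding near_def by blast
  then obtain b where b: "\<And>n. b n \<in> carrier R" "\<And>n. a (N + n) = a N \<oplus> pw N \<otimes> b n" by metis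
  have aC: "a n \<in> carrier R" for n using coherent_closed[OF a] .
  have "near n (b (Suc n)) (b n)" for n
  proof -
    \<comment> \<open>The order \<open>N + n\<close> is required because cancelling
      \<open>y^N\<close> uses up \<open>N\<close> of it.\<close>
    have "near (N + n) (a (Suc (N + n))) (a (N + n))" using a unfolding coherent_def by blast
    then obtain d where d: "d \<in> carrier R" "a (N + Suc n) = a (N + n) \<oplus> pw (N + n) \<otimes> d"
      unfolding near_def by auto
    define p q where "p = pw N" "q = pw n"
    have pq: "p \<in> carrier R" "q \<in> carrier R" unfolding p_q_def by auto
    have "a N \<oplus> p \<otimes> b (Suc n) = a N \<oplus> p \<otimes> b n \<oplus> (p \<otimes> q) \<otimes> d"
      using d(2) unfolding b(2) p_q_def by (simp add: nat_pow_mult)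
    also have "\<dots> = a N \<oplus> p \<otimes> (b n \<oplus> q \<otimes> d)" using pq b(1)[of n] d(1) aC[of N] by algebra
    finally have e: "a N \<oplus> p \<otimes> b (Suc n) = a N \<oplus> p \<otimes> (b n \<oplus> q \<otimes> d)" .
    have cl: "b (Suc n) \<in> carrier R" "b n \<oplus> q \<otimes> d \<in> carrier R" using pq b(1) d(1) by auto
    then have "p \<otimes> b (Suc n) = p \<otimes> (b n \<oplus> q \<otimes> d)"
      using add.l_cancel[OF e] pq aC by simp
    then have "b (Suc n) = b n \<oplus> q \<otimes> d" unfolding p_q_def(1) by (rule pw_cancel[OF cl])
    then show ?thesis unfolding near_def p_q_def using d(1) by blast
  qed
  then have bc: "coherent b" unfolding coherent_def using b(1) by blast
  have "mk a = mk (\<lambda>n. a N \<oplus> pw N \<otimes> b n)"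
  proof (subst mk_eq[OF a])
    show "coherent (\<lambda>n. a N \<oplus> pw N \<otimes> b n)"
      by (rule coherent_add[OF coherent_const[OF aC] coherent_mult[OF coherent_const bc]]) simp
    show "\<forall>n. near n (a n) (a N \<oplus> pw N \<otimes> b n)"
    proof
      fix n
      have "near n (a (N + n)) (a n)" using coherent_near[OF a, of n N] by (simp add: add.commute)
      then show "near n (a n) (a N \<oplus> pw N \<otimes> b n)" unfolding b(2)[symmetric] by (rule near_sym) (rule aC)
    qed
  qed
  also have "\<dots> = \<kappa> (a N) \<oplus>\<^bsub>C\<^esub> \<kappa> y [^]\<^bsub>C\<^esub> N \<otimes>\<^bsub>C\<^esub> mk b"
    unfolding pow_mk[OF bc] unfolding \<kappa>_mk
    by (rule mk_add[symmetric, OF coherent_const[OF aC] coherent_mult[OF coherent_const bc]]) simp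
  finally show ?thesis using mk_closed[OF bc] by blast
qed

lemma C_dense: "c \<in> carrier C \<Longrightarrow> \<exists>r\<in>\<kappa> ` carrier R. \<exists>z\<in>carrier C. c = r \<oplus>\<^bsub>C\<^esub> \<kappa> y [^]\<^bsub>C\<^esub> (n::nat) \<otimes>\<^bsub>C\<^esub> z"
proof -
  assume "c \<in> carrier C"
  then obtain a where a: "coherent a" "c = mk a" unfolding C_carrier by blast
  have "\<kappa> (a n) \<in> \<kappa> ` carrier R" using coherent_closed[OF a(1)] by blast
  with C_dense_mk[OF a(1), of n] show ?thesis unfolding a(2) by (rule bexI)
qed

lemma C_divisible:
  assumes a: "coherent a" and "near N (a N) \<zero>"
  shows "\<exists>z\<in>carrier C. mk a = \<kappa> y [^]\<^bsub>C\<^esub> (N::nat) \<otimes>\<^bsub>C\<^esub> z"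
proof -
  obtain z where z: "z \<in> carrier C" "mk a = \<kappa> (a N) \<oplus>\<^bsub>C\<^esub> \<kappa> y [^]\<^bsub>C\<^esub> N \<otimes>\<^bsub>C\<^esub> z" using C_dense_mk[OF a] by blast
  obtain d where d: "d \<in> carrier R" "a N = pw N \<otimes> d" using assms(2) unfolding near_def by auto
  have "\<kappa> (a N) = \<kappa> y [^]\<^bsub>C\<^esub> N \<otimes>\<^bsub>C\<^esub> \<kappa> d" unfolding d(2) \<kappa>_pow using d(1) by (simp add: ring_hom_mult[OF \<kappa>_hom])
  then have "mk a = \<kappa> y [^]\<^bsub>C\<^esub> N \<otimes>\<^bsub>C\<^esub> (\<kappa> d \<oplus>\<^bsub>C\<^esub> z)" using z d(1) by (simp add: C.r_distr)
  then show ?thesis by (rule bexI[of _ "\<kappa> d \<oplus>\<^bsub>C\<^esub> z"]) (use z(1) d(1) in simp)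
qed

lemma C_separated:
  assumes "c \<in> carrier C" and "\<And>n::nat. \<exists>z\<in>carrier C. c = \<kappa> y [^]\<^bsub>C\<^esub> n \<otimes>\<^bsub>C\<^esub> z"
  shows "c = \<zero>\<^bsub>C\<^esub>"
proof -
  obtain a where a: "coherent a" "c = mk a" using assms(1) unfolding C_carrier by blast
  have "near n (a n) \<zero>" for n
  proof -
    from assms(2)[of n] obtain z where z: "z \<in> carrier C" "c = \<kappa> y [^]\<^bsub>C\<^esub> n \<otimes>\<^bsub>C\<^esub> z" ..
    then obtain b where "coherent b" "z = mk b" unfolding C_carrier by blast
    with z pow_mk[of b n] have b: "coherent b" "c = mk (\<lambda>k. pw n \<otimes> b k)" by simp_all
    have "coherent (\<lambda>k. pw n \<otimes> b k)" by (rule coherent_mult[OF coherent_const b(1)]) simp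
    then have "near n (a n) (pw n \<otimes> b n)" using a b mk_eq by metis
    moreover have "near n (pw n \<otimes> b n) \<zero>" unfolding near_def using coherent_closed[OF b(1)] by auto
    ultimately show ?thesis using near_trans by blast
  qed
  then show ?thesis unfolding a(2) mk_zero using mk_eq[OF a(1) coherent_const] by simp
qed

text \<open>Cancelling \<open>y\<close> costs one order of precision, so the entry at
  \<open>n\<close> is controlled through the entry at \<open>Suc n\<close>.\<close>

lemma C_cancel:
  assumes "c \<in> carrier C" "\<kappa> y \<otimes>\<^bsub>C\<^esub> c = \<zero>\<^bsub>C\<^esub>"
  shows "c = \<zero>\<^bsub>C\<^esub>"
proof -
  obtain a where a: "coherent a" "c = mk a" using assms(1) unfolding C_carrier by blast
  have aC: "a n \<in> carrier R" for n using coherent_closed[OF a(1)] .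
  have co: "coherent (\<lambda>n. y \<otimes> a n)" by (rule coherent_mult[OF coherent_const a(1)]) simp
  have "mk (\<lambda>n. y \<otimes> a n) = mk (\<lambda>n. \<zero>)"
    using assms(2) pow_mk[OF a(1), of 1] unfolding a(2) mk_zero by simp
  then have n0: "near n (y \<otimes> a n) \<zero>" for n using mk_eq[OF co coherent_const] by simp
  have "near n (a n) \<zero>" for n
  proof -
    obtain d where d: "d \<in> carrier R" "y \<otimes> a (Suc n) = pw (Suc n) \<otimes> d"
      using n0[of "Suc n"] unfolding near_def by auto
    then have "pw 1 \<otimes> a (Suc n) = pw 1 \<otimes> (pw n \<otimes> d)" by (simp add: m_ac)
    then have "a (Suc n) = pw n \<otimes> d" using pw_cancel[of "a (Suc n)" "pw n \<otimes> d" 1] aC d(1) by simp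
    then have "near n (a (Suc n)) \<zero>" unfolding near_def using d(1) by auto
    moreover have "near n (a n) (a (Suc n))" using near_sym aC a(1) unfolding coherent_def by blast
    ultimately show ?thesis using near_trans by blast
  qed
  then show ?thesis unfolding a(2) mk_zero using mk_eq[OF a(1) coherent_const] by simp
qed

lemma C_pow_cancel: "c \<in> carrier C \<Longrightarrow> \<kappa> y [^]\<^bsub>C\<^esub> (n::nat) \<otimes>\<^bsub>C\<^esub> c = \<zero>\<^bsub>C\<^esub> \<Longrightarrow> c = \<zero>\<^bsub>C\<^esub>"
  by (rule C.pow_cancel[OF \<kappa>_closed[OF y_closed]]) (rule C_cancel)

text \<open>Level \<open>N\<close> of the equation already shows that the element of
  \<open>R\<close> is divisible by \<open>y^N\<close> within \<open>R\<close>. The quotient has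
  image \<open>c\<close>, because \<open>y^N\<close> cancels in \<open>C\<close>.\<close>

lemma C_pure:
  assumes "c \<in> carrier C" "\<kappa> y [^]\<^bsub>C\<^esub> (N::nat) \<otimes>\<^bsub>C\<^esub> c \<in> \<kappa> ` carrier R"
  shows "c \<in> \<kappa> ` carrier R"
proof -
  obtain a where a: "coherent a" "c = mk a" using assms(1) unfolding C_carrier by blast
  have aC: "a n \<in> carrier R" for n using coherent_closed[OF a(1)] .
  obtain r where r: "r \<in> carrier R" "\<kappa> y [^]\<^bsub>C\<^esub> N \<otimes>\<^bsub>C\<^esub> c = \<kappa> r" using assms(2) by blast
  have "mk (\<lambda>n. pw N \<otimes> a n) = mk (\<lambda>n. r)" using r(2) pow_mk[OF a(1), of N] \<kappa>_mk[of r] unfolding a(2) by metis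
  moreover have "coherent (\<lambda>n. pw N \<otimes> a n)" by (rule coherent_mult[OF coherent_const a(1)]) simp
  ultimately have "near N (pw N \<otimes> a N) r" using mk_eq coherent_const r(1) by blast
  then have "near N r (pw N \<otimes> a N)" using near_sym r(1) by blast
  then obtain d where d: "d \<in> carrier R" "r = pw N \<otimes> a N \<oplus> pw N \<otimes> d" unfolding near_def by blast
  define s where "s = a N \<oplus> d"
  have s: "s \<in> carrier R" "r = pw N \<otimes> s" unfolding s_def using d aC by (simp_all add: r_distr)
  define p where "p = \<kappa> y [^]\<^bsub>C\<^esub> N"
  have p: "p \<in> carrier C" "\<kappa> s \<in> carrier C" unfolding p_def using s by auto
  have "p \<otimes>\<^bsub>C\<^esub> c = p \<otimes>\<^bsub>C\<^esub> \<kappa> s"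
    using r(2) unfolding s(2) p_def using s(1) by (simp add: \<kappa>_pow ring_hom_mult[OF \<kappa>_hom])
  then have "p \<otimes>\<^bsub>C\<^esub> (c \<ominus>\<^bsub>C\<^esub> \<kappa> s) = p \<otimes>\<^bsub>C\<^esub> \<kappa> s \<ominus>\<^bsub>C\<^esub> p \<otimes>\<^bsub>C\<^esub> \<kappa> s"
    using p assms(1) by (simp add: C.minus_eq C.r_distr C.r_minus)
  also have "\<dots> = \<zero>\<^bsub>C\<^esub>" using p by simp
  finally have "c \<ominus>\<^bsub>C\<^esub> \<kappa> s = \<zero>\<^bsub>C\<^esub>" unfolding p_def
    by (rule C_pow_cancel[rotated]) (use p assms(1) in simp)
  then have "c = \<kappa> s" using p assms(1) by simp
  then show ?thesis using s(1) by blast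
qed

lemma dot_mk:
  assumes "\<forall>i. coherent (a i)" "\<forall>i. coherent (b i)"
  shows "dot C k (\<lambda>i. mk (a i)) (\<lambda>i. mk (b i)) = mk (\<lambda>m. dot R k (\<lambda>i. a i m) (\<lambda>i. b i m)) \<and>
    coherent (\<lambda>m. dot R k (\<lambda>i. a i m) (\<lambda>i. b i m))"
proof (induction k)
  case 0
  show ?case by (simp add: mk_zero coherent_const)
next
  case (Suc k)
  then show ?case using assms by (simp add: mk_mult mk_add coherent_mult coherent_add)
qed

text \<open>With \<open>t k m\<close> the \<open>m\<close>-th entry of the \<open>k\<close>-th
  partial sum, the limit is represented by the diagonal sequence \<open>t n n\<close>.\<close>

lemma C_complete:
  assumes "\<forall>n::nat. c n \<in> carrier C"
  shows "\<exists>s\<in>carrier C. \<forall>n. \<exists>z\<in>carrier C. s = dot C n (\<lambda>i. \<kappa> y [^]\<^bsub>C\<^esub> i) c \<oplus>\<^bsub>C\<^esub> \<kappa> y [^]\<^bsub>C\<^esub> n \<otimes>\<^bsub>C\<^esub> z"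
proof -
  have "\<forall>i. \<exists>a. coherent a \<and> c i = mk a" using assms unfolding C_carrier by blast
  then obtain a where a: "\<forall>i. coherent (a i)" "\<And>i. c i = mk (a i)" by metis
  have aC: "a i n \<in> carrier R" for i n using coherent_closed a(1) by blast
  define t where "t k m = dot R k pw (\<lambda>i. a i m)" for k m
  have tC: "t k m \<in> carrier R" for k m unfolding t_def using aC by simp
  have dt: "dot C k (\<lambda>i. \<kappa> y [^]\<^bsub>C\<^esub> i) c = mk (t k)" and ct: "coherent (t k)" for k
    using dot_mk[of "\<lambda>i n. pw i" a k] a(1) coherent_const unfolding t_def \<kappa>_pow a(2) unfolding \<kappa>_mk by auto
  define s where "s n = t n n" for n
  have tnear: "near n (t k m) (t n m)" if "n \<le> k" for n k m
    using that
  proof (induction rule: dec_induct)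
    case base
    show ?case using near_refl tC by blast
  next
    case (step k)
    have "near k (t (Suc k) m) (t k m)" unfolding near_def t_def using aC by auto
    then have "near n (t (Suc k) m) (t k m)" using near_mono step.hyps by blast
    then show ?case using near_trans[OF _ step.IH tC] by blast
  qed
  have "near n (s (Suc n)) (s n)" for n
  proof -
    have "near n (t (Suc n) (Suc n)) (t n (Suc n))" by (rule tnear) simp
    moreover have "near n (t n (Suc n)) (t n n)" using ct[of n] unfolding coherent_def by blast
    ultimately show ?thesis unfolding s_def using near_trans tC by blast
  qed
  then have s: "coherent s" unfolding coherent_def s_def using tC by blast
  have "\<exists>z\<in>carrier C. mk s = mk (t n) \<oplus>\<^bsub>C\<^esub> \<kappa> y [^]\<^bsub>C\<^esub> n \<otimes>\<^bsub>C\<^esub> z" for n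
  proof -
    define e where "e m = s m \<oplus> \<ominus> t n m" for m
    have e: "coherent e" unfolding e_def by (rule coherent_add[OF s coherent_minus[OF ct]])
    \<comment> \<open>By the choice of the diagonal the \<open>n\<close>-th entry of the difference
      is exactly zero, which is enough for divisibility by \<open>y^n\<close>.\<close>
    have "near n (e n) \<zero>" unfolding e_def s_def using tC by (simp add: r_neg near_refl)
    from C_divisible[OF e this] obtain z where z: "z \<in> carrier C" "mk e = \<kappa> y [^]\<^bsub>C\<^esub> n \<otimes>\<^bsub>C\<^esub> z" by blast
    have "t n m \<oplus> e m = s m" for m
      unfolding e_def using tC[of n m] coherent_closed[OF s, of m] by algebra
    then have "mk s = mk (t n) \<oplus>\<^bsub>C\<^esub> mk e" unfolding mk_add[OF ct e] by simp
    with z(2) have "mk s = mk (t n) \<oplus>\<^bsub>C\<^esub> \<kappa> y [^]\<^bsub>C\<^esub> n \<otimes>\<^bsub>C\<^esub> z" by simp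
    from this z(1) show ?thesis by (rule bexI)
  qed
  then have "\<forall>n. \<exists>z\<in>carrier C. mk s = mk (t n) \<oplus>\<^bsub>C\<^esub> \<kappa> y [^]\<^bsub>C\<^esub> n \<otimes>\<^bsub>C\<^esub> z" by blast
  then show ?thesis unfolding dt by (rule bexI[of _ "mk s"]) (rule mk_closed[OF s])
qed

end

section \<open>Existence of primarily limit-intersecting elements\<close>

text \<open>Generators of the preimage of an ideal map to generators of the ideal. This passes the
  Noetherian property to the copy of \<open>R\<close> inside its completion.\<close>

lemma noetherian_ring_image:
  assumes "noetherian_ring R" "cring R" "cring S" "h \<in> ring_hom R S" "h ` carrier R = carrier S"
  shows "noetherian_ring S"
proof -
  interpret R: noetherian_ring R by fact
  interpret R: cring R by fact
  interpret S: cring S by fact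
  interpret h: ring_hom_ring R S h by (rule ring_hom_ringI2) (rule R.ring_axioms S.ring_axioms assms(4))+
  show ?thesis
  proof (rule S.noetherian_ringI)
    fix J assume J: "ideal J S"
    interpret J: ideal J S by fact
    define J' where "J' = {r \<in> carrier R. h r \<in> J}"
    have "ideal J' R" unfolding J'_def by (rule h.ideal_vimage[OF J])
    from R.ideal_eq_dot_span[OF R.is_cring this] obtain k f
      where f: "\<forall>i. f i \<in> carrier R" "J' = dot_span R k f" "\<forall>i. f i \<in> J'" .
    have hf: "\<forall>i. h (f i) \<in> carrier S" using f(1) by simp
    have "J \<subseteq> dot_span S k (\<lambda>i. h (f i))"
    proof
      fix x assume x: "x \<in> J"
      then have "x \<in> h ` carrier R" using J.Icarr assms(5) by blast
      then obtain r where r: "r \<in> carrier R" "x = h r" by blast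
      then have "r \<in> J'" using x unfolding J'_def by blast
      then obtain g where g: "\<forall>i. g i \<in> carrier R" "r = dot R k f g" unfolding f(2) dot_span_def by blast
      have "x = dot S k (\<lambda>i. h (f i)) (\<lambda>i. h (g i))"
        unfolding r(2) g(2) by (rule ring_hom_dot[OF R.ring_axioms S.ring_axioms assms(4) f(1) g(1)])
      moreover have "\<forall>i. h (g i) \<in> carrier S" using g(1) by simp
      ultimately show "x \<in> dot_span S k (\<lambda>i. h (f i))" unfolding dot_span_def by blast
    qed
    moreover have "dot_span S k (\<lambda>i. h (f i)) \<subseteq> J"
      unfolding S.dot_span_eq_genideal[OF hf]
      by (rule S.genideal_minimal[OF J]) (use f(3) J'_def in auto)
    ultimately have "J = Idl\<^bsub>S\<^esub> ((\<lambda>i. h (f i)) ` {..<k})" unfolding S.dot_span_eq_genideal[OF hf] by (rule subset_antisym)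
    then show "\<exists>A\<subseteq>carrier S. finite A \<and> J = Idl\<^bsub>S\<^esub> A"
      using hf by (intro exI[of _ "(\<lambda>i. h (f i)) ` {..<k}"]) auto
  qed
qed

text \<open>A nonunit of this form lies in some maximal ideal, hence in \<open>m\<close>, and
  \<open>y\<close> in \<open>m\<close> then forces one into \<open>m\<close>. Zorn's lemma provides
  the maximal ideal; chains are bounded since in a Noetherian ring they contain their union.\<close>

lemma (in cring) local_one_minus_unit:
  assumes "noetherian_ring R" "local_ring R m" "y \<in> m" "r \<in> carrier R"
  shows "\<exists>u\<in>carrier R. u \<otimes> (\<one> \<ominus> y \<otimes> r) = \<one>"
proof (rule ccontr)
  assume nu: "\<not> ?thesis"
  interpret N: noetherian_ring R by fact
  have m: "maximalideal m R" "\<And>n. maximalideal n R \<Longrightarrow> n = m" using assms(2) unfolding local_ring_def by auto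
  interpret m: maximalideal m R by fact
  have y: "y \<in> carrier R" using assms(3) m.Icarr by blast
  define u where "u = \<one> \<ominus> y \<otimes> r"
  have u: "u \<in> carrier R" unfolding u_def using y assms(4) by simp
  define \<A> where "\<A> = {I. ideal I R \<and> u \<in> I \<and> \<one> \<notin> I}"
  have "PIdl u \<in> \<A>" unfolding \<A>_def
    using cgenideal_ideal[OF u] cgenideal_self[OF u] nu unfolding u_def[symmetric] cgenideal_def by auto
  then have "\<A> \<noteq> {}" by blast
  moreover have "\<Union>\<C> \<in> \<A>" if "\<C> \<noteq> {}" "subset.chain \<A> \<C>" for \<C>
  proof -
    have "subset.chain {I. ideal I R} \<C>" using that(2) unfolding pred_on.chain_def \<A>_def by blast
    then have "\<Union>\<C> \<in> \<C>" using N.ideal_chain_is_trivial that(1) by blast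
    then show ?thesis using that(2) unfolding pred_on.chain_def by blast
  qed
  ultimately obtain M where M: "M \<in> \<A>" "\<forall>Z\<in>\<A>. M \<subseteq> Z \<longrightarrow> Z = M"
    using subset_Zorn_nonempty[of \<A>] by blast
  have MI: "ideal M R" "u \<in> M" "\<one> \<notin> M" using M(1) unfolding \<A>_def by auto
  have "maximalideal M R"
  proof (rule maximalidealI)
    show "carrier R \<noteq> M" using MI(3) by auto
    fix J assume J: "ideal J R" "M \<subseteq> J" "J \<subseteq> carrier R"
    show "J = M \<or> J = carrier R"
    proof (cases "\<one> \<in> J")
      case True
      then show ?thesis using ideal.one_imp_carrier[OF J(1)] by blast
    next
      case False
      then have "J \<in> \<A>" unfolding \<A>_def using J MI by blast
      then show ?thesis using M(2) J(2) by blast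
    qed
  qed (rule MI(1))
  then have um: "u \<in> m" using m(2) MI(2) by blast
  have "y \<otimes> r \<in> m" using assms(3,4) m.I_r_closed by blast
  then have "u \<oplus> y \<otimes> r \<in> m" using um m.a_closed by blast
  moreover have "u \<oplus> y \<otimes> r = \<one>" unfolding u_def using y assms(4) by (simp add: minus_eq a_assoc l_neg)
  ultimately show False using m.I_notcarr ideal.one_imp_carrier[OF m.ideal_axioms] by simp
qed

section \<open>The image of the base ring and its polynomial ring\<close>

locale local_y_adic = y_adic R y + noetherian_ring R for R (structure) and y +
  assumes one_minus_unit: "r \<in> carrier R \<Longrightarrow> \<exists>u\<in>carrier R. u \<otimes> (\<one> \<ominus> y \<otimes> r) = \<one>"
    and countable_carrier: "countable (carrier R)"
begin

text \<open>Krull's intersection theorem for \<open>(y)\<close>. If \<open>r = y^n a n\<close> for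
  all \<open>n\<close>, the ideals \<open>(a n)\<close> increase; once two consecutive ones agree,
  \<open>a (Suc n)\<close> is \<open>y v\<close> times itself and vanishes because
  \<open>1 - y v\<close> is a unit.\<close>

lemma \<kappa>_inj: "inj_on \<kappa> (carrier R)"
proof -
  have zero: "r = \<zero>" if r: "r \<in> carrier R" "\<kappa> r = \<zero>\<^bsub>C\<^esub>" for r
  proof -
    have "near n r \<zero>" for n
      using r(2) mk_eq[OF coherent_const[OF r(1)] coherent_const[of \<zero>]] unfolding \<kappa>_mk mk_zero by simp
    then have "\<exists>a\<in>carrier R. r = pw n \<otimes> a" for n unfolding near_def by force
    then obtain a where a: "\<And>n. a n \<in> carrier R" "\<And>n. r = pw n \<otimes> a n" by metis
    have aS: "a n = y \<otimes> a (Suc n)" for n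
    proof (rule pw_cancel[of _ _ n])
      have "pw n \<otimes> a n = pw (Suc n) \<otimes> a (Suc n)" using a(2) by metis
      then show "pw n \<otimes> a n = pw n \<otimes> (y \<otimes> a (Suc n))" using a(1) by (simp add: m_assoc)
    qed (use a(1) in simp_all)
    have sub: "PIdl (a n) \<subseteq> PIdl (a (Suc n))" for n
    proof (rule cgenideal_minimal[OF cgenideal_ideal[OF a(1)]])
      show "a n \<in> PIdl (a (Suc n))" unfolding cgenideal_def aS[of n] by auto
    qed
    obtain n where n: "\<forall>m\<ge>n. PIdl (a m) = PIdl (a n)"
      using ideal_sequence_stationary[of "\<lambda>n. PIdl (a n)", OF cgenideal_ideal[OF a(1)] sub] by blast
    have "a (Suc n) \<in> PIdl (a n)" using n[rule_format, of "Suc n"] cgenideal_self[OF a(1)] by auto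
    then obtain v where v: "v \<in> carrier R" "a (Suc n) = v \<otimes> a n" unfolding cgenideal_def by auto
    obtain u where u: "u \<in> carrier R" "u \<otimes> (\<one> \<ominus> y \<otimes> v) = \<one>" using one_minus_unit[OF v(1)] by blast
    define b where "b = a (Suc n)"
    have b: "b \<in> carrier R" "b = v \<otimes> (y \<otimes> b)" unfolding b_def using a(1) v(2) aS[of n] by auto
    have "b = (u \<otimes> (\<one> \<ominus> y \<otimes> v)) \<otimes> b" unfolding u(2) using b(1) by simp
    also have "\<dots> = u \<otimes> (b \<ominus> v \<otimes> (y \<otimes> b))" using u(1) v(1) b(1) y_closed by algebra
    also have "\<dots> = \<zero>" unfolding b(2)[symmetric] using u(1) b(1) by (simp add: minus_eq r_neg)
    finally have "a (Suc n) = \<zero>" unfolding b_def .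
    then show ?thesis using a(2)[of "Suc n"] by simp
  qed
  interpret h: ring_hom_ring R C \<kappa> by (rule ring_hom_ringI2[OF ring_axioms C.ring_axioms \<kappa>_hom])
  show ?thesis
  proof (rule inj_onI)
    fix r s assume rs: "r \<in> carrier R" "s \<in> carrier R" "\<kappa> r = \<kappa> s"
    then have "\<kappa> (r \<ominus> s) = \<zero>\<^bsub>C\<^esub>" by (simp add: minus_eq C.r_neg)
    then have "r \<ominus> s = \<zero>" using zero rs by simp
    then show "r = s" using rs by simp
  qed
qed

definition K :: "(nat \<Rightarrow> 'a set) set" where "K = \<kappa> ` carrier R"

abbreviation "KR \<equiv> C\<lparr>carrier := K\<rparr>"

lemma K_subring: "subring K C"
proof -
  interpret h: ring_hom_ring R C \<kappa> by (rule ring_hom_ringI2[OF ring_axioms C.ring_axioms \<kappa>_hom])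
  show ?thesis unfolding K_def by (rule h.img_is_subring[OF carrier_is_subring])
qed

lemma K_sub: "K \<subseteq> carrier C"
  by (rule subringE(1)[OF K_subring])

lemma K_cring: "cring KR"
  by (rule C.subcring_iff[THEN iffD1, OF _ C.subcringI'[OF K_subring]]) (rule K_sub)

lemma \<kappa>_hom_K: "\<kappa> \<in> ring_hom R KR"
  using \<kappa>_hom unfolding ring_hom_def K_def by auto

lemma \<kappa>_zero: "\<kappa> \<zero> = \<zero>\<^bsub>C\<^esub>"
  by (simp add: \<kappa>_mk mk_zero)

lemma K_domain: "domain KR"
proof (rule domainI)
  show "cring KR" by (rule K_cring)
  have "\<kappa> \<one> \<noteq> \<kappa> \<zero>" using inj_onD[OF \<kappa>_inj, of \<one> \<zero>] one_not_zero by auto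
  then show "\<one>\<^bsub>KR\<^esub> \<noteq> \<zero>\<^bsub>KR\<^esub>" using ring_hom_one[OF \<kappa>_hom] \<kappa>_zero by simp
  fix a b assume ab: "a \<otimes>\<^bsub>KR\<^esub> b = \<zero>\<^bsub>KR\<^esub>" "a \<in> carrier KR" "b \<in> carrier KR"
  then obtain r s where rs: "r \<in> carrier R" "s \<in> carrier R" "a = \<kappa> r" "b = \<kappa> s" unfolding K_def by auto
  then have "\<kappa> (r \<otimes> s) = \<kappa> \<zero>" using ab(1) \<kappa>_zero by (simp add: ring_hom_mult[OF \<kappa>_hom])
  then have "r \<otimes> s = \<zero>" using inj_onD[OF \<kappa>_inj] rs by simp
  then have "r = \<zero> \<or> s = \<zero>" using integral rs by blast
  then show "a = \<zero>\<^bsub>KR\<^esub> \<or> b = \<zero>\<^bsub>KR\<^esub>" using rs \<kappa>_zero by auto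
qed

abbreviation "P \<equiv> K[X]\<^bsub>KR\<^esub>"

definition ev :: "(nat \<Rightarrow> 'a set) \<Rightarrow> (nat \<Rightarrow> 'a set) list \<Rightarrow> (nat \<Rightarrow> 'a set)" where
  "ev a p = C.eval p a"

text \<open>Allows results about polynomials over the domain \<open>KR\<close> to be combined with
  evaluation in the larger ring \<open>C\<close>.\<close>

lemma P_eq: "P = K[X]\<^bsub>C\<^esub>"
  using C.univ_poly_consistent[OF K_subring] by simp

lemma P_sub: "p \<in> carrier P \<Longrightarrow> set p \<subseteq> K"
  unfolding P_eq univ_poly_carrier[symmetric] polynomial_def by auto

lemma ev_hom:
  assumes a: "a \<in> carrier C"
  shows "ev a \<in> ring_hom P C"
proof -
  have s: "set p \<subseteq> carrier C" if "p \<in> carrier P" for p using P_sub[OF that] K_sub by blast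
  show ?thesis unfolding ev_def
  proof (rule ring_hom_memI)
    fix p q assume p: "p \<in> carrier P" and q: "q \<in> carrier P"
    show "C.eval p a \<in> carrier C" by (rule C.eval_in_carrier[OF s[OF p] a])
    show "C.eval (p \<otimes>\<^bsub>P\<^esub> q) a = C.eval p a \<otimes>\<^bsub>C\<^esub> C.eval q a"
      unfolding P_eq univ_poly_mult by (rule C.eval_poly_mult[OF s[OF p] s[OF q] a])
    show "C.eval (p \<oplus>\<^bsub>P\<^esub> q) a = C.eval p a \<oplus>\<^bsub>C\<^esub> C.eval q a"
      unfolding P_eq univ_poly_add by (rule C.eval_poly_add[OF s[OF p] s[OF q] a])
  next
    show "C.eval \<one>\<^bsub>P\<^esub> a = \<one>\<^bsub>C\<^esub>" unfolding P_eq univ_poly_one using a by simp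
  qed
qed

lemma ev_K: "ev t p \<in> K" if "t \<in> K" "p \<in> carrier P"
proof -
  interpret KR: domain KR by (rule K_domain)
  have "KR.eval p t \<in> carrier KR" by (rule KR.eval_in_carrier) (use P_sub that in auto)
  then show ?thesis unfolding ev_def C.eval_consistent[OF K_subring] by simp
qed

sublocale spec: specialization C P K "\<kappa> y" "X\<^bsub>KR\<^esub>" "ring.poly_of_const KR" ev
proof -
  interpret KR: domain KR by (rule K_domain)
  interpret PD: domain P using KR.univ_poly_is_domain[OF KR.carrier_is_subring] by simp
  have KN: "noetherian_ring KR"
    by (rule noetherian_ring_image[OF noetherian_ring_axioms is_cring K_cring \<kappa>_hom_K]) (simp add: K_def)
  interpret PN: noetherian_ring P using KR.Hilbert_basis[OF KN] by simp
  have ev_eq: "ev t p = KR.eval p t" for t p unfolding ev_def C.eval_consistent[OF K_subring] ..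
  show "specialization C P K (\<kappa> y) X\<^bsub>KR\<^esub> KR.poly_of_const ev"
  proof (intro specialization.intro specialization_axioms.intro)
    show "cring C" "cring P" "noetherian_ring P" by unfold_locales
    show "subring K C" by (rule K_subring)
    show "noetherian_ring KR" by (rule KN)
    show "KR.poly_of_const \<in> ring_hom KR P"
      using KR.canonical_embedding_is_hom[OF KR.carrier_is_subring] by simp
    show "ev a \<in> ring_hom P C" if "a \<in> carrier C" for a by (rule ev_hom[OF that])
    show "ev t p \<in> K" if "t \<in> K" "p \<in> carrier P" for t p by (rule ev_K[OF that])
    show "ev a (KR.poly_of_const r) = r" if "a \<in> carrier C" "r \<in> K" for a r
      unfolding ev_def KR.poly_of_const_def using that K_sub by auto
    show "X\<^bsub>KR\<^esub> \<in> carrier P" using KR.var_closed(1)[OF KR.carrier_is_subring] by simp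
    show "ev a X\<^bsub>KR\<^esub> = a" if "a \<in> carrier C" for a
      unfolding ev_def var_def using that by simp
    show "\<exists>g\<in>carrier P. p = KR.poly_of_const (ev t p) \<oplus>\<^bsub>P\<^esub> (X\<^bsub>KR\<^esub> \<ominus>\<^bsub>P\<^esub> KR.poly_of_const t) \<otimes>\<^bsub>P\<^esub> g"
      if "t \<in> K" "p \<in> carrier P" for t p
      unfolding ev_eq using KR.univ_poly_linear_division[of t p] that by simp
    show "\<kappa> y \<in> K" unfolding K_def by simp
    show "\<exists>u\<in>K. u \<otimes>\<^bsub>C\<^esub> (\<one>\<^bsub>C\<^esub> \<ominus>\<^bsub>C\<^esub> \<kappa> y \<otimes>\<^bsub>C\<^esub> r) = \<one>\<^bsub>C\<^esub>" if rK: "r \<in> K" for r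
    proof -
      obtain s where s: "s \<in> carrier R" "r = \<kappa> s" using rK unfolding K_def by blast
      obtain u where u: "u \<in> carrier R" "u \<otimes> (\<one> \<ominus> y \<otimes> s) = \<one>" using one_minus_unit[OF s(1)] by blast
      interpret h: ring_hom_ring R C \<kappa> by (rule ring_hom_ringI2[OF ring_axioms C.ring_axioms \<kappa>_hom])
      have "\<kappa> u \<otimes>\<^bsub>C\<^esub> (\<one>\<^bsub>C\<^esub> \<ominus>\<^bsub>C\<^esub> \<kappa> y \<otimes>\<^bsub>C\<^esub> r) = \<kappa> (u \<otimes> (\<one> \<ominus> y \<otimes> s))"
        using u(1) s by (simp add: minus_eq C.minus_eq)
      then show ?thesis unfolding u(2) using u(1) K_def by auto
    qed
    show "c = \<zero>\<^bsub>C\<^esub>" if "c \<in> carrier C" "\<kappa> y \<otimes>\<^bsub>C\<^esub> c = \<zero>\<^bsub>C\<^esub>" for c by (rule C_cancel[OF that])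
    show "c \<in> K" if "c \<in> carrier C" "\<kappa> y [^]\<^bsub>C\<^esub> (n::nat) \<otimes>\<^bsub>C\<^esub> c \<in> K" for c n
      using C_pure[OF that(1)] that(2) unfolding K_def by blast
    show "\<exists>r\<in>K. \<exists>z\<in>carrier C. c = r \<oplus>\<^bsub>C\<^esub> \<kappa> y [^]\<^bsub>C\<^esub> (n::nat) \<otimes>\<^bsub>C\<^esub> z" if "c \<in> carrier C" for c n
      unfolding K_def by (rule C_dense[OF that])
    show "c = \<zero>\<^bsub>C\<^esub>" if "c \<in> carrier C" "\<And>n::nat. \<exists>z\<in>carrier C. c = \<kappa> y [^]\<^bsub>C\<^esub> n \<otimes>\<^bsub>C\<^esub> z" for c
      by (rule C_separated[OF that])
    show "\<exists>s\<in>carrier C. \<forall>n. \<exists>z\<in>carrier C. s = dot C n (\<lambda>i. \<kappa> y [^]\<^bsub>C\<^esub> i) c \<oplus>\<^bsub>C\<^esub> \<kappa> y [^]\<^bsub>C\<^esub> n \<otimes>\<^bsub>C\<^esub> z"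
      if "\<forall>n::nat. c n \<in> carrier C" for c by (rule C_complete[OF that])
  qed
qed

lemma P_domain: "domain P"
proof -
  interpret KR: domain KR by (rule K_domain)
  show ?thesis using KR.univ_poly_is_domain[OF KR.carrier_is_subring] by simp
qed

lemma P_countable: "countable (carrier P)"
proof -
  have "carrier P \<subseteq> lists K" unfolding lists_eq_set using P_sub by blast
  moreover have "countable (lists K)" unfolding K_def using countable_carrier by simp
  ultimately show ?thesis by (rule countable_subset)
qed

text \<open>Presents \<open>R[\<tau>]\<close> as the set of values at \<open>\<tau>\<close>, so that
  coefficients of linear relations can be lifted to \<open>P\<close>.\<close>

lemma generate_ring_eq:
  assumes \<tau>: "\<tau> \<in> carrier C"
  shows "generate_ring C (K \<union> {\<tau>}) = ev \<tau> ` carrier P"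
proof
  interpret h: ring_hom_ring P C "ev \<tau>"
    by (rule ring_hom_ringI2[OF spec.P.ring_axioms C.ring_axioms ev_hom[OF \<tau>]])
  have KT: "K \<union> {\<tau>} \<subseteq> carrier C" using K_sub \<tau> by blast
  have sub: "subring (ev \<tau> ` carrier P) C" by (rule h.img_is_subring[OF spec.P.carrier_is_subring])
  have "K \<union> {\<tau>} \<subseteq> ev \<tau> ` carrier P"
  proof
    fix x assume "x \<in> K \<union> {\<tau>}"
    then show "x \<in> ev \<tau> ` carrier P"
    proof
      assume "x \<in> K"
      then show ?thesis
        by (intro image_eqI[of _ _ "ring.poly_of_const KR x"] spec.ev_cst[OF \<tau>, symmetric] spec.cst_closed)
    next
      assume "x \<in> {\<tau>}"
      then have "x = ev \<tau> X\<^bsub>KR\<^esub>" using spec.ev_V[OF \<tau>] by simp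
      then show ?thesis by (rule image_eqI) (rule spec.V_closed)
    qed
  qed
  then show "generate_ring C (K \<union> {\<tau>}) \<subseteq> ev \<tau> ` carrier P"
    by (rule C.generate_ring_min_subring1[OF KT sub])
  have gs: "subring (generate_ring C (K \<union> {\<tau>})) C" by (rule C.generate_ring_is_subring[OF KT])
  have inc: "x \<in> generate_ring C (K \<union> {\<tau>})" if "x \<in> K \<union> {\<tau>}" for x by (rule generate_ring.incl[OF that])
  have pow: "\<tau> [^]\<^bsub>C\<^esub> (n::nat) \<in> generate_ring C (K \<union> {\<tau>})" for n
    by (induction n) (use subringE(3,6)[OF gs] inc in auto)
  have "C.eval p \<tau> \<in> generate_ring C (K \<union> {\<tau>})" if "set p \<subseteq> K" for p
    using that
  proof (induction p)
    case Nil
    show ?case using subringE(2)[OF gs] by simp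
  next
    case (Cons c p)
    then show ?case using subringE(6,7)[OF gs] inc pow by simp
  qed
  then show "ev \<tau> ` carrier P \<subseteq> generate_ring C (K \<union> {\<tau>})" unfolding ev_def using P_sub by blast
qed

lemma exists_primarily_limit_intersecting:
  "\<exists>\<tau>\<in>PIdl\<^bsub>C\<^esub> (\<kappa> y). primarily_limit_intersecting R y \<tau>"
proof -
  obtain \<tau> z0 where \<tau>: "\<tau> \<in> carrier C" and z0: "z0 \<in> carrier C" "\<tau> = \<kappa> y \<otimes>\<^bsub>C\<^esub> z0"
    and lifts: "\<And>k f. \<forall>i. f i \<in> carrier P \<Longrightarrow> \<exists>m. spec.lifts_syzygies m k f \<tau>"
    using spec.countable_lifting[OF P_countable] by blast
  interpret PD: domain P by (rule P_domain)
  have triv: "\<exists>M l \<sigma> z. (\<forall>i j. \<sigma> i j \<in> carrier P) \<and> (\<forall>j. z j \<in> carrier C) \<and>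
      (\<forall>j<l. dot P k f (\<lambda>i. \<sigma> i j) = \<zero>\<^bsub>P\<^esub>) \<and>
      (\<forall>i<k. \<kappa> y [^]\<^bsub>C\<^esub> (M::nat) \<otimes>\<^bsub>C\<^esub> x i = dot C l (\<lambda>j. ev \<tau> (\<sigma> i j)) z)"
    if f: "\<forall>i. f i \<in> carrier P" and x: "\<forall>i. x i \<in> carrier C" "dot C k (\<lambda>i. ev \<tau> (f i)) x = \<zero>\<^bsub>C\<^esub>" for k f x
  proof -
    obtain M s where s: "syzygy_span P C (ev \<tau>) k f s" "\<forall>i<k. \<kappa> y [^]\<^bsub>C\<^esub> (M::nat) \<otimes>\<^bsub>C\<^esub> x i = s i"
      using spec.relation_in_syzygy_span[OF \<tau> lifts f x] by blast
    have "ev \<tau> \<in> carrier P \<rightarrow> carrier C" using \<tau> by simp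
    from syzygy_span_explicit[OF s(1) spec.P.ring_axioms C.ring_axioms this]
    obtain l \<sigma> z where "\<forall>i j. \<sigma> i j \<in> carrier P" "\<forall>j. z j \<in> carrier C"
      "\<forall>j<l. dot P k f (\<lambda>i. \<sigma> i j) = \<zero>\<^bsub>P\<^esub>" "\<forall>i. s i = dot C l (\<lambda>j. ev \<tau> (\<sigma> i j)) z" by blast
    with s(2) show ?thesis by (intro exI[of _ M] exI[of _ l] exI[of _ \<sigma>] exI[of _ z] conjI) simp_all
  qed
  have pi: "\<tau> \<in> PIdl\<^bsub>C\<^esub> (\<kappa> y)" unfolding cgenideal_def z0(2) using z0(1) C.m_comm[of "\<kappa> y" z0] by auto
  have one: "\<one>\<^bsub>C\<^esub> \<noteq> \<zero>\<^bsub>C\<^esub>" using domain.one_not_zero[OF K_domain] by simp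
  have trans: "C.transcendental K \<tau>"
    unfolding C.transcendental_def P_eq[symmetric]
  proof (rule inj_onI, rule ccontr)
    fix p q assume p: "p \<in> carrier P" "q \<in> carrier P" "C.eval p \<tau> = C.eval q \<tau>" "p \<noteq> q"
    define h where "h = p \<ominus>\<^bsub>P\<^esub> q"
    have h: "h \<in> carrier P" "h \<noteq> \<zero>\<^bsub>P\<^esub>"
      unfolding h_def using spec.P.minus_closed[OF p(1,2)] spec.P.r_right_minus_eq[OF p(1,2)] p(4) by blast+
    have "ev \<tau> h = \<zero>\<^bsub>C\<^esub>" unfolding h_def spec.ev_minus[OF \<tau> p(1,2)]
      using spec.ev_closed[OF \<tau> p(2)] p(3) by (simp add: ev_def)
    then have d: "dot C 1 (\<lambda>i. ev \<tau> h) (\<lambda>i. \<one>\<^bsub>C\<^esub>) = \<zero>\<^bsub>C\<^esub>" by simp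
    have "\<forall>i::nat. h \<in> carrier P" "\<forall>i::nat. \<one>\<^bsub>C\<^esub> \<in> carrier C" using h by auto
    from triv[OF this d] obtain M l \<sigma> z where *: "\<forall>i j. \<sigma> i j \<in> carrier P" "\<forall>j. z j \<in> carrier C"
      "\<forall>j<l. dot P 1 (\<lambda>i. h) (\<lambda>i. \<sigma> i j) = \<zero>\<^bsub>P\<^esub>"
      "\<kappa> y [^]\<^bsub>C\<^esub> (M::nat) \<otimes>\<^bsub>C\<^esub> \<one>\<^bsub>C\<^esub> = dot C l (\<lambda>j. ev \<tau> (\<sigma> (0::nat) j)) z" by auto
    \<comment> \<open>The family consists of \<open>h\<close> alone, with coefficient one. In the
      domain \<open>P\<close> a nonzero \<open>h\<close> has only the zero syzygy, so the power
      \<open>y^M\<close> itself would vanish.\<close>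
    have "\<sigma> 0 j = \<zero>\<^bsub>P\<^esub>" if "j < l" for j
    proof -
      have "\<zero>\<^bsub>P\<^esub> \<oplus>\<^bsub>P\<^esub> h \<otimes>\<^bsub>P\<^esub> \<sigma> 0 j = \<zero>\<^bsub>P\<^esub>"
        using *(3)[rule_format, OF that] by (simp only: dot.simps One_nat_def)
      moreover have "\<sigma> 0 j \<in> carrier P" using *(1) by blast
      ultimately have "h \<otimes>\<^bsub>P\<^esub> \<sigma> 0 j = \<zero>\<^bsub>P\<^esub>"
        using spec.P.l_zero[OF spec.P.m_closed[OF h(1)]] by metis
      then show ?thesis using PD.integral[of h "\<sigma> 0 j"] h *(1) by blast
    qed
    then have "dot C l (\<lambda>j. ev \<tau> (\<sigma> 0 j)) z = dot C l (\<lambda>j. \<zero>\<^bsub>C\<^esub>) z"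
      by (intro dot_cong) (simp_all add: spec.ev_zero[OF \<tau>])
    also have "\<dots> = dot C l z (\<lambda>j. \<zero>\<^bsub>C\<^esub>)" by (rule C.dot_commute) (use *(2) in auto)
    also have "\<dots> = \<zero>\<^bsub>C\<^esub>" by (rule C.dot_zero[OF *(2)])
    finally have "\<kappa> y [^]\<^bsub>C\<^esub> M \<otimes>\<^bsub>C\<^esub> \<one>\<^bsub>C\<^esub> = \<zero>\<^bsub>C\<^esub>" unfolding *(4) .
    then show False using C_pow_cancel[of "\<one>\<^bsub>C\<^esub>" M] one by simp
  qed
  define A where "A = C\<lparr>carrier := generate_ring C (K \<union> {\<tau>})\<rparr>"
  have AC: "carrier A = ev \<tau> ` carrier P" unfolding A_def using generate_ring_eq[OF \<tau>] by simp
  have A_sub: "carrier A \<subseteq> carrier C" unfolding AC using \<tau> by auto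
  have gs: "subring (carrier A) C" unfolding A_def using C.generate_ring_is_subring[of "K \<union> {\<tau>}"] K_sub \<tau> by simp
  have A_cring: "cring A"
    using C.subcring_iff[THEN iffD1, OF A_sub C.subcringI'[OF gs]] unfolding A_def by simp
  let ?S = "powers_of C (\<kappa> y)"
  have "equationally_flat A (localization C ?S) (loc_map C ?S)"
  proof (rule equationally_flat_localization[OF C_cring \<kappa>_closed[OF y_closed] C_cancel A_sub])
    fix k a x assume a: "\<forall>i. a i \<in> carrier A" and x: "\<forall>i. x i \<in> carrier C" "dot C k a x = \<zero>\<^bsub>C\<^esub>"
    \<comment> \<open>The coefficients are lifted to polynomials; syzygies of the lifts specialize
      at \<open>\<tau>\<close> to solutions over \<open>R[\<tau>]\<close>.\<close>
    have "\<forall>i. \<exists>p. p \<in> carrier P \<and> a i = ev \<tau> p" using a unfolding AC by blast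
    then obtain f where f: "\<forall>i. f i \<in> carrier P" "\<And>i. a i = ev \<tau> (f i)" by metis
    have af: "a = (\<lambda>i. ev \<tau> (f i))" using f(2) by auto
    from triv[OF f(1) x(1) x(2)[unfolded af]] obtain M l \<sigma> z where *: "\<forall>i j. \<sigma> i j \<in> carrier P" "\<forall>j. z j \<in> carrier C"
      "\<forall>j<l. dot P k f (\<lambda>i. \<sigma> i j) = \<zero>\<^bsub>P\<^esub>"
      "\<forall>i<k. \<kappa> y [^]\<^bsub>C\<^esub> (M::nat) \<otimes>\<^bsub>C\<^esub> x i = dot C l (\<lambda>j. ev \<tau> (\<sigma> i j)) z" by blast
    have "dot A k a (\<lambda>i. ev \<tau> (\<sigma> i j)) = \<zero>\<^bsub>A\<^esub>" if "j < l" for j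
    proof -
      have "dot A k a (\<lambda>i. ev \<tau> (\<sigma> i j)) = ev \<tau> (dot P k f (\<lambda>i. \<sigma> i j))"
        unfolding af A_def using spec.ev_dot[OF \<tau> f(1), of "\<lambda>i. \<sigma> i j" k] *(1) by simp
      also have "\<dots> = \<zero>\<^bsub>C\<^esub>" using *(3) that spec.ev_zero[OF \<tau>] by simp
      finally show ?thesis unfolding A_def by simp
    qed
    moreover have "\<forall>i j. ev \<tau> (\<sigma> i j) \<in> carrier A" unfolding AC using *(1) by blast
    ultimately show "\<exists>M l \<sigma> z. (\<forall>i j. \<sigma> i j \<in> carrier A) \<and> (\<forall>j. z j \<in> carrier C) \<and>
        (\<forall>j<l. dot A k a (\<lambda>i. \<sigma> i j) = \<zero>\<^bsub>A\<^esub>) \<and>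
        (\<forall>i<k. \<kappa> y [^]\<^bsub>C\<^esub> (M::nat) \<otimes>\<^bsub>C\<^esub> x i = dot C l (\<sigma> i) z)"
      using *(2,4) by (intro exI[of _ M] exI[of _ l] exI[of _ "\<lambda>i j. ev \<tau> (\<sigma> i j)"] exI[of _ z]) simp
  qed
  moreover interpret F: fractions C ?S
  proof
    show "?S \<subseteq> carrier C" unfolding powers_of_def by auto
    show "\<one>\<^bsub>C\<^esub> \<in> ?S" unfolding powers_of_def by (auto intro!: exI[of _ "0::nat"])
    fix s t assume "s \<in> ?S" "t \<in> ?S"
    then obtain m n :: nat where "s = \<kappa> y [^]\<^bsub>C\<^esub> m" "t = \<kappa> y [^]\<^bsub>C\<^esub> n" unfolding powers_of_def by blast
    then show "s \<otimes>\<^bsub>C\<^esub> t \<in> ?S" unfolding powers_of_def by (auto simp: C.nat_pow_mult)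
  qed
  have "loc_map C ?S \<in> ring_hom A (localization C ?S)"
    using F.loc_map_hom A_sub unfolding ring_hom_def A_def by (auto simp: subset_iff)
  ultimately have "flat_hom A (localization C ?S) (loc_map C ?S)"
    using equationally_flat_imp_flat_hom[OF A_cring F.L_cring] by blast
  then have "primarily_limit_intersecting R y \<tau>"
    unfolding primarily_limit_intersecting_def Let_def A_def K_def \<kappa>_def[symmetric]
    using pi trans unfolding K_def by simp
  then show ?thesis using pi by blast
qed

end

theorem theorem3p8:
  fixes R :: "('a, 'c) ring_scheme" and m :: "'a set" and y :: 'a and d :: nat
  assumes "excellent_ring R"
    and "normal_domain R"
    and "local_ring R m"
    and "countable (carrier R)"
    and "krull_dim R = enat d"
    and "d \<ge> 2"
    and "y \<in> m"
    and "y \<noteq> \<zero>\<^bsub>R\<^esub>"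
  shows "\<exists>\<tau> \<in> PIdl\<^bsub>y_completion R y\<^esub> (y_completion_map R y y).
           primarily_limit_intersecting R y \<tau>"
proof -
  interpret domain R using assms(2) unfolding normal_domain_def by blast
  interpret noetherian_ring R using assms(1) unfolding excellent_ring_def by blast
  interpret m: maximalideal m R using assms(3) unfolding local_ring_def by blast
  \<comment> \<open>Locality together with \<open>y\<close> in \<open>m\<close> supplies the
    inverses of the elements \<open>1 - y r\<close>.\<close>
  interpret local_y_adic R y
    by unfold_locales (use assms m.Icarr local_one_minus_unit[OF noetherian_ring_axioms assms(3,7)] in auto)
  show ?thesis using exists_primarily_limit_intersecting unfolding \<kappa>_def .
qed

end
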